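(* Let $\nu=0$, $T>0$, $\omega>0$, and let $\{\mathcal T_h\}$ be a shape-regular, quasi-uniform family of meshes. Let $d^p$ be the Becker–Hansbo stabilization and $d^u$ the discrete upwinding stabilization (arbitrary $\alpha_{ij}=\alpha_{ji}\in[0,1]$). For each $h$ let $(\mathbf u_i(t),p_i(t))_i$ solve (S1)–(S2) on $[0,T]$ with $\mathbf u_i\in C^1([0,T])$, with finite element functions $\mathbf u_h,p_h$. Assume there is $M$ independent of $h$ with $|\mathbf u_i(t)|\le M$, $|p_i(t)|\le M$, $|\tfrac{d\mathbf u_i}{dt}(t)|\le M$ for all $i,t$, and $\int_0^Th|\mathbf u_h|^2_{H^1(\Omega)}dt\le M$. For a periodic $q\in C^1(\bar\Omega)$ define $e_{q_h}(q,t)=\int_\Omega\mathbf u_h(\cdot,t)\cdot\nabla q\,dx$, and for $\mathbf v\in C^2(\bar\Omega\times[0,T])^d$ periodic in space, vanishing near $t=T$, with $\nabla\cdot\mathbf v=0$, define $$e_{\mathbf u_h}(\mathbf v,t)=\int_\Omega\partial_t\mathbf u_h\cdot\mathbf v\,dx-\int_\Omega(\mathbf u_h\otimes\mathbf u_h):\nabla\mathbf v\,dx,$$ so that $\big[\int_\Omega\mathbf u_h\cdot\mathbf v\,dx\big]_{t=0}^{t=\tau}=\int_0^\tau\!\int_\Omega[\mathbf u_h\cdot\partial_t\mathbf v+(\mathbf u_h\otimes\mathbf u_h):\nabla\mathbf v]\,dx\,dt+\int_0^\tau e_{\mathbf u_h}(\mathbf v,t)\,dt$ for all $\tau\in(0,T]$.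 Then $\|e_{q_h}(q,\cdot)\|_{L^1(0,T)}\to0$ and $\|e_{\mathbf u_h}(\mathbf v,\cdot)\|_{L^1(0,T)}\to0$ as $h\to0$.
   Context: Setting. Let $d\in\{2,3\}$ and let $\Omega\subset\mathbb R^d$ be a box on which periodic boundary conditions are imposed (all functions on $\Omega$ are periodic, so $\Omega$ is effectively a flat torus). $\{\mathcal T_h\}$ is a family of conforming simplicial meshes of $\Omega$ compatible with periodicity, $h$ the maximal element diameter, $h\to0$, with vertices $\mathbf x_1,\dots,\mathbf x_{N_h}$; $\varphi_i$ are the continuous piecewise-linear Lagrange basis functions ($\varphi_i(\mathbf x_j)=\delta_{ij}$), $V_h=\mathrm{span}\{\varphi_i\}$, $\mathbf V_h=(V_h)^d$, $\mathbf u_h=\sum_j\mathbf u_j\varphi_j$, $p_h=\sum_jp_j\varphi_j$. $\mathcal N_i$: indices $j$ (including $i$) with overlapping supports of $\varphi_i,\varphi_j$. $m_{ij}=\int_\Omega\varphi_i\varphi_j$, $m_i=\int_\Omega\varphi_i$, $\mathbf c_{ij}=\int_\Omega\varphi_i\nabla\varphi_j$, $s_{ij}=\int_\Omega\nabla\varphi_i\cdot\nabla\varphi_j$, $\tilde a_{ij}=\frac{\mathbf u_i+\mathbf u_j}{2}\cdot\mathbf c_{ij}$, $a_{ij}=\frac12\int_\Omega[\varphi_i\,\mathbf u_h\cdot\nabla\varphi_j-\varphi_j\,\mathbf u_h\cdot\nabla\varphi_i]dx$ (computed from the current $\mathbf u_h$). Scheme: for all $i,k$, (S1) $m_i\frac{d\mathbf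 u_i}{dt}=\sum_{j\in\mathcal N_i}[(d^u_{ij}-\tilde a_{ij}-\nu s_{ij})\mathbf u_j-\mathbf c_{ij}p_j]$, (S2) $0=\sum_{j\in\mathcal N_k}[d^p_{kj}p_j-\mathbf c_{kj}\cdot\mathbf u_j]$. Becker–Hansbo: $d^p_{ij}=\omega m_{ij}$ ($j\ne i$), $d^p_{ii}=-\sum_{k\ne i}d^p_{ik}$. Discrete upwinding: $d^u_{ij}=(1-\alpha_{ij})|a_{ij}|$ for $j\in\mathcal N_i\setminus\{i\}$, $0$ for $j\notin\mathcal N_i$, $d^u_{ii}=-\sum_{k\ne i}d^u_{ik}$. Notation: $A:\nabla\mathbf w=\sum_{k,l}A_{kl}\partial_lw_k$, $(\mathbf a\otimes\mathbf b)_{kl}=a_kb_l$. *)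

theory Defs
  imports "HOL-Analysis.Analysis"
begin

text \<open>The box Omega = [0,L_1] x ... x [0,L_d] (as a torus). The period lattice.\<close>
definition lattice :: "real^'d \<Rightarrow> (real^'d) set" where
  "lattice L = {z. \<forall>k. \<exists>m::int. z $ k = of_int m * L $ k}"

definition periodic_fun :: "real^'d \<Rightarrow> (real^'d \<Rightarrow> 'b) \<Rightarrow> bool" where
  "periodic_fun L f \<longleftrightarrow> (\<forall>x z. z \<in> lattice L \<longrightarrow> f (x + z) = f x)"

text \<open>A mesh is a set of simplices, each given by its vertex set (d+1 affinely
  independent points); the element is the convex hull. The mesh of the torus is
  represented by its lattice-periodic lift to R^d.\<close>
definition periodic_mesh :: "real^'d \<Rightarrow> (real^'d) set set \<Rightarrow> bool" where
  "periodic_mesh L Tr \<longleftrightarrow>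
     (\<forall>K\<in>Tr. finite K \<and> card K = CARD('d) + 1 \<and> \<not> affine_dependent K)
   \<and> (\<forall>K\<in>Tr. \<forall>z\<in>lattice L. (\<lambda>x. x + z) ` K \<in> Tr)
   \<and> (\<Union>K\<in>Tr. convex hull K) = UNIV
   \<and> (\<forall>K1\<in>Tr. \<forall>K2\<in>Tr. convex hull K1 \<inter> convex hull K2 = convex hull (K1 \<inter> K2))
   \<and> (\<forall>B. bounded B \<longrightarrow> finite {K\<in>Tr. convex hull K \<inter> B \<noteq> {}})"

definition meshsize :: "(real^'d) set set \<Rightarrow> real" where
  "meshsize Tr = Sup ((\<lambda>K. diameter (convex hull K)) ` Tr)"

definition inradius :: "(real^'d) set \<Rightarrow> real" where
  "inradius K = Sup {r. \<exists>c. ball c r \<subseteq> convex hull K}"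

definition bary :: "(real^'d) set \<Rightarrow> real^'d \<Rightarrow> real^'d \<Rightarrow> real" where
  "bary K v x = (SOME \<mu>. (\<Sum>w\<in>K. \<mu> w) = 1 \<and> (\<Sum>w\<in>K. \<mu> w *\<^sub>R w) = x) v"

definition hat :: "(real^'d) set set \<Rightarrow> real^'d \<Rightarrow> real^'d \<Rightarrow> real" where
  "hat Tr v x = (if \<exists>K\<in>Tr. v \<in> K \<and> x \<in> convex hull K
                 then bary (SOME K. K \<in> Tr \<and> v \<in> K \<and> x \<in> convex hull K) v x else 0)"

text \<open>Nodes x_1..x_N: representatives of the vertices in the half-open box.\<close>
definition nodes :: "real^'d \<Rightarrow> (real^'d) set set \<Rightarrow> (real^'d) set" where
  "nodes L Tr = {v. (\<exists>K\<in>Tr. v \<in> K) \<and> (\<forall>k. 0 \<le> v $ k \<and> v $ k < L $ k)}"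

definition phi :: "real^'d \<Rightarrow> (real^'d) set set \<Rightarrow> real^'d \<Rightarrow> real^'d \<Rightarrow> real" where
  "phi L Tr v x = (\<Sum>w \<in> {w. w - v \<in> lattice L \<and> (\<exists>K\<in>Tr. w \<in> K \<and> x \<in> convex hull K)}. hat Tr w x)"

definition fe :: "real^'d \<Rightarrow> (real^'d) set set \<Rightarrow> (real^'d \<Rightarrow> 'b::real_vector) \<Rightarrow> real^'d \<Rightarrow> 'b" where
  "fe L Tr f x = (\<Sum>v\<in>nodes L Tr. phi L Tr v x *\<^sub>R f v)"

definition pd :: "(real^'d \<Rightarrow> real) \<Rightarrow> 'd \<Rightarrow> real^'d \<Rightarrow> real" where
  "pd f l x = frechet_derivative f (at x) (axis l 1)"

definition grad :: "(real^'d \<Rightarrow> real) \<Rightarrow> real^'d \<Rightarrow> real^'d" where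
  "grad f x = (\<chi> l. pd f l x)"

definition C1_on :: "'a::euclidean_space set \<Rightarrow> ('a \<Rightarrow> 'b::real_normed_vector) \<Rightarrow> bool" where
  "C1_on S g \<longleftrightarrow> (\<exists>g'. (\<forall>z\<in>S. (g has_derivative blinfun_apply (g' z)) (at z within S))
                        \<and> continuous_on S g')"

definition C2_on :: "'a::euclidean_space set \<Rightarrow> ('a \<Rightarrow> 'b::real_normed_vector) \<Rightarrow> bool" where
  "C2_on S g \<longleftrightarrow> (\<exists>g'. (\<forall>z\<in>S. (g has_derivative blinfun_apply (g' z)) (at z within S))
                        \<and> C1_on S g')"

definition mass_lumped :: "real^'d \<Rightarrow> (real^'d) set set \<Rightarrow> real^'d \<Rightarrow> real" where
  "mass_lumped L Tr i = integral (cbox 0 L) (phi L Tr i)"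

definition mass :: "real^'d \<Rightarrow> (real^'d) set set \<Rightarrow> real^'d \<Rightarrow> real^'d \<Rightarrow> real" where
  "mass L Tr i j = integral (cbox 0 L) (\<lambda>x. phi L Tr i x * phi L Tr j x)"

definition cvec :: "real^'d \<Rightarrow> (real^'d) set set \<Rightarrow> real^'d \<Rightarrow> real^'d \<Rightarrow> real^'d" where
  "cvec L Tr i j = integral (cbox 0 L) (\<lambda>x. phi L Tr i x *\<^sub>R grad (phi L Tr j) x)"

definition nbrs :: "real^'d \<Rightarrow> (real^'d) set set \<Rightarrow> real^'d \<Rightarrow> (real^'d) set" where
  "nbrs L Tr i = {j \<in> nodes L Tr. \<exists>x. phi L Tr i x \<noteq> 0 \<and> phi L Tr j x \<noteq> 0}"

definition atil :: "real^'d \<Rightarrow> (real^'d) set set \<Rightarrow> (real^'d \<Rightarrow> real^'d) \<Rightarrow> real^'d \<Rightarrow> real^'d \<Rightarrow> real" where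
  "atil L Tr U i j = inner ((1/2) *\<^sub>R (U i + U j)) (cvec L Tr i j)"

definition aij :: "real^'d \<Rightarrow> (real^'d) set set \<Rightarrow> (real^'d \<Rightarrow> real^'d) \<Rightarrow> real^'d \<Rightarrow> real^'d \<Rightarrow> real" where
  "aij L Tr U i j = (1/2) * integral (cbox 0 L)
     (\<lambda>x. phi L Tr i x * inner (fe L Tr U x) (grad (phi L Tr j) x)
        - phi L Tr j x * inner (fe L Tr U x) (grad (phi L Tr i) x))"

definition dU :: "real^'d \<Rightarrow> (real^'d) set set \<Rightarrow> (real^'d \<Rightarrow> real^'d \<Rightarrow> real) \<Rightarrow> (real^'d \<Rightarrow> real^'d)
                  \<Rightarrow> real^'d \<Rightarrow> real^'d \<Rightarrow> real" where
  "dU L Tr \<alpha> U i j =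
     (if j = i then - (\<Sum>k\<in>nbrs L Tr i - {i}. (1 - \<alpha> i k) * \<bar>aij L Tr U i k\<bar>)
      else if j \<in> nbrs L Tr i then (1 - \<alpha> i j) * \<bar>aij L Tr U i j\<bar> else 0)"

definition dP :: "real^'d \<Rightarrow> (real^'d) set set \<Rightarrow> real \<Rightarrow> real^'d \<Rightarrow> real^'d \<Rightarrow> real" where
  "dP L Tr \<omega> i j =
     (if j = i then - (\<Sum>k\<in>nodes L Tr - {i}. \<omega> * mass L Tr i k) else \<omega> * mass L Tr i j)"

definition H1semi_sq :: "real^'d \<Rightarrow> (real^'d) set set \<Rightarrow> (real^'d \<Rightarrow> real^'d) \<Rightarrow> real" where
  "H1semi_sq L Tr U = integral (cbox 0 L)
     (\<lambda>x. \<Sum>k\<in>UNIV. \<Sum>l\<in>UNIV. (pd (\<lambda>y. fe L Tr U y $ k) l x)\<^sup>2)"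

definition err_q :: "real^'d \<Rightarrow> (real^'d) set set \<Rightarrow> (real^'d \<Rightarrow> real^'d) \<Rightarrow> (real^'d \<Rightarrow> real) \<Rightarrow> real" where
  "err_q L Tr U q = integral (cbox 0 L) (\<lambda>x. inner (fe L Tr U x) (grad q x))"

text \<open>e_{u_h}(v,t) = int d_t u_h . v - int (u_h (x) u_h) : grad v, with U the nodal
  velocities, DU their time derivatives and vt = v(.,t).\<close>
definition err_u :: "real^'d \<Rightarrow> (real^'d) set set \<Rightarrow> (real^'d \<Rightarrow> real^'d) \<Rightarrow> (real^'d \<Rightarrow> real^'d)
                     \<Rightarrow> (real^'d \<Rightarrow> real^'d) \<Rightarrow> real" where
  "err_u L Tr U DU vt =
     integral (cbox 0 L) (\<lambda>x. inner (fe L Tr DU x) (vt x))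
   - integral (cbox 0 L) (\<lambda>x. \<Sum>k\<in>UNIV. \<Sum>l\<in>UNIV.
        (fe L Tr U x $ k * fe L Tr U x $ l) * pd (\<lambda>y. vt y $ k) l x)"

end

theory Submission
  imports Defs
begin

text \<open>
  Let \<open>D\<close> be the Frobenius norm of the velocity gradient. At almost every point of an element,
  nodal velocity differences are at most \<open>h D\<close> and the gradients of the basis functions sum up to
  \<open>O(1/h)\<close>. Every consistency error then has an integrand bounded by a multiple of
  \<open>h + h D \<le> 2 (\<surd>h + h \<surd>h D\<^sup>2)\<close>, whose space-time integral is \<open>O(\<surd>h)\<close> by the bound on
  \<open>\<integral> h |u\<^sub>h|\<^sup>2\<close>. The divergence of \<open>u\<^sub>h\<close> tends to zero weakly because the pressure
  stabilisation is a symmetric sum of pressure differences, so the difference can be moved to the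
  test function; this also removes the term \<open>\<integral> (div u\<^sub>h) (u\<^sub>h \<cdot> v) / 2\<close> by which the
  discrete convection differs from the conservative form. The pressure gradient, only
  \<open>O(1/h)\<close>, is tested with the interpolation error of a \<open>C\<^sup>2\<close> field, which is \<open>O(h\<^sup>2)\<close>.
  All integrations by parts reduce to the vanishing of the integral of a partial derivative of a
  periodic Lipschitz function, seen from difference quotients.
\<close>

section \<open>Essentially bounded measurable functions\<close>

text \<open>All estimates are pointwise in x. A double sum over nodes with coefficients
  \<open>mass\<close>, \<open>cvec\<close> or a bound for \<open>dU\<close> is rewritten as one
  integral over the box; at a point off the element boundaries only the vertices of the element
  around it contribute. No stencil is counted and no reference element is used: sums weighted by the
  basis functions are convex combinations, and a sum weighted by their gradients costs one factor
  1/h. A term must therefore supply one power of h beyond the one that cancels its gradient. For the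
  pressure both come from the interpolation error; for upwinding and convection one comes from the
  test function and one, in the form h D, from the velocity.

  The obstacle to this plan is that \<open>pd\<close> is an arbitrary choice wherever the function
  is not differentiable, so a gradient is neither bounded nor measurable by construction, and an
  integral that does not exist has the value 0 by default. Linearity of the integral thus needs
  integrability of every term. The class \<open>ebm\<close> supplies it: it ignores a null set, is
  closed under the algebra that occurs, and implies integrability on a box.\<close>

definition ebm :: "'a::euclidean_space set \<Rightarrow> ('a \<Rightarrow> real) \<Rightarrow> bool" where
  "ebm S f \<longleftrightarrow> (\<exists>N g B. negligible N \<and> g \<in> borel_measurable (lebesgue_on S)
      \<and> (\<forall>x\<in>S. \<bar>g x\<bar> \<le> B) \<and> (\<forall>x\<in>S - N. f x = g x))"

lemma ebmE:
  assumes "ebm S f"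
  obtains N g B where "negligible N" "g \<in> borel_measurable (lebesgue_on S)"
    "\<And>x. x \<in> S \<Longrightarrow> \<bar>g x\<bar> \<le> B" "\<And>x. x \<in> S - N \<Longrightarrow> f x = g x"
  using assms unfolding ebm_def by blast

lemma ebmI:
  assumes "negligible N" "g \<in> borel_measurable (lebesgue_on S)"
    "\<And>x. x \<in> S \<Longrightarrow> \<bar>g x\<bar> \<le> B" "\<And>x. x \<in> S - N \<Longrightarrow> f x = g x"
  shows "ebm S f"
  using assms unfolding ebm_def by blast

lemma ebm_const [intro, simp]: "ebm S (\<lambda>x. c)"
  by (rule ebmI[of "{}" "\<lambda>x. c" S "\<bar>c\<bar>"]) auto

lemma ebm_continuous:
  assumes "compact S" "continuous_on S f"
  shows "ebm S f"
proof -
  obtain B where "\<forall>x\<in>S. norm (f x) \<le> B"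
    using compact_imp_bounded[OF compact_continuous_image[OF assms(2,1)]]
    unfolding bounded_iff by auto
  then show ?thesis
    using assms continuous_imp_measurable_on_sets_lebesgue[OF assms(2)]
    by (intro ebmI[of "{}" f S B]) (auto simp: lmeasurable_compact fmeasurableD)
qed

lemma ebm_add [intro]:
  assumes "ebm S f" "ebm S g"
  shows "ebm S (\<lambda>x. f x + g x)"
proof -
  obtain N1 f' B1 where 1: "negligible N1" "f' \<in> borel_measurable (lebesgue_on S)"
    "\<And>x. x \<in> S \<Longrightarrow> \<bar>f' x\<bar> \<le> B1" "\<And>x. x \<in> S - N1 \<Longrightarrow> f x = f' x"
    using ebmE[OF assms(1)] by blast
  obtain N2 g' B2 where 2: "negligible N2" "g' \<in> borel_measurable (lebesgue_on S)"
    "\<And>x. x \<in> S \<Longrightarrow> \<bar>g' x\<bar> \<le> B2" "\<And>x. x \<in> S - N2 \<Longrightarrow> g x = g' x"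
    using ebmE[OF assms(2)] by blast
  show ?thesis
  proof (rule ebmI[of "N1 \<union> N2" "\<lambda>x. f' x + g' x" S "B1 + B2"])
    show "\<bar>f' x + g' x\<bar> \<le> B1 + B2" if "x \<in> S" for x
      using 1(3)[OF that] 2(3)[OF that] by linarith
  qed (use 1 2 in auto)
qed

lemma ebm_mult [intro]:
  assumes "ebm S f" "ebm S g"
  shows "ebm S (\<lambda>x. f x * g x)"
proof -
  obtain N1 f' B1 where 1: "negligible N1" "f' \<in> borel_measurable (lebesgue_on S)"
    "\<And>x. x \<in> S \<Longrightarrow> \<bar>f' x\<bar> \<le> B1" "\<And>x. x \<in> S - N1 \<Longrightarrow> f x = f' x"
    using ebmE[OF assms(1)] by blast
  obtain N2 g' B2 where 2: "negligible N2" "g' \<in> borel_measurable (lebesgue_on S)"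
    "\<And>x. x \<in> S \<Longrightarrow> \<bar>g' x\<bar> \<le> B2" "\<And>x. x \<in> S - N2 \<Longrightarrow> g x = g' x"
    using ebmE[OF assms(2)] by blast
  show ?thesis
  proof (rule ebmI[of "N1 \<union> N2" "\<lambda>x. f' x * g' x" S "B1 * B2"])
    show "\<bar>f' x * g' x\<bar> \<le> B1 * B2" if "x \<in> S" for x
      using mult_mono[OF 1(3)[OF that] 2(3)[OF that]] 1(3)[OF that]
      by (simp add: abs_mult)
  qed (use 1 2 in auto)
qed

lemma ebm_minus [intro]: "ebm S f \<Longrightarrow> ebm S (\<lambda>x. - f x)"
  using ebm_mult[of S "\<lambda>x. -1" f] by simp

lemma ebm_diff [intro]: "ebm S f \<Longrightarrow> ebm S g \<Longrightarrow> ebm S (\<lambda>x. f x - g x)"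
  using ebm_add[of S f "\<lambda>x. - g x"] by auto

lemma ebm_power [intro]: "ebm S f \<Longrightarrow> ebm S (\<lambda>x. f x ^ n)"
  by (induction n) auto

lemma ebm_sum [intro]: "(\<And>i. i \<in> I \<Longrightarrow> ebm S (f i)) \<Longrightarrow> ebm S (\<lambda>x. \<Sum>i\<in>I. f i x)"
  by (induction I rule: infinite_finite_induct) auto

lemma ebm_sqrt:
  assumes "ebm S f"
  shows "ebm S (\<lambda>x. sqrt (f x))"
proof -
  obtain N g B where *: "negligible N" "g \<in> borel_measurable (lebesgue_on S)"
    "\<And>x. x \<in> S \<Longrightarrow> \<bar>g x\<bar> \<le> B" "\<And>x. x \<in> S - N \<Longrightarrow> f x = g x"
    using ebmE[OF assms] by blast
  show ?thesis
  proof (rule ebmI[of N "\<lambda>x. sqrt (g x)" S "sqrt B"])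
    show "\<bar>sqrt (g x)\<bar> \<le> sqrt B" if "x \<in> S" for x
    proof -
      \<comment> \<open>\<open>sqrt\<close> is extended to negative arguments as an odd function, so
        the bound holds for either sign of \<open>g x\<close>.\<close>
      have "\<bar>sqrt (g x)\<bar> = sqrt \<bar>g x\<bar>" by (simp add: abs_if real_sqrt_minus)
      then show ?thesis using *(3)[OF that] by simp
    qed
  qed (use * in auto)
qed

lemma ebm_abs [intro]: "ebm S f \<Longrightarrow> ebm S (\<lambda>x. \<bar>f x\<bar>)"
  using ebm_sqrt[OF ebm_power[of S f 2]] by simp

lemma ebm_inner:
  fixes f g :: "'a::euclidean_space \<Rightarrow> real^'n"
  assumes "\<And>l. ebm S (\<lambda>x. f x $ l)" "\<And>l. ebm S (\<lambda>x. g x $ l)"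
  shows "ebm S (\<lambda>x. inner (f x) (g x))"
  unfolding inner_vec_def inner_real_def by (intro ebm_sum ebm_mult assms)

lemma ebm_norm:
  fixes f :: "'a::euclidean_space \<Rightarrow> real^'n"
  assumes "\<And>l. ebm S (\<lambda>x. f x $ l)"
  shows "ebm S (\<lambda>x. norm (f x))"
  unfolding norm_eq_sqrt_inner by (intro ebm_sqrt ebm_inner assms)

lemma ebm_integrable:
  assumes "ebm (cbox a b) f"
  shows "f integrable_on cbox a b"
proof -
  obtain N g B where *: "negligible N" "g \<in> borel_measurable (lebesgue_on (cbox a b))"
    "\<And>x. x \<in> cbox a b \<Longrightarrow> \<bar>g x\<bar> \<le> B" "\<And>x. x \<in> cbox a b - N \<Longrightarrow> f x = g x"
    using ebmE[OF assms] by blast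
  have "g integrable_on cbox a b"
    by (rule measurable_bounded_by_integrable_imp_integrable[of _ _ "\<lambda>x. B"]) (use * in auto)
  then show ?thesis
    by (rule integrable_spike[OF _ *(1) *(4)])
qed

text \<open>On \<open>N\<close> both integrands are overwritten by 0. This changes no integral and
  turns the almost-everywhere inequality into one that holds at every point.\<close>

lemma integral_abs_le_ae:
  assumes "ebm (cbox a b) f" "ebm (cbox a b) g" "negligible N"
    and "\<And>x. x \<in> cbox a b - N \<Longrightarrow> \<bar>f x\<bar> \<le> g x"
  shows "\<bar>integral (cbox a b) f\<bar> \<le> integral (cbox a b) g"
proof -
  let ?f = "\<lambda>x. if x \<in> N then 0 else f x" and ?g = "\<lambda>x. if x \<in> N then 0 else g x"
  have "integral (cbox a b) f = integral (cbox a b) ?f" "integral (cbox a b) g = integral (cbox a b) ?g"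
    by (rule integral_spike[OF assms(3)]; simp)+
  moreover have "?f integrable_on cbox a b" "?g integrable_on cbox a b"
    by (rule integrable_spike[OF ebm_integrable[OF assms(1)] assms(3)], simp,
        rule integrable_spike[OF ebm_integrable[OF assms(2)] assms(3)], simp)
  ultimately show ?thesis
    using integral_norm_bound_integral[of ?f "cbox a b" ?g] assms(4) by auto
qed

text \<open>Brings partial derivatives into the class: they arise as limits of difference quotients,
  of which only integrability and an almost-everywhere bound survive.\<close>

lemma ebm_of_integrable:
  assumes "f integrable_on cbox a b" "negligible N" "\<And>x. x \<in> cbox a b - N \<Longrightarrow> \<bar>f x\<bar> \<le> B"
  shows "ebm (cbox a b) f"
proof -
  let ?f = "\<lambda>x. if x \<in> N then 0 else f x"
  have "?f integrable_on cbox a b"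
    by (rule integrable_spike[OF assms(1,2)]) auto
  then have "?f \<in> borel_measurable (lebesgue_on (cbox a b))"
    by (rule integrable_imp_measurable)
  then show ?thesis
    by (rule ebmI[OF assms(2), of _ _ "max 0 B"]) (use assms(3) in force)+
qed

section \<open>Integration by parts on the torus\<close>

lemma has_derivative_pd: "(f has_derivative f') (at x) \<Longrightarrow> pd f l x = f' (axis l 1)"
  unfolding pd_def using frechet_derivative_at by metis

lemma pd_mult:
  assumes "f differentiable at x" "g differentiable at x"
  shows "pd (\<lambda>y. f y * g y) l x = pd f l x * g x + f x * pd g l x"
proof -
  obtain f' g' where *: "(f has_derivative f') (at x)" "(g has_derivative g') (at x)"
    using assms unfolding differentiable_def by blast
  show ?thesis
    using has_derivative_pd[OF has_derivative_mult[OF *]] *[THEN has_derivative_pd] by simp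
qed

lemma pd_sum:
  assumes "\<And>i. i \<in> I \<Longrightarrow> f i differentiable at x"
  shows "pd (\<lambda>y. \<Sum>i\<in>I. f i y) l x = (\<Sum>i\<in>I. pd (f i) l x)"
proof -
  have "\<forall>i. \<exists>f'. i \<in> I \<longrightarrow> (f i has_derivative f') (at x)"
    using assms unfolding differentiable_def by blast
  then obtain f' where *: "\<And>i. i \<in> I \<Longrightarrow> (f i has_derivative f' i) (at x)"
    by metis
  show ?thesis
    using has_derivative_pd[OF has_derivative_sum[of I f f', OF *]]
      has_derivative_pd[OF *] by simp
qed

lemma pd_const_mult:
  assumes "f differentiable at x"
  shows "pd (\<lambda>y. c * f y) l x = c * pd f l x"
  using pd_mult[of "\<lambda>y. c" x f l] assms has_derivative_pd[OF has_derivative_const, of c l x]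
  by simp

text \<open>The enlarged box leaves room for the difference quotients at points of the box.\<close>

definition torus_lip :: "real^'d \<Rightarrow> (real^'d \<Rightarrow> real) \<Rightarrow> bool" where
  "torus_lip L f \<longleftrightarrow> periodic_fun L f \<and> (\<exists>C. C-lipschitz_on (cbox (-1) (L + 1)) f)
     \<and> (\<exists>N. negligible N \<and> (\<forall>x\<in>cbox 0 L - N. f differentiable at x))"

lemma torus_lip_continuous:
  "torus_lip L f \<Longrightarrow> continuous_on (cbox (-1) (L + 1)) f"
  unfolding torus_lip_def using lipschitz_on_continuous_on by blast

lemma box_subset_enlarged: "cbox 0 L \<subseteq> cbox (-1) (L + 1 :: real^'d)"
proof
  fix x assume x: "x \<in> cbox 0 L"
  have "- 1 \<le> x $ i \<and> x $ i \<le> L $ i + 1" for i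
    using x[unfolded mem_box_cart, rule_format, of i] by auto
  then show "x \<in> cbox (-1) (L + 1)" by (auto simp: mem_box_cart)
qed

lemma torus_lip_ebm:
  assumes "torus_lip L f"
  shows "ebm (cbox 0 L) f"
  using ebm_continuous[OF compact_cbox continuous_on_subset[OF torus_lip_continuous[OF assms] box_subset_enlarged]] .

lemma torus_lip_add:
  assumes "torus_lip L f" "torus_lip L g"
  shows "torus_lip L (\<lambda>x. f x + g x)"
proof -
  obtain C D N N' where "C-lipschitz_on (cbox (-1) (L + 1)) f" "D-lipschitz_on (cbox (-1) (L + 1)) g"
    "negligible N" "negligible N'" "\<forall>x\<in>cbox 0 L - N. f differentiable at x"
    "\<forall>x\<in>cbox 0 L - N'. g differentiable at x"
    using assms unfolding torus_lip_def by blast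
  then have "(C + D)-lipschitz_on (cbox (-1) (L + 1)) (\<lambda>x. f x + g x)"
    "negligible (N \<union> N')" "\<forall>x\<in>cbox 0 L - (N \<union> N'). (\<lambda>x. f x + g x) differentiable at x"
    by (auto intro: lipschitz_on_add)
  moreover have "periodic_fun L (\<lambda>x. f x + g x)"
    using assms unfolding torus_lip_def periodic_fun_def by simp
  ultimately show ?thesis unfolding torus_lip_def by blast
qed

lemma torus_lip_mult:
  assumes "torus_lip L f" "torus_lip L g"
  shows "torus_lip L (\<lambda>x. f x * g x)"
proof -
  obtain C D N N' where *: "C-lipschitz_on (cbox (-1) (L + 1)) f" "D-lipschitz_on (cbox (-1) (L + 1)) g"
    "negligible N" "negligible N'" "\<forall>x\<in>cbox 0 L - N. f differentiable at x"
    "\<forall>x\<in>cbox 0 L - N'. g differentiable at x"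
    using assms unfolding torus_lip_def by blast
  have bdd: "bounded (f ` cbox (-1) (L + 1))" "bounded (g ` cbox (-1) (L + 1))"
    using assms torus_lip_continuous compact_continuous_image compact_imp_bounded compact_cbox by blast+
  obtain A B where A: "\<And>x. x \<in> cbox (-1) (L + 1) \<Longrightarrow> \<bar>f x\<bar> \<le> A"
    and B: "\<And>x. x \<in> cbox (-1) (L + 1) \<Longrightarrow> \<bar>g x\<bar> \<le> B"
    using bdd unfolding bounded_iff by auto
  have "(\<bar>A\<bar> * D + \<bar>B\<bar> * C)-lipschitz_on (cbox (-1) (L + 1)) (\<lambda>x. f x * g x)"
  proof (rule lipschitz_onI)
    show "0 \<le> \<bar>A\<bar> * D + \<bar>B\<bar> * C"
      using *(1,2)[THEN lipschitz_on_nonneg] by simp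
    fix x y assume xy: "x \<in> cbox (-1) (L + 1)" "y \<in> cbox (-1) (L + 1)"
    have "f x * g x - f y * g y = f x * (g x - g y) + g y * (f x - f y)"
      by (simp add: algebra_simps)
    then have "\<bar>f x * g x - f y * g y\<bar> \<le> \<bar>f x\<bar> * \<bar>g x - g y\<bar> + \<bar>g y\<bar> * \<bar>f x - f y\<bar>"
      by (metis abs_mult abs_triangle_ineq)
    also have "\<dots> \<le> \<bar>A\<bar> * (D * dist x y) + \<bar>B\<bar> * (C * dist x y)"
      using A[OF xy(1)] B[OF xy(2)] lipschitz_onD[OF *(1) xy] lipschitz_onD[OF *(2) xy]
      by (intro add_mono mult_mono) (auto simp: dist_real_def)
    finally show "dist (f x * g x) (f y * g y) \<le> (\<bar>A\<bar> * D + \<bar>B\<bar> * C) * dist x y"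
      by (simp add: dist_real_def algebra_simps)
  qed
  moreover have "negligible (N \<union> N')" "\<forall>x\<in>cbox 0 L - (N \<union> N'). (\<lambda>x. f x * g x) differentiable at x"
    using * by auto
  moreover have "periodic_fun L (\<lambda>x. f x * g x)"
    using assms unfolding torus_lip_def periodic_fun_def by simp
  ultimately show ?thesis unfolding torus_lip_def by blast
qed

lemma torus_lip_const: "torus_lip L (\<lambda>x. c)"
  unfolding torus_lip_def periodic_fun_def
  by (auto intro!: exI[of _ "0::real"] exI[of _ "{}"] lipschitz_onI)

lemma torus_lip_sum:
  "(\<And>i. i \<in> I \<Longrightarrow> torus_lip L (f i)) \<Longrightarrow> torus_lip L (\<lambda>x. \<Sum>i\<in>I. f i x)"
  by (induction I rule: infinite_finite_induct) (auto intro: torus_lip_add torus_lip_const)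

lemma axis_period_in_lattice: "axis l (L $ l) \<in> lattice L"
  unfolding lattice_def
  by (auto simp: axis_def intro: exI[of _ 1] exI[of _ 0] intro!: exI[of _ "if k = l then 1 else 0" for k])

text \<open>The translated box differs from the box by a slab that is moved by a full period.\<close>

lemma integral_periodic_translate:
  fixes f :: "real^'d \<Rightarrow> real"
  assumes L: "\<forall>k. 0 < L $ k" and per: "periodic_fun L f"
    and cont: "continuous_on (cbox (-1) (L + 1)) f" and e: "0 \<le> e" "e \<le> 1" "e \<le> L $ l"
  shows "(\<lambda>x. f (x + axis l e)) integrable_on cbox 0 L"
    "integral (cbox 0 L) (\<lambda>x. f (x + axis l e)) = integral (cbox 0 L) f"
proof -
  define E where "E = axis l e"
  define P where "P = axis l (L $ l)"
  have mb: "x \<in> cbox c c' \<longleftrightarrow> (c $ l \<le> x $ l \<and> x $ l \<le> c' $ l)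
      \<and> (\<forall>i. i \<noteq> l \<longrightarrow> c $ i \<le> x $ i \<and> x $ i \<le> c' $ i)" for x c c' :: "real^'d"
    by (auto simp: mem_box_cart)
  have ia: "x \<bullet> axis l 1 = x $ l" for x :: "real^'d"
    by (simp add: inner_axis)
  have b: "axis l (1::real) \<in> Basis" by (simp add: axis_in_Basis_iff)
  have sub: "cbox E (L + E) \<subseteq> cbox (-1) (L + 1)" "cbox 0 (L + E) \<subseteq> cbox (-1) (L + 1)"
    using e by (force simp: mb E_def axis_def)+
  have int: "f integrable_on cbox 0 (L + E)" "f integrable_on cbox E (L + E)"
    using sub cont by (blast intro: integrable_continuous continuous_on_subset)+
  have tr: "(\<lambda>x. f (x + c)) integrable_on cbox a' b' \<and> integral (cbox a' b') (\<lambda>x. f (x + c)) = integral (cbox (a' + c) (b' + c)) f"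
    if "f integrable_on cbox (a' + c) (b' + c)" for a' b' c
  proof -
    have "(f has_integral integral (cbox (a' + c) (b' + c)) f) (cbox (a' + c) (b' + c))"
      using that by blast
    from has_integral_affinity[OF this, of 1 c]
    have "((\<lambda>x. f (x + c)) has_integral integral (cbox (a' + c) (b' + c)) f) ((\<lambda>x. x - c) ` cbox (a' + c) (b' + c))"
      by simp
    moreover have "(\<lambda>x. x - c) ` cbox (a' + c) (b' + c) = cbox a' b'"
      using cbox_translation[of "-c" "a' + c" "b' + c"] by simp
    ultimately show ?thesis by (metis integrable_integral has_integral_integrable integral_unique)
  qed
  show "(\<lambda>x. f (x + axis l e)) integrable_on cbox 0 L"
    using tr[of 0 E L] int unfolding E_def by simp
  have "integral (cbox 0 L) (\<lambda>x. f (x + E)) = integral (cbox E (L + E)) f"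
    using tr[of 0 E L] int by simp
  \<comment> \<open>The box lengthened by \<open>e\<close> in direction \<open>l\<close> is cut once
    at height \<open>e\<close> and once at height \<open>L $ l\<close>. Comparing the two
    decompositions leaves two slabs that differ by the translation \<open>P\<close>.\<close>
  moreover have s1: "cbox 0 (L + E) \<inter> {x. x \<bullet> axis l 1 \<le> e} = cbox 0 (L - P + E)"
    using e unfolding ia by (auto simp: mb E_def P_def axis_def)
  moreover have s2: "cbox 0 (L + E) \<inter> {x. x \<bullet> axis l 1 \<ge> e} = cbox E (L + E)"
    using e unfolding ia by (auto simp: mb E_def P_def axis_def)
  moreover have s3: "cbox 0 (L + E) \<inter> {x. x \<bullet> axis l 1 \<le> L $ l} = cbox 0 L"
    using e unfolding ia by (auto simp: mb E_def P_def axis_def)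
  moreover have s4: "cbox 0 (L + E) \<inter> {x. x \<bullet> axis l 1 \<ge> L $ l} = cbox P (L + E)"
    using e unfolding ia by (auto simp: mb E_def P_def axis_def)
  moreover have "integral (cbox 0 (L - P + E)) f = integral (cbox P (L + E)) f"
  proof -
    have "cbox P (L + E) \<subseteq> cbox 0 (L + E)" using s4 by blast
    then have "f integrable_on cbox (0 + P) (L - P + E + P)"
      using int(1) integrable_on_subcbox by (metis add_0 add_diff_eq diff_add_cancel add.assoc add.commute)
    from tr[OF this] have "integral (cbox 0 (L - P + E)) (\<lambda>x. f (x + P)) = integral (cbox P (L + E)) f"
      by (simp add: algebra_simps)
    moreover have "(\<lambda>x. f (x + P)) = f"
      using per axis_period_in_lattice unfolding periodic_fun_def P_def by blast
    ultimately show ?thesis by simp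
  qed
  ultimately show "integral (cbox 0 L) (\<lambda>x. f (x + axis l e)) = integral (cbox 0 L) f"
    using integral_split[OF int(1) b, of e] integral_split[OF int(1) b, of "L $ l"]
    unfolding E_def by simp
qed

text \<open>The quotients \<open>q n\<close> have integral 0 by translation invariance and are
  dominated by the Lipschitz constant. Dominated convergence passes integrability and the zero
  integral on to \<open>pd f l\<close>, and the pointwise limit inherits the bound.\<close>

lemma torus_lip_pd:
  fixes f :: "real^'d \<Rightarrow> real"
  assumes L: "\<forall>k. 0 < L $ k" and f: "torus_lip L f"
  shows "ebm (cbox 0 L) (pd f l)" "integral (cbox 0 L) (pd f l) = 0"
proof -
  obtain C N where per: "periodic_fun L f" and lip: "C-lipschitz_on (cbox (-1) (L + 1)) f"
    and N: "negligible N" and diff: "\<And>x. x \<in> cbox 0 L - N \<Longrightarrow> f differentiable at x"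
    using f unfolding torus_lip_def by blast
  note cont = torus_lip_continuous[OF f]
  \<comment> \<open>Steps of length at most \<open>m\<close> neither leave the enlarged box nor
    exceed one period.\<close>
  define m where "m = min 1 (L $ l)"
  have m: "0 < m" "m \<le> 1" "m \<le> L $ l" using L unfolding m_def by auto
  define e where "e n = m / real (Suc n)" for n
  have e: "0 < e n" "e n \<le> 1" "e n \<le> L $ l" for n
  proof -
    have "e n \<le> m" unfolding e_def using m(1) by (simp add: divide_le_eq mult_left_le)
    then show "0 < e n" "e n \<le> 1" "e n \<le> L $ l"
      using m by (auto simp: e_def)
  qed
  have ax: "axis l (e n) = e n *\<^sub>R axis l 1" for n
    by (simp add: vec_eq_iff axis_def)
  have e0: "e \<longlonglongrightarrow> 0"
    unfolding e_def using LIMSEQ_Suc[OF lim_const_over_n[of m]] by simp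
  define q where "q n x = (f (x + axis l (e n)) - f x) / e n" for n x
  have mem: "x + axis l (e n) \<in> cbox (-1) (L + 1)" if "x \<in> cbox 0 L" for x n
  proof -
    have "- 1 \<le> x $ i + axis l (e n) $ i \<and> x $ i + axis l (e n) $ i \<le> L $ i + 1" for i
      using that[unfolded mem_box_cart, rule_format, of i] e[of n] by (auto simp: axis_def)
    then show ?thesis by (auto simp: mem_box_cart)
  qed
  have qint: "q n integrable_on cbox 0 L" and qI: "integral (cbox 0 L) (q n) = 0" for n
  proof -
    note T = integral_periodic_translate[OF L per cont less_imp_le[OF e(1)[of n]] e(2,3)]
    have fi: "f integrable_on cbox 0 L"
      using cont box_subset_enlarged by (blast intro: integrable_continuous continuous_on_subset)
    have d: "(\<lambda>x. f (x + axis l (e n)) - f x) integrable_on cbox 0 L"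
      by (rule integrable_diff[OF T(1) fi])
    show "q n integrable_on cbox 0 L"
      unfolding q_def using d by (rule integrable_on_divide)
    show "integral (cbox 0 L) (q n) = 0"
      unfolding q_def using T fi by (simp add: integral_diff)
  qed
  have qb: "\<bar>q n x\<bar> \<le> C" if "x \<in> cbox 0 L" for n x
  proof -
    have "dist (f (x + axis l (e n))) (f x) \<le> C * dist (x + axis l (e n)) x"
      using lipschitz_onD[OF lip mem[OF that]] that box_subset_enlarged by blast
    then have "\<bar>f (x + axis l (e n)) - f x\<bar> \<le> C * e n"
      using e[of n] ax[of n] by (simp add: dist_norm norm_axis_1)
    then show ?thesis
      using e(1)[of n] by (simp add: q_def divide_le_eq)
  qed
  have qlim: "(\<lambda>n. q n x) \<longlonglongrightarrow> pd f l x" if x: "x \<in> cbox 0 L - N" for x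
  proof -
    obtain f' where f': "(f has_derivative f') (at x)"
      using diff[OF x] unfolding differentiable_def by blast
    have "((\<lambda>t. f (x + t *\<^sub>R axis l 1)) has_derivative (\<lambda>t. f' (t *\<^sub>R axis l 1))) (at 0)"
      by (rule has_derivative_compose[of "\<lambda>t. x + t *\<^sub>R axis l 1" "\<lambda>t. t *\<^sub>R axis l 1" 0 UNIV f f', simplified])
         (auto intro!: derivative_eq_intros f')
    then have "((\<lambda>t. f (x + t *\<^sub>R axis l 1)) has_real_derivative f' (axis l 1)) (at 0)"
      unfolding has_field_derivative_def using linear_cmul[OF has_derivative_linear[OF f']]
      by (simp add: mult_commute_abs)
    then have "((\<lambda>t. (f (x + t *\<^sub>R axis l 1) - f x) / t) \<longlongrightarrow> f' (axis l 1)) (at 0)"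
      unfolding has_field_derivative_iff by simp
    note lim = this
    have ef: "filterlim e (at 0) sequentially"
      using e0 e(1) by (auto simp: filterlim_at less_imp_neq[symmetric] intro!: always_eventually)
    show ?thesis
      using filterlim_compose[OF lim ef] unfolding q_def has_derivative_pd[OF f'] ax .
  qed
  let ?q = "\<lambda>n x. if x \<in> N then 0 else q n x"
  let ?p = "\<lambda>x. if x \<in> N then 0 else pd f l x"
  have C0: "0 \<le> C" using lip by (rule lipschitz_on_nonneg)
  have dc: "?p integrable_on cbox 0 L" "(\<lambda>n. integral (cbox 0 L) (?q n)) \<longlonglongrightarrow> integral (cbox 0 L) ?p"
  proof -
    have 1: "?q n integrable_on cbox 0 L" for n
      by (rule integrable_spike[OF qint N]) auto
    have 2: "norm (?q n x) \<le> C" if "x \<in> cbox 0 L" for n x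
      using qb[OF that] C0 by simp
    have 3: "(\<lambda>n. ?q n x) \<longlonglongrightarrow> ?p x" if "x \<in> cbox 0 L" for x
      using qlim that by simp
    show "?p integrable_on cbox 0 L" "(\<lambda>n. integral (cbox 0 L) (?q n)) \<longlonglongrightarrow> integral (cbox 0 L) ?p"
      using dominated_convergence[of ?q "cbox 0 L" "\<lambda>x. C" ?p, OF 1 integrable_const 2 3] by blast+
  qed
  have "integral (cbox 0 L) (?q n) = 0" for n
    using integral_spike[OF N, of "cbox 0 L" "?q n" "q n"] qI by simp
  then have "integral (cbox 0 L) ?p = 0"
    using LIMSEQ_unique[OF dc(2), of 0] by simp
  then show "integral (cbox 0 L) (pd f l) = 0"
    using integral_spike[OF N, of "cbox 0 L" "pd f l" ?p] by simp
  have "pd f l integrable_on cbox 0 L"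
    by (rule integrable_spike[OF dc(1) N]) simp
  moreover have "\<bar>pd f l x\<bar> \<le> C" if "x \<in> cbox 0 L - N" for x
    by (rule LIMSEQ_le_const2[OF tendsto_rabs[OF qlim[OF that]]]) (use qb that in blast)
  ultimately show "ebm (cbox 0 L) (pd f l)"
    by (rule ebm_of_integrable[OF _ N])
qed

section \<open>Barycentric coordinates\<close>

locale full_simplex =
  fixes K :: "(real^'d) set"
  assumes fin: "finite K" and card_K: "card K = CARD('d) + 1" and indep: "\<not> affine_dependent K"
begin

text \<open>Affine independence pins down the \<open>SOME\<close> in \<open>bary\<close> at the
  vertices. Facts about \<open>bary\<close> are from here on proved by exhibiting a family of
  coefficients.\<close>

lemma bary_unique:
  assumes "(\<Sum>w\<in>K. \<mu> w) = 1" "(\<Sum>w\<in>K. \<mu> w *\<^sub>R w) = x" "v \<in> K"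
  shows "bary K v x = \<mu> v"
proof -
  define \<mu>' where "\<mu>' = (SOME \<mu>. (\<Sum>w\<in>K. \<mu> w) = 1 \<and> (\<Sum>w\<in>K. \<mu> w *\<^sub>R w) = x)"
  have *: "(\<Sum>w\<in>K. \<mu>' w) = 1 \<and> (\<Sum>w\<in>K. \<mu>' w *\<^sub>R w) = x"
    unfolding \<mu>'_def by (rule someI[of _ \<mu>]) (use assms in auto)
  have "(\<Sum>w\<in>K. \<mu>' w - \<mu> w) = 0" "(\<Sum>w\<in>K. (\<mu>' w - \<mu> w) *\<^sub>R w) = 0"
    using * assms by (simp_all add: sum_subtractf scaleR_diff_left)
  then have "\<mu>' v - \<mu> v = 0"
    using indep assms(3) unfolding affine_dependent_explicit_finite[OF fin] by blast
  then show ?thesis unfolding bary_def \<mu>'_def by simp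
qed

text \<open>d+1 affinely independent points span the whole space, so the coordinates make sense
  outside the simplex too. This is what makes \<open>bary K v\<close> a globally affine
  function.\<close>

lemma bary_exists: "\<exists>\<mu>. (\<Sum>w\<in>K. \<mu> w) = 1 \<and> (\<Sum>w\<in>K. \<mu> w *\<^sub>R w) = x"
proof -
  have "x \<in> affine hull K"
    using affine_independent_span_eq[OF indep] card_K by simp
  then show ?thesis unfolding affine_hull_finite[OF fin] by blast
qed

lemma bary_sum: "(\<Sum>w\<in>K. bary K w x) = 1"
  and bary_combination: "(\<Sum>w\<in>K. bary K w x *\<^sub>R w) = x"
proof -
  obtain \<mu> where "(\<Sum>w\<in>K. \<mu> w) = 1" "(\<Sum>w\<in>K. \<mu> w *\<^sub>R w) = x"
    using bary_exists by blast
  with bary_unique[OF this]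
  show "(\<Sum>w\<in>K. bary K w x) = 1" "(\<Sum>w\<in>K. bary K w x *\<^sub>R w) = x" by auto
qed

lemma bary_vertex:
  assumes "v \<in> K" "w \<in> K"
  shows "bary K v w = (if v = w then 1 else 0)"
  by (rule bary_unique) (use assms fin in \<open>auto simp: if_distrib[of "\<lambda>c. c *\<^sub>R _"] sum.delta cong: if_cong\<close>)

lemma linear_bary:
  assumes "v \<in> K"
  shows "linear (\<lambda>x. bary K v x - bary K v 0)"
proof (rule linearI)
  fix x y :: "real^'d" and c :: real
  have "bary K v (x + y) = bary K v x + bary K v y - bary K v 0"
    by (rule bary_unique[OF _ _ assms])
       (simp_all add: sum.distrib sum_subtractf scaleR_add_left scaleR_diff_left bary_sum bary_combination)
  then show "bary K v (x + y) - bary K v 0 = bary K v x - bary K v 0 + (bary K v y - bary K v 0)"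
    by simp
  have "bary K v (c *\<^sub>R x) = c * bary K v x + (1 - c) * bary K v 0"
    by (rule bary_unique[OF _ _ assms])
       (simp_all add: sum.distrib sum_distrib_left[symmetric] scaleR_add_left scaleR_scaleR[symmetric]
          scaleR_sum_right[symmetric] bary_sum bary_combination del: scaleR_scaleR)
  then show "bary K v (c *\<^sub>R x) - bary K v 0 = c *\<^sub>R (bary K v x - bary K v 0)"
    by (simp add: algebra_simps)
qed

text \<open>The constant gradient of an affine coordinate: applying the adjoint of its linear part
  to 1 gives the vector that represents this linear part.\<close>

definition bgrad :: "real^'d \<Rightarrow> real^'d" where
  "bgrad v = adjoint (\<lambda>x. bary K v x - bary K v 0) 1"

lemma bary_diff:
  assumes "v \<in> K"
  shows "bary K v x - bary K v y = bgrad v \<bullet> (x - y)"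
  using adjoint_works[OF linear_bary[OF assms], of x 1] adjoint_works[OF linear_bary[OF assms], of y 1]
  unfolding bgrad_def inner_commute[of _ "x - y"] by (simp add: inner_diff_left)

lemma bary_nonneg:
  assumes "x \<in> convex hull K" "v \<in> K"
  shows "0 \<le> bary K v x"
proof -
  obtain u where "\<forall>w\<in>K. 0 \<le> u w" "sum u K = 1" "(\<Sum>w\<in>K. u w *\<^sub>R w) = x"
    using assms(1) unfolding convex_hull_finite[OF fin] by blast
  then show ?thesis using bary_unique assms(2) by metis
qed

lemma bary_le_1:
  assumes "x \<in> convex hull K" "v \<in> K"
  shows "bary K v x \<le> 1"
  using member_le_sum[of v K "\<lambda>w. bary K w x"] assms bary_nonneg fin bary_sum by auto

text \<open>Coefficients with respect to a face, extended by zero, are coefficients with respect to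
  \<open>K\<close>. Together with conformity this makes \<open>hat\<close> well defined across
  elements.\<close>

lemma bary_face:
  assumes "F \<subseteq> K" "x \<in> convex hull F" "v \<in> K" "v \<notin> F"
  shows "bary K v x = 0"
proof -
  have "finite F" using assms(1) fin finite_subset by blast
  then obtain u where u: "sum u F = 1" "(\<Sum>w\<in>F. u w *\<^sub>R w) = x"
    using assms(2) unfolding convex_hull_finite[OF \<open>finite F\<close>] by blast
  have "bary K v x = (if v \<in> F then u v else 0)"
    by (rule bary_unique[OF _ _ assms(3)])
       (use u fin assms(1) in \<open>simp_all add: if_distrib[of "\<lambda>c. c *\<^sub>R _"] sum.inter_restrict[symmetric]
          Int_absorb1 cong: if_cong\<close>)
  then show ?thesis using assms(4) by simp
qed

text \<open>The coordinate stays in [0,1] on the ball. Walking from the centre along the gradient by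
  r/2, which remains strictly inside the open ball, changes it by r/2 times the norm.\<close>

lemma norm_bgrad_le:
  assumes "ball c r \<subseteq> convex hull K" "0 < r" "v \<in> K"
  shows "norm (bgrad v) \<le> 2 / r"
proof (cases "bgrad v = 0")
  case False
  define y where "y = c + (r / (2 * norm (bgrad v))) *\<^sub>R bgrad v"
  have "dist c y < r" using False assms(2) by (simp add: y_def dist_norm)
  then have "y \<in> convex hull K" "c \<in> convex hull K" using assms by auto
  then have "bary K v y - bary K v c \<le> 1"
    using bary_nonneg[OF _ assms(3), of c] bary_le_1[OF _ assms(3), of y] by linarith
  also have "bary K v y - bary K v c = r / 2 * norm (bgrad v)"
    unfolding bary_diff[OF assms(3)] y_def using False
    by (simp add: dot_square_norm power2_eq_square)
  finally show ?thesis using assms(2) by (simp add: field_simps)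
qed (use assms in simp)

end

lemma bary_translate:
  assumes "full_simplex K" "v \<in> K"
  shows "bary ((\<lambda>x. x + z) ` K) (v + z) (x + z) = bary K v x"
proof -
  interpret full_simplex K by fact
  have im: "(\<lambda>x. x + z) ` K = (+) z ` K" by (auto simp: add.commute)
  interpret S: full_simplex "(\<lambda>x. x + z) ` K"
  proof
    show "finite ((\<lambda>x. x + z) ` K)" using fin by simp
    show "card ((\<lambda>x. x + z) ` K) = CARD('a) + 1" using card_K by (simp add: card_image)
    show "\<not> affine_dependent ((\<lambda>x. x + z) ` K)"
      unfolding im using affine_dependent_translation_eq indep by blast
  qed
  have inj: "inj_on (\<lambda>x. x + z) K" by simp
  have "bary ((\<lambda>x. x + z) ` K) (v + z) (x + z) = (\<lambda>w. bary K (w - z) x) (v + z)"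
    by (rule S.bary_unique)
       (use assms(2) in \<open>simp_all add: sum.reindex[OF inj] o_def bary_sum scaleR_add_right
          sum.distrib bary_combination scaleR_sum_left[symmetric]\<close>)
  then show ?thesis by simp
qed

section \<open>The period lattice\<close>

lemma lattice_0: "0 \<in> lattice L"
  unfolding lattice_def by (auto intro: exI[of _ 0])

lemma lattice_uminus:
  assumes "z \<in> lattice L"
  shows "- z \<in> lattice L"
  unfolding lattice_def
proof (intro CollectI allI)
  fix k
  obtain m :: int where "z $ k = of_int m * L $ k" using assms unfolding lattice_def by blast
  then show "\<exists>m::int. (- z) $ k = of_int m * L $ k" by (intro exI[of _ "- m"]) simp
qed

lemma lattice_add:
  assumes "z \<in> lattice L" "z' \<in> lattice L"
  shows "z + z' \<in> lattice L"
  unfolding lattice_def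
proof (intro CollectI allI)
  fix k
  obtain m m' :: int where "z $ k = of_int m * L $ k" "z' $ k = of_int m' * L $ k"
    using assms unfolding lattice_def by blast
  then show "\<exists>m::int. (z + z') $ k = of_int m * L $ k"
    by (intro exI[of _ "m + m'"]) (simp add: algebra_simps)
qed

lemma lattice_diff: "z \<in> lattice L \<Longrightarrow> z' \<in> lattice L \<Longrightarrow> z - z' \<in> lattice L"
  using lattice_add[of z L "- z'"] lattice_uminus[of z' L] by simp

lemma periodic_funD:
  assumes "periodic_fun L f" "x - y \<in> lattice L"
  shows "f x = f y"
  using assms(1)[unfolded periodic_fun_def, rule_format, OF assms(2), of y] by simp

lemma diameter_translation:
  fixes S :: "'a::real_normed_vector set"
  shows "diameter ((+) a ` S) = diameter S"
proof -
  have "((+) a ` S) \<times> ((+) a ` S) = (\<lambda>(x, y). (a + x, a + y)) ` (S \<times> S)" by auto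
  then have "(\<lambda>(x, y). dist x y) ` (((+) a ` S) \<times> ((+) a ` S)) = (\<lambda>(x, y). dist x y) ` (S \<times> S)"
    by (simp add: image_image case_prod_unfold)
  then show ?thesis unfolding diameter_def by simp
qed

section \<open>Periodic meshes\<close>

locale torus_mesh =
  fixes L :: "real^'d" and Tr :: "(real^'d) set set"
  assumes L_pos: "\<forall>k. 0 < L $ k" and mesh: "periodic_mesh L Tr"
begin

abbreviation "\<phi> \<equiv> phi L Tr"
abbreviation "\<Omega> \<equiv> cbox 0 L"
abbreviation "nds \<equiv> nodes L Tr"

lemma simplexI: "K \<in> Tr \<Longrightarrow> full_simplex K"
  using conjunct1[OF mesh[unfolded periodic_mesh_def]] unfolding full_simplex_def by simp

lemma translate_mesh: "K \<in> Tr \<Longrightarrow> z \<in> lattice L \<Longrightarrow> (\<lambda>x. x + z) ` K \<in> Tr"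
  using mesh unfolding periodic_mesh_def by simp

lemma mesh_cover: "\<exists>K\<in>Tr. x \<in> convex hull K"
proof -
  have "(\<Union>K\<in>Tr. convex hull K) = UNIV" using mesh unfolding periodic_mesh_def by (elim conjE)
  then have "x \<in> (\<Union>K\<in>Tr. convex hull K)" by simp
  then show ?thesis by simp
qed

lemma mesh_conforming: "K \<in> Tr \<Longrightarrow> K' \<in> Tr \<Longrightarrow> convex hull K \<inter> convex hull K' = convex hull (K \<inter> K')"
  using mesh unfolding periodic_mesh_def by simp

lemma mesh_locally_finite: "bounded B \<Longrightarrow> finite {K \<in> Tr. convex hull K \<inter> B \<noteq> {}}"
  using mesh unfolding periodic_mesh_def by simp

text \<open>By conformity \<open>x\<close> lies in the common face. The coordinates with respect to
  \<open>K'\<close> vanish off that face, so they also serve as coordinates with respect to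
  \<open>K\<close>. Hence the element chosen inside \<open>hat\<close> does not matter.\<close>

lemma bary_conforming:
  assumes "K \<in> Tr" "K' \<in> Tr" "x \<in> convex hull K" "x \<in> convex hull K'" "v \<in> K" "v \<in> K'"
  shows "bary K v x = bary K' v x"
proof -
  interpret K: full_simplex K using simplexI assms by blast
  interpret K': full_simplex K' using simplexI assms by blast
  have x: "x \<in> convex hull (K \<inter> K')" using mesh_conforming assms by blast
  have "sum (\<lambda>w. bary K' w x) (K \<inter> K') = sum (\<lambda>w. bary K' w x) K'"
    by (rule sum.mono_neutral_left) (use K'.fin K'.bary_face[of "K \<inter> K'" x] x in auto)
  moreover have "sum (\<lambda>w. bary K' w x *\<^sub>R w) (K \<inter> K') = sum (\<lambda>w. bary K' w x *\<^sub>R w) K'"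
    by (rule sum.mono_neutral_left) (use K'.fin K'.bary_face[of "K \<inter> K'" x] x in auto)
  ultimately have *: "sum (\<lambda>w. bary K' w x) (K \<inter> K') = 1" "sum (\<lambda>w. bary K' w x *\<^sub>R w) (K \<inter> K') = x"
    using K'.bary_sum K'.bary_combination by auto
  have "bary K v x = (if v \<in> K' then bary K' v x else 0)"
    by (rule K.bary_unique[OF _ _ assms(5)])
       (use * K.fin in \<open>simp_all add: if_distrib[of "\<lambda>c. c *\<^sub>R _"] sum.inter_restrict[symmetric] cong: if_cong\<close>)
  then show ?thesis using assms by simp
qed

lemma hat_eq_bary:
  assumes "K \<in> Tr" "x \<in> convex hull K" "v \<in> K"
  shows "hat Tr v x = bary K v x"
proof -
  let ?P = "\<lambda>K. K \<in> Tr \<and> v \<in> K \<and> x \<in> convex hull K"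
  have "?P (SOME K. ?P K)" by (rule someI[of ?P K]) (use assms in auto)
  then have "bary (SOME K. ?P K) v x = bary K v x"
    using assms by (intro bary_conforming) auto
  moreover have "\<exists>K\<in>Tr. v \<in> K \<and> x \<in> convex hull K" using assms by blast
  ultimately show ?thesis unfolding hat_def by simp
qed

lemma hat_eq_0:
  assumes "K \<in> Tr" "x \<in> convex hull K" "v \<notin> K"
  shows "hat Tr v x = 0"
proof (cases "\<exists>K\<in>Tr. v \<in> K \<and> x \<in> convex hull K")
  case True
  then obtain K' where K': "K' \<in> Tr" "v \<in> K'" "x \<in> convex hull K'" by blast
  interpret full_simplex K' using simplexI K' by blast
  have "x \<in> convex hull (K \<inter> K')" using mesh_conforming K' assms by blast
  then have "bary K' v x = 0"
    using bary_face[of "K \<inter> K'" x v] K' assms by blast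
  then show ?thesis using hat_eq_bary[OF K'(1,3,2)] by simp
qed (auto simp: hat_def)

text \<open>All translates that contribute at \<open>x\<close> are vertices of one element. A sum
  remains because on a coarse mesh one element may contain several translates of the same
  node.\<close>

lemma phi_eq:
  assumes "K \<in> Tr" "x \<in> convex hull K"
  shows "\<phi> v x = (\<Sum>w | w \<in> K \<and> w - v \<in> lattice L. bary K w x)"
proof -
  let ?A = "{w. w - v \<in> lattice L \<and> (\<exists>K\<in>Tr. w \<in> K \<and> x \<in> convex hull K)}"
  have "?A \<subseteq> \<Union>{K \<in> Tr. convex hull K \<inter> {x} \<noteq> {}}" by auto
  moreover have "finite (\<Union>{K \<in> Tr. convex hull K \<inter> {x} \<noteq> {}})"
    using mesh_locally_finite[of "{x}"] simplexI full_simplex.fin by auto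
  ultimately have fin: "finite ?A" using finite_subset by blast
  have "\<phi> v x = (\<Sum>w\<in>?A. hat Tr w x)" unfolding phi_def ..
  also have "\<dots> = (\<Sum>w | w \<in> K \<and> w - v \<in> lattice L. hat Tr w x)"
    by (rule sum.mono_neutral_right[OF fin]) (use assms hat_eq_0[OF assms] in auto)
  also have "\<dots> = (\<Sum>w | w \<in> K \<and> w - v \<in> lattice L. bary K w x)"
    by (rule sum.cong) (use hat_eq_bary[OF assms] in auto)
  finally show ?thesis .
qed

lemma finite_nodes: "finite nds"
proof (rule finite_subset)
  show "nds \<subseteq> \<Union>{K \<in> Tr. convex hull K \<inter> \<Omega> \<noteq> {}}"
  proof
    fix v assume "v \<in> nds"
    then obtain K where "K \<in> Tr" "v \<in> K" "v \<in> \<Omega>"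
      unfolding nodes_def by (auto simp: mem_box_cart less_imp_le)
    then show "v \<in> \<Union>{K \<in> Tr. convex hull K \<inter> \<Omega> \<noteq> {}}"
      using hull_inc[of v K convex] by blast
  qed
  show "finite (\<Union>{K \<in> Tr. convex hull K \<inter> \<Omega> \<noteq> {}})"
    using mesh_locally_finite[OF bounded_cbox[of 0 L]] simplexI full_simplex.fin by auto
qed

lemma lattice_reduce: "\<exists>z\<in>lattice L. \<forall>k. 0 \<le> (w - z) $ k \<and> (w - z) $ k < L $ k"
proof
  let ?z = "\<chi> k. of_int \<lfloor>w $ k / L $ k\<rfloor> * L $ k"
  show "?z \<in> lattice L"
    unfolding lattice_def vec_lambda_beta by (intro CollectI allI exI) (rule vec_lambda_beta)
  show "\<forall>k. 0 \<le> (w - ?z) $ k \<and> (w - ?z) $ k < L $ k"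
  proof
    fix k
    have L: "0 < L $ k" using L_pos by blast
    have "of_int \<lfloor>w $ k / L $ k\<rfloor> * L $ k \<le> w $ k"
      using of_int_floor_le[of "w $ k / L $ k"] by (simp only: pos_le_divide_eq[OF L])
    moreover have "w $ k < (of_int \<lfloor>w $ k / L $ k\<rfloor> + 1) * L $ k"
      using floor_correct[of "w $ k / L $ k"] by (simp only: pos_divide_less_eq[OF L] of_int_add of_int_1)
    ultimately show "0 \<le> (w - ?z) $ k \<and> (w - ?z) $ k < L $ k"
      unfolding vector_minus_component vec_lambda_beta distrib_right by simp
  qed
qed

lemma node_unique:
  assumes "v \<in> nds" "v' \<in> nds" "v - v' \<in> lattice L"
  shows "v = v'"
proof (rule vec_eq_iff[THEN iffD2], rule allI)
  fix k
  obtain m :: int where m: "(v - v') $ k = of_int m * L $ k"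
    using assms(3) unfolding lattice_def by blast
  have "\<bar>v $ k - v' $ k\<bar> < L $ k"
  proof -
    have "0 \<le> v $ k \<and> v $ k < L $ k" "0 \<le> v' $ k \<and> v' $ k < L $ k"
      using assms(1,2) unfolding nodes_def by auto
    then show ?thesis by linarith
  qed
  then have "\<bar>real_of_int m\<bar> * L $ k < 1 * L $ k"
    using m L_pos[rule_format, of k] by (simp add: abs_mult)
  then have "\<bar>real_of_int m\<bar> < 1"
    using L_pos[rule_format, of k] by simp
  then have "m = 0" by linarith
  then show "v $ k = v' $ k" using m by simp
qed

definition rep :: "real^'d \<Rightarrow> real^'d" where
  "rep w = (SOME v. v \<in> nds \<and> w - v \<in> lattice L)"

lemma rep:
  assumes "K \<in> Tr" "w \<in> K"
  shows "rep w \<in> nds" "w - rep w \<in> lattice L"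
proof -
  obtain z where z: "z \<in> lattice L" "\<forall>k. 0 \<le> (w - z) $ k \<and> (w - z) $ k < L $ k"
    using lattice_reduce by blast
  have "(\<lambda>x. x + (- z)) ` K \<in> Tr"
    using translate_mesh assms(1) lattice_uminus[OF z(1)] by blast
  moreover have "w - z \<in> (\<lambda>x. x + (- z)) ` K" using assms(2) by simp
  ultimately have "w - z \<in> nds" unfolding nodes_def using z(2) by (intro CollectI conjI bexI)
  then have "\<exists>v. v \<in> nds \<and> w - v \<in> lattice L" using z(1) by (intro exI[of _ "w - z"]) simp
  then have "rep w \<in> nds \<and> w - rep w \<in> lattice L" unfolding rep_def by (rule someI_ex)
  then show "rep w \<in> nds" "w - rep w \<in> lattice L" by auto
qed

lemma rep_eq:
  assumes "K \<in> Tr" "w \<in> K" "v \<in> nds"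
  shows "w - v \<in> lattice L \<longleftrightarrow> v = rep w"
proof
  assume "w - v \<in> lattice L"
  then have "v - rep w \<in> lattice L"
    using lattice_diff[OF rep(2)[OF assms(1,2)], of "w - v"] by simp
  then show "v = rep w" by (rule node_unique[OF assms(3) rep(1)[OF assms(1,2)]])
qed (use rep(2)[OF assms(1,2)] in simp)

text \<open>Each vertex of \<open>K\<close> is a translate of exactly one node,
  \<open>rep w\<close>. Exchanging the sums therefore collapses a sum over all nodes of the torus to
  the d+1 vertices of one element.\<close>

lemma sum_over_nodes:
  fixes f :: "real^'d \<Rightarrow> 'b::real_vector"
  assumes K: "K \<in> Tr"
  shows "(\<Sum>v\<in>nds. (\<Sum>w | w \<in> K \<and> w - v \<in> lattice L. g w) *\<^sub>R f v) = (\<Sum>w\<in>K. g w *\<^sub>R f (rep w))"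
proof -
  have fK: "finite K" using simplexI[OF K] full_simplex.fin by blast
  have "(\<Sum>v\<in>nds. (\<Sum>w | w \<in> K \<and> w - v \<in> lattice L. g w) *\<^sub>R f v)
      = (\<Sum>v\<in>nds. \<Sum>w | w \<in> K \<and> w - v \<in> lattice L. g w *\<^sub>R f v)"
    by (simp add: scaleR_sum_left)
  also have "\<dots> = (\<Sum>w\<in>K. \<Sum>v | v \<in> nds \<and> w - v \<in> lattice L. g w *\<^sub>R f v)"
    by (rule sum.swap_restrict[OF finite_nodes fK])
  also have "\<dots> = (\<Sum>w\<in>K. g w *\<^sub>R f (rep w))"
  proof (rule sum.cong[OF refl])
    fix w assume "w \<in> K"
    then have "{v. v \<in> nds \<and> w - v \<in> lattice L} = {rep w}"
      using rep_eq[OF K] rep[OF K] by auto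
    then show "(\<Sum>v | v \<in> nds \<and> w - v \<in> lattice L. g w *\<^sub>R f v) = g w *\<^sub>R f (rep w)" by simp
  qed
  finally show ?thesis .
qed

lemma fe_eq:
  fixes f :: "real^'d \<Rightarrow> 'b::real_vector"
  assumes "K \<in> Tr" "x \<in> convex hull K"
  shows "fe L Tr f x = (\<Sum>w\<in>K. bary K w x *\<^sub>R f (rep w))"
  unfolding fe_def phi_eq[OF assms] by (rule sum_over_nodes[OF assms(1)])

lemma phi_nonneg: "0 \<le> \<phi> v x"
proof -
  obtain K where K: "K \<in> Tr" "x \<in> convex hull K" using mesh_cover by blast
  interpret full_simplex K using simplexI K by blast
  show ?thesis unfolding phi_eq[OF K] by (rule sum_nonneg) (use bary_nonneg K in auto)
qed

lemma sum_phi: "(\<Sum>v\<in>nds. \<phi> v x) = 1"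
proof -
  obtain K where K: "K \<in> Tr" "x \<in> convex hull K" using mesh_cover by blast
  interpret full_simplex K using simplexI K by blast
  show ?thesis using fe_eq[OF K, of "\<lambda>_. 1::real"] unfolding fe_def by (simp add: bary_sum)
qed

text \<open>Makes each node its own neighbour, so that the diagonal entry belongs to the stencil
  sums of the scheme.\<close>

lemma phi_node_self:
  assumes "i \<in> nds"
  shows "\<phi> i i \<noteq> 0"
proof -
  obtain K where K: "K \<in> Tr" "i \<in> K" using assms unfolding nodes_def by blast
  interpret full_simplex K using simplexI K by blast
  have i: "i \<in> convex hull K" using K(2) by (rule hull_inc)
  have "bary K i i \<le> (\<Sum>w | w \<in> K \<and> w - i \<in> lattice L. bary K w i)"
    by (rule member_le_sum[of i _ "\<lambda>w. bary K w i"])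
       (use K fin lattice_0 bary_nonneg[OF i] in auto)
  then show ?thesis unfolding phi_eq[OF K(1) i] using bary_vertex[OF K(2) K(2)] by simp
qed

text \<open>A lattice translation carries the element around \<open>x\<close> to an element around
  \<open>x + z\<close> and maps translates of \<open>v\<close> to translates of
  \<open>v\<close>.\<close>

lemma phi_periodic: "periodic_fun L (\<phi> v)"
  unfolding periodic_fun_def
proof (intro allI impI)
  fix x z assume z: "z \<in> lattice L"
  obtain K where K: "K \<in> Tr" "x \<in> convex hull K" using mesh_cover by blast
  interpret full_simplex K using simplexI K by blast
  let ?K = "(\<lambda>x. x + z) ` K"
  have im: "(\<lambda>x. x + z) = (+) z" by (auto simp: add.commute)
  have K': "?K \<in> Tr" "x + z \<in> convex hull ?K"
    using translate_mesh[OF K(1) z] K(2) unfolding im convex_hull_translation by (auto simp: add.commute)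
  have iff: "w + z - v \<in> lattice L \<longleftrightarrow> w - v \<in> lattice L" for w
    using lattice_add[OF _ z, of "w - v"] lattice_diff[OF _ z, of "w + z - v"]
    by (auto simp: algebra_simps)
  have eq: "{w. w \<in> ?K \<and> w - v \<in> lattice L} = (\<lambda>x. x + z) ` {w. w \<in> K \<and> w - v \<in> lattice L}"
    using iff by auto
  have "\<phi> v (x + z) = (\<Sum>w | w \<in> ?K \<and> w - v \<in> lattice L. bary ?K w (x + z))"
    by (rule phi_eq[OF K'])
  also have "\<dots> = (\<Sum>w | w \<in> K \<and> w - v \<in> lattice L. bary ?K (w + z) (x + z))"
    unfolding eq by (simp add: sum.reindex)
  also have "\<dots> = (\<Sum>w | w \<in> K \<and> w - v \<in> lattice L. bary K w x)"
    by (rule sum.cong) (use bary_translate simplexI[OF K(1)] in auto)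
  finally show "\<phi> v (x + z) = \<phi> v x" using phi_eq[OF K] by simp
qed

text \<open>Finitely many elements meet \<open>B\<close>, and \<phi> is affine on each. The local
  constants are glued along the segment between two points, which stays in \<open>B\<close> by
  convexity.\<close>

lemma phi_lipschitz:
  assumes B: "bounded B" "convex B"
  shows "\<exists>C. C-lipschitz_on B (\<phi> v)"
proof -
  define F where "F = {K \<in> Tr. convex hull K \<inter> B \<noteq> {}}"
  have F: "finite F" unfolding F_def by (rule mesh_locally_finite[OF B(1)])
  define G where "G K = (\<Sum>w\<in>K. norm (full_simplex.bgrad K w))" for K :: "(real^'d) set"
  define C where "C = sum G F"
  have G0: "0 \<le> G K" for K unfolding G_def by (rule sum_nonneg) simp
  have GC: "G K \<le> C" if "K \<in> F" for K
    unfolding C_def using member_le_sum[of K F G] that F G0 by auto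
  have C0: "0 \<le> C" unfolding C_def by (rule sum_nonneg) (rule G0)
  have loc: "\<bar>\<phi> v x - \<phi> v y\<bar> \<le> C * norm (x - y)"
    if K: "K \<in> F" and x: "x \<in> convex hull K" "y \<in> convex hull K" for K x y
  proof -
    have KT: "K \<in> Tr" using K unfolding F_def by blast
    interpret full_simplex K using simplexI KT by blast
    have "\<phi> v x - \<phi> v y = (\<Sum>w | w \<in> K \<and> w - v \<in> lattice L. bgrad w \<bullet> (x - y))"
      unfolding phi_eq[OF KT x(1)] phi_eq[OF KT x(2)]
      by (simp add: sum_subtractf[symmetric] bary_diff)
    also have "\<bar>\<dots>\<bar> \<le> (\<Sum>w | w \<in> K \<and> w - v \<in> lattice L. \<bar>bgrad w \<bullet> (x - y)\<bar>)"
      by (rule sum_abs)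
    also have "\<dots> \<le> (\<Sum>w | w \<in> K \<and> w - v \<in> lattice L. norm (bgrad w) * norm (x - y))"
      by (rule sum_mono) (rule Cauchy_Schwarz_ineq2)
    also have "\<dots> \<le> (\<Sum>w\<in>K. norm (bgrad w) * norm (x - y))"
      by (rule sum_mono2) (use fin in auto)
    also have "\<dots> = G K * norm (x - y)"
      unfolding G_def by (simp add: sum_distrib_right)
    also have "\<dots> \<le> C * norm (x - y)"
      by (rule mult_right_mono[OF GC[OF K]]) simp
    finally show ?thesis .
  qed
  have "C-lipschitz_on B (\<phi> v)"
  proof (rule lipschitz_onI[OF _ C0])
    fix x y assume xy: "x \<in> B" "y \<in> B"
    let ?c = "\<lambda>t::real. x + t *\<^sub>R (y - x)"
    let ?U = "\<lambda>K. ?c -` (convex hull K)"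
    \<comment> \<open>The segment is parametrised over [0,1], where the preimages of the elements
      form a finite closed cover. A function on an interval that is Lipschitz on each closed piece
      is Lipschitz with the same constant.\<close>
    have "(C * norm (y - x))-lipschitz_on {0..1} (\<lambda>t. \<phi> v (?c t))"
    proof (rule lipschitz_on_closed_Union[of F _ ?U])
      fix K assume K: "K \<in> F"
      show "(C * norm (y - x))-lipschitz_on (?U K) (\<lambda>t. \<phi> v (?c t))"
      proof (rule lipschitz_onI)
        fix s t assume "s \<in> ?U K" "t \<in> ?U K"
        then have "\<bar>\<phi> v (?c s) - \<phi> v (?c t)\<bar> \<le> C * norm (?c s - ?c t)"
          by (intro loc[OF K]) auto
        also have "?c s - ?c t = (s - t) *\<^sub>R (y - x)" by (simp add: algebra_simps)
        finally show "dist (\<phi> v (?c s)) (\<phi> v (?c t)) \<le> C * norm (y - x) * dist s t"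
          by (simp add: dist_real_def mult.commute mult.left_commute)
      qed (use C0 in simp)
      have "K \<in> Tr" using K unfolding F_def by blast
      then have "closed (convex hull K)"
        by (intro compact_imp_closed finite_imp_compact_convex_hull full_simplex.fin simplexI)
      then show "closed (?U K)"
        by (rule continuous_closed_vimage) (intro continuous_intros)
    next
      show "{0..1} \<subseteq> (\<Union>K\<in>F. ?U K)"
      proof
        fix t :: real assume t: "t \<in> {0..1}"
        have "?c t = (1 - t) *\<^sub>R x + t *\<^sub>R y" by (simp add: algebra_simps)
        then have "?c t \<in> B" using convexD_alt[OF B(2) xy] t by auto
        moreover obtain K where "K \<in> Tr" "?c t \<in> convex hull K" using mesh_cover by blast
        ultimately show "t \<in> (\<Union>K\<in>F. ?U K)" unfolding F_def by blast
      qed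
    qed (use F C0 in auto)
    from lipschitz_onD[OF this, of 0 1] show "dist (\<phi> v x) (\<phi> v y) \<le> C * dist x y"
      by (simp add: dist_norm norm_minus_commute)
  qed
  then show ?thesis by blast
qed

section \<open>Element boundaries and gradients of the basis functions\<close>

definition skeleton :: "(real^'d) set" where
  "skeleton = (\<Union>K\<in>{K \<in> Tr. convex hull K \<inter> \<Omega> \<noteq> {}}. frontier (convex hull K))"

text \<open>Only elements that meet the box enter \<open>skeleton\<close>, so it is a finite union
  of boundaries of convex sets.\<close>

lemma negligible_skeleton: "negligible skeleton"
  unfolding skeleton_def
proof (rule negligible_Union)
  show "finite ((\<lambda>K. frontier (convex hull K)) ` {K \<in> Tr. convex hull K \<inter> \<Omega> \<noteq> {}})"
    by (intro finite_imageI mesh_locally_finite bounded_cbox)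
qed (auto intro: negligible_convex_frontier)

lemma off_skeleton:
  assumes "x \<in> \<Omega> - skeleton"
  obtains K where "K \<in> Tr" "x \<in> interior (convex hull K)" "x \<in> convex hull K"
proof -
  obtain K where K: "K \<in> Tr" "x \<in> convex hull K" using mesh_cover by blast
  then have "x \<notin> frontier (convex hull K)" using assms unfolding skeleton_def by blast
  then have "x \<in> interior (convex hull K)"
    using K(2) closure_subset unfolding frontier_def by blast
  then show ?thesis using that K by blast
qed

lemma phi_has_derivative:
  assumes K: "K \<in> Tr" and x: "x \<in> interior (convex hull K)"
  shows "(\<phi> v has_derivative (\<lambda>h. (\<Sum>w | w \<in> K \<and> w - v \<in> lattice L. full_simplex.bgrad K w) \<bullet> h)) (at x)"
proof -
  interpret full_simplex K using simplexI K by blast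
  let ?g = "\<Sum>w | w \<in> K \<and> w - v \<in> lattice L. bgrad w"
  have xK: "x \<in> convex hull K" using x interior_subset by blast
  have eq: "\<phi> v y = \<phi> v x + ?g \<bullet> (y - x)" if y: "y \<in> interior (convex hull K)" for y
  proof -
    have yK: "y \<in> convex hull K" using y interior_subset by blast
    have "\<phi> v y - \<phi> v x = (\<Sum>w | w \<in> K \<and> w - v \<in> lattice L. bary K w y - bary K w x)"
      unfolding phi_eq[OF K xK] phi_eq[OF K yK] by (simp add: sum_subtractf)
    also have "\<dots> = ?g \<bullet> (y - x)"
      unfolding inner_sum_left by (rule sum.cong) (auto simp: bary_diff)
    finally show ?thesis by simp
  qed
  have "((\<lambda>y. \<phi> v x + ?g \<bullet> (y - x)) has_derivative (\<lambda>h. ?g \<bullet> h)) (at x)"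
    by (auto intro!: derivative_eq_intros)
  then show ?thesis
    by (rule has_derivative_transform_within_open[OF _ open_interior x]) (simp add: eq)
qed

lemma grad_phi:
  assumes "K \<in> Tr" "x \<in> interior (convex hull K)"
  shows "grad (\<phi> v) x = (\<Sum>w | w \<in> K \<and> w - v \<in> lattice L. full_simplex.bgrad K w)"
  unfolding grad_def vec_eq_iff has_derivative_pd[OF phi_has_derivative[OF assms]]
  by (simp add: inner_axis)

lemma phi_differentiable: "x \<in> \<Omega> - skeleton \<Longrightarrow> \<phi> v differentiable at x"
  by (erule off_skeleton) (rule differentiableI, rule phi_has_derivative)

lemma phi_torus_lip: "torus_lip L (\<phi> v)"
  unfolding torus_lip_def
  by (intro conjI exI[of _ skeleton] ballI phi_periodic phi_lipschitz bounded_cbox convex_box(1)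
      negligible_skeleton phi_differentiable)

lemma ebm_pd_phi: "ebm \<Omega> (pd (\<phi> v) l)"
  using torus_lip_pd(1)[OF L_pos phi_torus_lip] .

lemma ebm_phi: "ebm \<Omega> (\<phi> v)"
  using torus_lip_ebm[OF phi_torus_lip] .

lemma ebm_grad_phi: "ebm \<Omega> (\<lambda>x. grad (\<phi> v) x $ l)"
  unfolding grad_def using ebm_pd_phi by simp

text \<open>The derivative of the partition of unity. It permits subtracting a constant, in practice
  the value of the finite element function at \<open>x\<close>, from nodal values paired with
  gradients.\<close>

lemma sum_grad_phi:
  assumes "x \<in> \<Omega> - skeleton"
  shows "(\<Sum>v\<in>nds. grad (\<phi> v) x) = 0"
proof -
  have "(\<Sum>v\<in>nds. pd (\<phi> v) l x) = 0" for l
  proof -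
    have "(\<Sum>v\<in>nds. pd (\<phi> v) l x) = pd (\<lambda>y. \<Sum>v\<in>nds. \<phi> v y) l x"
      by (rule pd_sum[symmetric]) (rule phi_differentiable[OF assms])
    also have "\<dots> = 0"
      unfolding sum_phi using has_derivative_pd[OF has_derivative_const, of 1 l x] by simp
    finally show ?thesis .
  qed
  then show ?thesis by (simp add: vec_eq_iff grad_def)
qed

lemma fe_component:
  fixes U :: "real^'d \<Rightarrow> real^'n"
  shows "fe L Tr U x $ k = (\<Sum>v\<in>nds. \<phi> v x * U v $ k)"
  unfolding fe_def by simp

lemma fe_torus_lip: "torus_lip L (\<lambda>x. fe L Tr U x $ k)"
  unfolding fe_component by (intro torus_lip_sum torus_lip_mult phi_torus_lip torus_lip_const)

lemma fe_differentiable: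
  fixes U :: "real^'d \<Rightarrow> real^'n"
  shows "x \<in> \<Omega> - skeleton \<Longrightarrow> (\<lambda>x. fe L Tr U x $ k) differentiable at x"
  unfolding fe_component
  by (rule differentiable_sum[OF finite_nodes], rule ballI, rule differentiable_mult[OF phi_differentiable differentiable_const])

lemma pd_fe:
  assumes "x \<in> \<Omega> - skeleton"
  shows "pd (\<lambda>y. fe L Tr U y $ k) l x = (\<Sum>v\<in>nds. U v $ k * pd (\<phi> v) l x)"
proof -
  have "pd (\<lambda>y. \<Sum>v\<in>nds. U v $ k * \<phi> v y) l x = (\<Sum>v\<in>nds. pd (\<lambda>y. U v $ k * \<phi> v y) l x)"
    by (rule pd_sum) (rule differentiable_mult[OF differentiable_const phi_differentiable[OF assms]])
  then show ?thesis
    unfolding fe_component using pd_const_mult[OF phi_differentiable[OF assms]] by (simp add: mult.commute)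
qed

text \<open>\<open>meshsize\<close> is a supremum over the infinitely many elements of the lift.
  Every element is a translate of one meeting the box, so only finitely many diameters occur and the
  supremum is an upper bound.\<close>

lemma dist_le_meshsize:
  assumes K: "K \<in> Tr" and "x \<in> convex hull K" "y \<in> convex hull K"
  shows "dist x y \<le> meshsize Tr"
proof -
  let ?d = "\<lambda>K. diameter (convex hull K)"
  let ?F = "{K \<in> Tr. convex hull K \<inter> \<Omega> \<noteq> {}}"
  have "?d ` Tr \<subseteq> ?d ` ?F"
  proof (rule image_subsetI)
    fix K assume K: "K \<in> Tr"
    interpret full_simplex K using simplexI K by blast
    have "K \<noteq> {}" using card_K by auto
    then obtain w where w: "w \<in> K" by auto
    obtain z where z: "z \<in> lattice L" "\<forall>k. 0 \<le> (w - z) $ k \<and> (w - z) $ k < L $ k"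
      using lattice_reduce by blast
    have im: "(\<lambda>x. x + (- z)) ` K = (+) (-z) ` K" by (auto simp: add.commute)
    let ?K = "(+) (-z) ` K"
    have "?K \<in> Tr" using translate_mesh[OF K lattice_uminus[OF z(1)]] im by simp
    moreover have "w - z \<in> convex hull ?K" using w by (intro hull_inc) auto
    moreover have "w - z \<in> \<Omega>" using z(2) by (auto simp: mem_box_cart less_imp_le)
    ultimately have F: "?K \<in> ?F" by auto
    have "?d K = ?d ?K"
      unfolding convex_hull_translation by (rule diameter_translation[symmetric])
    then show "?d K \<in> ?d ` ?F" by (rule image_eqI[OF _ F])
  qed
  then have "finite (?d ` Tr)"
    by (rule finite_subset) (intro finite_imageI mesh_locally_finite bounded_cbox)
  then have "?d K \<le> meshsize Tr"
    unfolding meshsize_def using K by (intro cSup_upper) (auto intro: bdd_above_finite)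
  moreover have "bounded (convex hull K)"
    by (intro finite_imp_bounded_convex_hull full_simplex.fin simplexI K)
  ultimately show ?thesis using diameter_bounded_bound[of "convex hull K" x y] assms(2,3) by linarith
qed

lemma meshsize_pos: "0 < meshsize Tr"
proof -
  obtain K where K: "K \<in> Tr" using mesh_cover by blast
  interpret full_simplex K using simplexI K by blast
  have "2 \<le> card K" using card_K by simp
  then obtain x y where "x \<in> K" "y \<in> K" "x \<noteq> y"
    by (metis card_2_iff' card_le_Suc0_iff_eq fin not_less_eq_eq numeral_2_eq_2)
  then show ?thesis
    using dist_le_meshsize[OF K hull_inc hull_inc, of x y] by (auto intro: less_le_trans[of 0 "dist x y"])
qed

section \<open>Nodal differences and gradient sums on one element\<close>

definition fro :: "(real^'d \<Rightarrow> real^'d) \<Rightarrow> real^'d \<Rightarrow> real" where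
  "fro U x = sqrt (\<Sum>k\<in>UNIV. \<Sum>l\<in>UNIV. (pd (\<lambda>y. fe L Tr U y $ k) l x)\<^sup>2)"

lemma fro_nonneg: "0 \<le> fro U x"
  unfolding fro_def by (intro real_sqrt_ge_zero sum_nonneg zero_le_power2)

text \<open>Sums over nodes are weighted either by values or by gradients of the basis functions at
  \<open>x\<close>. A node is active if it can contribute to one of these, and only then are bounds
  on its nodal values needed.\<close>

definition active :: "real^'d \<Rightarrow> real^'d \<Rightarrow> bool" where
  "active i x \<longleftrightarrow> \<phi> i x \<noteq> 0 \<or> grad (\<phi> i) x \<noteq> 0"

lemma active_vertex:
  assumes "K \<in> Tr" "x \<in> interior (convex hull K)" "active i x"
  obtains w where "w \<in> K" "w - i \<in> lattice L"
proof -
  have xK: "x \<in> convex hull K" using assms(2) interior_subset by blast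
  have "{w. w \<in> K \<and> w - i \<in> lattice L} \<noteq> {}"
  proof
    assume e: "{w. w \<in> K \<and> w - i \<in> lattice L} = {}"
    show False
      using assms(3) unfolding active_def phi_eq[OF assms(1) xK] grad_phi[OF assms(1,2)] e by simp
  qed
  then show ?thesis using that by blast
qed

lemma active_near:
  assumes "x \<in> \<Omega> - skeleton" "active i x"
  obtains w where "w - i \<in> lattice L" "dist w x \<le> meshsize Tr"
proof -
  obtain K where K: "K \<in> Tr" "x \<in> interior (convex hull K)" "x \<in> convex hull K"
    using off_skeleton assms(1) by blast
  obtain w where "w \<in> K" "w - i \<in> lattice L" using active_vertex[OF K(1,2) assms(2)] .
  then show ?thesis by (intro that dist_le_meshsize[OF K(1) hull_inc K(3)])
qed

text \<open>On an element the finite element function is affine and takes the nodal values at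
  the vertices, so nodal differences are controlled by the (constant) gradient.\<close>

lemma nodal_difference:
  assumes x: "x \<in> \<Omega> - skeleton" and i: "i \<in> nds" "active i x"
  shows "norm (U i - fe L Tr U x) \<le> meshsize Tr * fro U x"
proof -
  obtain K where K: "K \<in> Tr" "x \<in> interior (convex hull K)" "x \<in> convex hull K"
    using off_skeleton x by blast
  interpret full_simplex K using simplexI K by blast
  obtain w where w: "w \<in> K" "w - i \<in> lattice L" using active_vertex[OF K(1,2) i(2)] .
  have wi: "i = rep w" using rep_eq[OF K(1) w(1) i(1)] w(2) by simp
  have wK: "w \<in> convex hull K" using w(1) by (rule hull_inc)
  define g where "g k = grad (\<lambda>y. fe L Tr U y $ k) x" for k
  have gk: "g k = (\<Sum>u\<in>K. U (rep u) $ k *\<^sub>R bgrad u)" for k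
  proof -
    have "g k $ l = (\<Sum>u\<in>K. U (rep u) $ k *\<^sub>R bgrad u) $ l" for l
    proof -
      have "g k $ l = (\<Sum>v\<in>nds. U v $ k * grad (\<phi> v) x $ l)"
        unfolding g_def using pd_fe[OF x] by (simp add: grad_def)
      also have "\<dots> = (\<Sum>v\<in>nds. (\<Sum>u | u \<in> K \<and> u - v \<in> lattice L. bgrad u $ l) *\<^sub>R (U v $ k))"
        unfolding grad_phi[OF K(1,2)] by (simp add: mult.commute)
      also have "\<dots> = (\<Sum>u\<in>K. bgrad u $ l *\<^sub>R (U (rep u) $ k))"
        by (rule sum_over_nodes[OF K(1)])
      finally show ?thesis by (simp add: mult.commute)
    qed
    then show ?thesis by (simp add: vec_eq_iff)
  qed
  have "fe L Tr U w = U i"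
    unfolding fe_eq[OF K(1) wK] wi using w(1) fin
    by (simp add: bary_vertex if_distrib[of "\<lambda>c. c *\<^sub>R _"] cong: if_cong)
  moreover have "(fe L Tr U w - fe L Tr U x) $ k = g k \<bullet> (w - x)" for k
  proof -
    have "(fe L Tr U w - fe L Tr U x) $ k = (\<Sum>u\<in>K. (bary K u w - bary K u x) * U (rep u) $ k)"
      unfolding fe_eq[OF K(1) wK] fe_eq[OF K(1,3)] by (simp add: sum_subtractf algebra_simps)
    also have "\<dots> = g k \<bullet> (w - x)"
      unfolding gk inner_sum_left by (rule sum.cong) (auto simp: bary_diff mult.commute)
    finally show ?thesis .
  qed
  ultimately have comp: "(U i - fe L Tr U x) $ k = g k \<bullet> (w - x)" for k by simp
  have "(norm (U i - fe L Tr U x))\<^sup>2 = (\<Sum>k\<in>UNIV. (g k \<bullet> (w - x))\<^sup>2)"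
    unfolding power2_norm_eq_inner inner_vec_def comp by (simp add: power2_eq_square)
  also have "\<dots> \<le> (\<Sum>k\<in>UNIV. (norm (g k) * norm (w - x))\<^sup>2)"
  proof (rule sum_mono)
    fix k
    show "(g k \<bullet> (w - x))\<^sup>2 \<le> (norm (g k) * norm (w - x))\<^sup>2"
      using power_mono[OF Cauchy_Schwarz_ineq2[of "g k" "w - x"] abs_ge_zero, of 2] by simp
  qed
  also have "\<dots> = (\<Sum>k\<in>UNIV. (norm (g k))\<^sup>2) * (norm (w - x))\<^sup>2"
    by (simp add: power_mult_distrib sum_distrib_right)
  also have "(\<Sum>k\<in>UNIV. (norm (g k))\<^sup>2) = (fro U x)\<^sup>2"
    unfolding fro_def g_def power2_norm_eq_inner inner_vec_def grad_def
    by (subst real_sqrt_pow2) (auto intro!: sum_nonneg simp: power2_eq_square)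
  also have "(fro U x)\<^sup>2 * (norm (w - x))\<^sup>2 = (norm (w - x) * fro U x)\<^sup>2"
    by (simp add: power_mult_distrib)
  finally have "norm (U i - fe L Tr U x) \<le> norm (w - x) * fro U x"
    by (rule power2_le_imp_le) (intro mult_nonneg_nonneg norm_ge_zero fro_nonneg)
  also have "\<dots> \<le> meshsize Tr * fro U x"
    using dist_le_meshsize[OF K(1) wK K(3)]
    by (intro mult_right_mono fro_nonneg) (simp add: dist_norm)
  finally show ?thesis .
qed

text \<open>By \<open>sum_over_nodes\<close> at most d+1 coordinate gradients occur, whatever the
  number of nodes.\<close>

lemma sum_norm_grad_phi:
  assumes x: "x \<in> \<Omega> - skeleton" and G: "\<And>K w. K \<in> Tr \<Longrightarrow> w \<in> K \<Longrightarrow> norm (full_simplex.bgrad K w) \<le> G"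
  shows "(\<Sum>v\<in>nds. norm (grad (\<phi> v) x)) \<le> real (CARD('d) + 1) * G"
proof -
  obtain K where K: "K \<in> Tr" "x \<in> interior (convex hull K)" using off_skeleton x by blast
  interpret full_simplex K using simplexI K by blast
  have "(\<Sum>v\<in>nds. norm (grad (\<phi> v) x)) \<le> (\<Sum>v\<in>nds. (\<Sum>w | w \<in> K \<and> w - v \<in> lattice L. norm (bgrad w)) *\<^sub>R 1)"
    unfolding grad_phi[OF K] by (intro sum_mono) (simp add: norm_sum)
  also have "\<dots> = (\<Sum>w\<in>K. norm (bgrad w))"
    using sum_over_nodes[OF K(1), of "\<lambda>w. norm (bgrad w)" "\<lambda>_. 1::real"] by simp
  also have "\<dots> \<le> real (card K) * G" by (rule sum_bounded_above) (use G K in blast)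
  finally show ?thesis using card_K by simp
qed

text \<open>The two mesh conditions give an inradius of at least
  \<open>c * meshsize Tr / \<sigma>\<close>. One factor 2 of the constant comes from
  \<open>norm_bgrad_le\<close>, the other from halving the inradius.\<close>

lemma gradient_bound_of_shape:
  assumes sr: "\<forall>K\<in>Tr. diameter (convex hull K) \<le> \<sigma> * inradius K" "\<sigma> > 0"
    and qu: "\<forall>K\<in>Tr. c * meshsize Tr \<le> diameter (convex hull K)" "c > 0"
    and K: "K \<in> Tr" "w \<in> K"
  shows "norm (full_simplex.bgrad K w) \<le> 4 * \<sigma> / c / meshsize Tr"
proof -
  interpret full_simplex K using simplexI K by blast
  have h: "0 < c * meshsize Tr" using qu(2) meshsize_pos by simp
  have "c * meshsize Tr \<le> \<sigma> * inradius K" using sr(1)[rule_format, OF K(1)] qu(1)[rule_format, OF K(1)] by linarith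
  then have r: "c * meshsize Tr / \<sigma> \<le> inradius K" using sr(2) by (simp add: divide_le_eq mult.commute)
  then have "inradius K > 0" using divide_pos_pos[OF h sr(2)] by linarith
  \<comment> \<open>\<open>inradius\<close> is a supremum of radii, so an inscribed ball of more
    than half that radius is used in its place.\<close>
  then have lt: "inradius K / 2 < Sup {r. \<exists>c. ball c r \<subseteq> convex hull K}"
    unfolding inradius_def by simp
  have "{r. \<exists>c. ball c r \<subseteq> convex hull K} \<noteq> {}"
    by (auto intro: exI[of _ 0])
  from less_cSupE[OF lt this] obtain \<rho> b where \<rho>: "inradius K / 2 < \<rho>" "ball b \<rho> \<subseteq> convex hull K"
    by blast
  have \<rho>0: "0 < \<rho>" using \<rho>(1) \<open>inradius K > 0\<close> by linarith
  have "norm (bgrad w) \<le> 2 / \<rho>" using norm_bgrad_le[OF \<rho>(2) \<rho>0 K(2)] .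
  also have "\<dots> \<le> 2 / (c * meshsize Tr / \<sigma> / 2)"
  proof (rule divide_left_mono)
    show "c * meshsize Tr / \<sigma> / 2 \<le> \<rho>" using divide_right_mono[OF r, of 2] \<rho>(1) by auto
    show "0 < \<rho> * (c * meshsize Tr / \<sigma> / 2)" using \<rho>0 sr(2) qu(2) meshsize_pos by simp
  qed simp
  also have "\<dots> = 4 * \<sigma> / c / meshsize Tr" by simp
  finally show ?thesis .
qed

text \<open>The first-order Taylor terms cancel because the barycentric combination of the vertices is \<open>x\<close>.\<close>

lemma interpolation_second_order:
  fixes f :: "real^'d \<Rightarrow> real^'d"
  assumes per: "periodic_fun L f" and f': "linear f'"
    and taylor: "\<And>w. dist w x \<le> meshsize Tr \<Longrightarrow> norm (f w - f x - f' (w - x)) \<le> C"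
  shows "norm (f x - fe L Tr f x) \<le> C"
proof -
  obtain K where K: "K \<in> Tr" "x \<in> convex hull K" using mesh_cover by blast
  interpret full_simplex K using simplexI K by blast
  have "f (rep w) = f w" if "w \<in> K" for w
    using periodic_funD[OF per rep(2)[OF K(1) that]] by simp
  then have "fe L Tr f x = (\<Sum>w\<in>K. bary K w x *\<^sub>R f w)"
    unfolding fe_eq[OF K] by simp
  also have "\<dots> = (\<Sum>w\<in>K. bary K w x *\<^sub>R (f w - f x - f' (w - x))) + f x
      + f' (\<Sum>w\<in>K. bary K w x *\<^sub>R (w - x))"
  proof -
    have "f' (\<Sum>w\<in>K. bary K w x *\<^sub>R (w - x)) = (\<Sum>w\<in>K. bary K w x *\<^sub>R f' (w - x))"
      by (simp add: linear_sum[OF f'] linear_cmul[OF f'])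
    moreover have "f x = (\<Sum>w\<in>K. bary K w x *\<^sub>R f x)"
      by (simp add: scaleR_sum_left[symmetric] bary_sum)
    ultimately show ?thesis by (simp add: scaleR_diff_right sum_subtractf)
  qed
  also have "(\<Sum>w\<in>K. bary K w x *\<^sub>R (w - x)) = 0"
    by (simp add: scaleR_diff_right sum_subtractf bary_combination scaleR_sum_left[symmetric] bary_sum)
  finally have "f x - fe L Tr f x = - (\<Sum>w\<in>K. bary K w x *\<^sub>R (f w - f x - f' (w - x)))"
    using linear_0[OF f'] by simp
  then have "norm (f x - fe L Tr f x) \<le> (\<Sum>w\<in>K. norm (bary K w x *\<^sub>R (f w - f x - f' (w - x))))"
    by (simp only: norm_minus_cancel norm_sum)
  also have "\<dots> \<le> (\<Sum>w\<in>K. bary K w x * C)"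
    using bary_nonneg[OF K(2)] taylor dist_le_meshsize[OF K(1) hull_inc K(2)]
    by (intro sum_mono) (auto intro!: mult_left_mono)
  also have "\<dots> = C" by (simp add: sum_distrib_right[symmetric] bary_sum)
  finally show ?thesis .
qed

end

text \<open>Value and differentiability are bundled so that the rules below chain by introduction;
  equations for \<open>pd\<close> alone would ask for the differentiability of each subterm
  separately.\<close>

definition has_pd :: "(real^'d \<Rightarrow> real) \<Rightarrow> 'd \<Rightarrow> real^'d \<Rightarrow> real \<Rightarrow> bool" where
  "has_pd f l x D \<longleftrightarrow> f differentiable at x \<and> pd f l x = D"

lemma has_pdI: "f differentiable at x \<Longrightarrow> has_pd f l x (pd f l x)"
  unfolding has_pd_def by simp

lemma has_pd_eq: "has_pd f l x D \<Longrightarrow> pd f l x = D"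
  unfolding has_pd_def by simp

lemma has_pd_mult:
  "has_pd f l x a \<Longrightarrow> has_pd g l x b \<Longrightarrow> has_pd (\<lambda>y. f y * g y) l x (a * g x + f x * b)"
  unfolding has_pd_def by (auto simp: pd_mult intro: differentiable_mult)

lemma has_pd_cmult: "has_pd f l x a \<Longrightarrow> has_pd (\<lambda>y. c * f y) l x (c * a)"
  unfolding has_pd_def by (auto simp: pd_const_mult intro: differentiable_mult)

lemma has_pd_add:
  assumes "has_pd f l x a" "has_pd g l x b"
  shows "has_pd (\<lambda>y. f y + g y) l x (a + b)"
proof -
  obtain f' g' where *: "(f has_derivative f') (at x)" "(g has_derivative g') (at x)"
    using assms unfolding has_pd_def differentiable_def by blast
  then have "pd (\<lambda>y. f y + g y) l x = a + b"
    using has_derivative_pd[OF has_derivative_add[OF *]] *[THEN has_derivative_pd] assms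
    unfolding has_pd_def by simp
  then show ?thesis using assms unfolding has_pd_def by (simp add: differentiable_add)
qed

lemma has_pd_sum:
  assumes "finite I" "\<And>i. i \<in> I \<Longrightarrow> has_pd (f i) l x (a i)"
  shows "has_pd (\<lambda>y. \<Sum>i\<in>I. f i y) l x (\<Sum>i\<in>I. a i)"
  using assms pd_sum[of I f x l] unfolding has_pd_def by (simp add: differentiable_sum)

section \<open>Consistency estimates\<close>

context torus_mesh
begin

abbreviation "h \<equiv> meshsize Tr"
abbreviation "G v \<equiv> grad (\<phi> v)"
abbreviation "I \<equiv> integral \<Omega>"

lemma ebm_fe: "ebm \<Omega> (\<lambda>x. fe L Tr (U :: real^'d \<Rightarrow> real^'n) x $ k)"
  by (rule torus_lip_ebm[OF fe_torus_lip])

lemma ebm_fro_sq: "ebm \<Omega> (\<lambda>x. (fro U x)\<^sup>2)"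
  unfolding fro_def
  by (intro ebm_power ebm_sqrt ebm_sum torus_lip_pd(1)[OF L_pos fe_torus_lip])

lemma fro_sq: "(fro U x)\<^sup>2 = (\<Sum>k\<in>UNIV. \<Sum>l\<in>UNIV. (pd (\<lambda>y. fe L Tr U y $ k) l x)\<^sup>2)"
  unfolding fro_def by (intro real_sqrt_pow2 sum_nonneg zero_le_power2)

lemmas ebm_rules = ebm_phi ebm_grad_phi ebm_fe ebm_const ebm_add ebm_mult ebm_diff ebm_minus
  ebm_sum ebm_abs ebm_inner ebm_norm ebm_power

lemma I_add: "ebm \<Omega> f \<Longrightarrow> ebm \<Omega> g \<Longrightarrow> I (\<lambda>x. f x + g x) = I f + I g"
  by (rule integral_add[OF ebm_integrable ebm_integrable])

lemma I_diff: "ebm \<Omega> f \<Longrightarrow> ebm \<Omega> g \<Longrightarrow> I (\<lambda>x. f x - g x) = I f - I g"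
  by (rule integral_diff[OF ebm_integrable ebm_integrable])

lemma I_sum: "finite A \<Longrightarrow> (\<And>i. i \<in> A \<Longrightarrow> ebm \<Omega> (f i)) \<Longrightarrow> I (\<lambda>x. \<Sum>i\<in>A. f i x) = (\<Sum>i\<in>A. I (f i))"
  by (rule integral_sum) (simp_all add: ebm_integrable)

lemma I_cong: "(\<And>x. x \<in> \<Omega> - skeleton \<Longrightarrow> f x = g x) \<Longrightarrow> I f = I g"
  by (rule integral_spike[OF negligible_skeleton]) simp

lemma I_bound:
  assumes "ebm \<Omega> f" "ebm \<Omega> g" "\<And>x. x \<in> \<Omega> - skeleton \<Longrightarrow> \<bar>f x\<bar> \<le> C * g x"
  shows "\<bar>I f\<bar> \<le> C * I g"
  using integral_abs_le_ae[OF assms(1) ebm_mult[OF ebm_const assms(2)] negligible_skeleton assms(3)]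
  by simp

lemma I_divergence:
  assumes "\<And>l. torus_lip L (F l)" "\<And>x. x \<in> \<Omega> - skeleton \<Longrightarrow> f x = (\<Sum>l\<in>UNIV. pd (F l) l x)"
  shows "I f = 0"
proof -
  have "I f = I (\<lambda>x. \<Sum>l\<in>UNIV. pd (F l) l x)" by (rule I_cong) (rule assms(2))
  also have "\<dots> = (\<Sum>l\<in>UNIV. I (pd (F l) l))"
    by (rule I_sum) (use torus_lip_pd(1)[OF L_pos assms(1)] in auto)
  finally show ?thesis using torus_lip_pd(2)[OF L_pos assms(1)] by simp
qed

text \<open>\<open>cvec\<close> is a vector-valued integral. Pairing it with a fixed vector turns it
  into a scalar integral, to which the calculus of \<open>ebm\<close> applies.\<close>

lemma inner_cvec: "cvec L Tr i j \<bullet> a = I (\<lambda>x. \<phi> i x * (G j x \<bullet> a))"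
proof -
  have "(\<lambda>x. \<phi> i x *\<^sub>R G j x) integrable_on \<Omega>"
  proof (rule integrable_componentwise_iff[THEN iffD2], rule ballI)
    fix b :: "real^'d" assume "b \<in> Basis"
    have "ebm \<Omega> (\<lambda>x. \<phi> i x * (G j x \<bullet> b))"
      by (intro ebm_rules)
    then show "(\<lambda>x. (\<phi> i x *\<^sub>R G j x) \<bullet> b) integrable_on \<Omega>"
      using ebm_integrable by simp
  qed
  from integral_linear[OF this bounded_linear_inner_left[of a]]
  show ?thesis unfolding cvec_def by (simp add: o_def)
qed

lemma nbrs_sym: "i \<in> nds \<Longrightarrow> j \<in> nbrs L Tr i \<Longrightarrow> i \<in> nbrs L Tr j"
  unfolding nbrs_def by auto

lemma nbrs_self: "i \<in> nds \<Longrightarrow> i \<in> nbrs L Tr i"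
  unfolding nbrs_def using phi_node_self by auto

lemma nbrs_subset: "nbrs L Tr i \<subseteq> nds"
  unfolding nbrs_def by auto

lemma mass_eq_0:
  assumes "j \<in> nds" "j \<notin> nbrs L Tr i"
  shows "mass L Tr i j = 0"
proof -
  have "(\<lambda>x. \<phi> i x * \<phi> j x) = (\<lambda>x. 0)" using assms by (intro ext) (auto simp: nbrs_def)
  then show ?thesis unfolding mass_def by simp
qed

text \<open>Where the first basis function is nonzero it stays nonzero nearby, so the second one
  vanishes in a neighbourhood and has zero gradient. With this, sums over \<open>nbrs\<close> may be
  extended to all nodes.\<close>

lemma cvec_eq_0:
  assumes "j \<in> nds" "j \<notin> nbrs L Tr i"
  shows "cvec L Tr i j = 0"
proof -
  have zero: "\<phi> i x *\<^sub>R G j x = 0" if x: "x \<in> \<Omega> - skeleton" for x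
  proof (cases "\<phi> i x = 0")
    case False
    have "isCont (\<phi> i) x"
      using differentiable_imp_continuous_within[OF phi_differentiable[OF x]] .
    then have "\<forall>\<^sub>F y in at x. \<phi> i y \<noteq> 0"
      using False unfolding isCont_def by (rule tendsto_imp_eventually_ne)
    then have ev: "\<forall>\<^sub>F y in at x. 0 = \<phi> j y"
      by (rule eventually_mono) (use assms in \<open>auto simp: nbrs_def\<close>)
    have "(\<phi> j has_derivative (\<lambda>_. 0)) (at x)"
      by (rule has_derivative_transform_eventually[OF has_derivative_const ev])
         (use assms False in \<open>auto simp: nbrs_def\<close>)
    note has_derivative_pd[OF this]
    then show ?thesis by (simp add: grad_def vec_eq_iff)
  qed simp
  have "I (\<lambda>x. \<phi> i x *\<^sub>R G j x) = I (\<lambda>x. 0)"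
    by (rule integral_spike[OF negligible_skeleton]) (simp add: zero)
  then show ?thesis unfolding cvec_def by simp
qed

end

section \<open>Meshes with an inverse estimate; shape regularity and quasi-uniformity enter only
  through \<open>Cg\<close>\<close>

locale inverse_estimate_mesh = torus_mesh L Tr for L :: "real^'d" and Tr +
  fixes Cg :: real
  assumes h_le_1: "meshsize Tr \<le> 1" and Cg: "0 \<le> Cg"
    and sum_grad: "\<And>x. x \<in> \<Omega> - skeleton \<Longrightarrow> (\<Sum>v\<in>nds. norm (grad (phi L Tr v) x)) \<le> Cg / meshsize Tr"
begin

definition eps :: "(real^'d \<Rightarrow> real^'d) \<Rightarrow> real^'d \<Rightarrow> real" where
  "eps U x = sqrt h + h * sqrt h * (fro U x)\<^sup>2"

lemma ebm_eps: "ebm \<Omega> (eps U)"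
  unfolding eps_def by (intro ebm_add ebm_mult ebm_const ebm_fro_sq)

text \<open>After a factor \<open>sqrt h\<close> is split off, the second summand is
  \<open>h * H1semi_sq L Tr U\<close>, whose time integral is bounded by assumption. This fixes the
  choice of \<open>eps\<close>.\<close>

lemma I_eps: "I (eps U) = sqrt h * measure lborel \<Omega> + h * sqrt h * H1semi_sq L Tr U"
proof -
  have "I (eps U) = I (\<lambda>x. sqrt h) + I (\<lambda>x. h * sqrt h * (fro U x)\<^sup>2)"
    unfolding eps_def by (rule I_add) (intro ebm_add ebm_mult ebm_const ebm_fro_sq)+
  then show ?thesis unfolding H1semi_sq_def fro_sq[symmetric] by simp
qed

lemma h_le_sqrt: "h \<le> sqrt h"
proof -
  have "h * h \<le> h * 1" using h_le_1 meshsize_pos by (intro mult_left_mono) auto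
  then show ?thesis using meshsize_pos by (intro real_le_rsqrt) (simp add: power2_eq_square)
qed

lemma h_le_eps: "h \<le> eps U x"
proof -
  have "0 \<le> h * sqrt h * (fro U x)\<^sup>2" using meshsize_pos by simp
  then show ?thesis unfolding eps_def using h_le_sqrt by linarith
qed

text \<open>Young's inequality: with s the square root of h, s F is at most 1 + (s F)^2, and the
  claim is this multiplied by s.\<close>

lemma h_fro_le_eps: "h * fro U x \<le> eps U x"
proof -
  define s F where "s = sqrt h" and "F = fro U x"
  have s: "0 < s" "h = s * s" using meshsize_pos by (auto simp: s_def)
  \<comment> \<open>This sum of squares equals twice 1 + (s F)^2 - s F.\<close>
  have "0 \<le> (s * F - 1)\<^sup>2 + (s * F)\<^sup>2 + 1" by (intro add_nonneg_nonneg) auto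
  then have "0 \<le> 1 + (s * F)\<^sup>2 - s * F" by (simp add: power2_eq_square algebra_simps)
  then have "0 \<le> s * (1 + (s * F)\<^sup>2 - s * F)" using s(1) by simp
  also have "\<dots> = s + s * s * s * F\<^sup>2 - s * s * F" by (simp add: power2_eq_square algebra_simps)
  finally show ?thesis unfolding eps_def s_def[symmetric] F_def[symmetric] s(2) using s(1) by simp
qed

text \<open>The factor h in the bound on \<open>d j\<close> pays for the 1/h of the gradient sum.
  Where the gradient vanishes, \<open>c j\<close> is forced to be 0, so \<open>d j\<close> has to be
  bounded at active nodes only.\<close>

lemma grad_sum_bound:
  assumes x: "x \<in> \<Omega> - skeleton" and B: "0 \<le> B"
    and c: "\<And>j. j \<in> nds \<Longrightarrow> \<bar>c j\<bar> \<le> norm (G j x) * d j"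
    and d: "\<And>j. j \<in> nds \<Longrightarrow> active j x \<Longrightarrow> d j \<le> h * B"
  shows "\<bar>\<Sum>j\<in>nds. c j\<bar> \<le> Cg * B"
proof -
  have "\<bar>\<Sum>j\<in>nds. c j\<bar> \<le> (\<Sum>j\<in>nds. \<bar>c j\<bar>)" by (rule sum_abs)
  also have "\<dots> \<le> (\<Sum>j\<in>nds. norm (G j x) * (h * B))"
  proof (rule sum_mono)
    fix j assume j: "j \<in> nds"
    show "\<bar>c j\<bar> \<le> norm (G j x) * (h * B)"
    proof (cases "G j x = 0")
      case False
      then have "norm (G j x) * d j \<le> norm (G j x) * (h * B)"
        using d[OF j] by (intro mult_left_mono) (auto simp: active_def)
      then show ?thesis using c[OF j] by linarith
    qed (use c[OF j] in simp)
  qed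
  also have "\<dots> = (\<Sum>j\<in>nds. norm (G j x)) * (h * B)" by (rule sum_distrib_right[symmetric])
  also have "\<dots> \<le> Cg / h * (h * B)"
    using sum_grad[OF x] B meshsize_pos by (intro mult_right_mono) auto
  also have "\<dots> = Cg * B" using meshsize_pos by simp
  finally show ?thesis .
qed

text \<open>The basis functions are nonnegative and sum to 1, so this is a convex combination, and a
  nonzero weight makes its node active.\<close>

lemma phi_sum_bound:
  assumes "\<And>i. i \<in> nds \<Longrightarrow> active i x \<Longrightarrow> \<bar>c i\<bar> \<le> B"
  shows "\<bar>\<Sum>i\<in>nds. \<phi> i x * c i\<bar> \<le> B"
proof -
  have "\<bar>\<Sum>i\<in>nds. \<phi> i x * c i\<bar> \<le> (\<Sum>i\<in>nds. \<bar>\<phi> i x * c i\<bar>)" by (rule sum_abs)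
  also have "\<dots> \<le> (\<Sum>i\<in>nds. \<phi> i x * B)"
  proof (rule sum_mono)
    fix i assume i: "i \<in> nds"
    show "\<bar>\<phi> i x * c i\<bar> \<le> \<phi> i x * B"
    proof (cases "\<phi> i x = 0")
      case False
      then show ?thesis
        using assms[OF i] phi_nonneg[of i x] by (simp add: abs_mult active_def mult_left_mono)
    qed simp
  qed
  also have "\<dots> = B" by (simp add: sum_distrib_right[symmetric] sum_phi)
  finally show ?thesis .
qed

lemma norm_fe_le:
  fixes U :: "real^'d \<Rightarrow> 'b::real_normed_vector"
  assumes "\<And>i. i \<in> nds \<Longrightarrow> norm (U i) \<le> M"
  shows "norm (fe L Tr U x) \<le> M"
proof -
  have "norm (fe L Tr U x) \<le> (\<Sum>i\<in>nds. norm (\<phi> i x *\<^sub>R U i))" unfolding fe_def by (rule norm_sum)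
  also have "\<dots> \<le> (\<Sum>i\<in>nds. \<phi> i x * M)"
    using assms phi_nonneg by (intro sum_mono) (simp add: mult_left_mono)
  also have "\<dots> = M" by (simp add: sum_distrib_right[symmetric] sum_phi)
  finally show ?thesis .
qed

end

section \<open>The scheme at one instant on one mesh; \<open>DU\<close> is a nodal vector tied to
  \<open>U\<close> by the momentum equation alone\<close>

locale scheme_state = inverse_estimate_mesh L Tr Cg for L :: "real^'d" and Tr Cg +
  fixes U DU :: "real^'d \<Rightarrow> real^'d" and P :: "real^'d \<Rightarrow> real"
    and \<alpha> :: "real^'d \<Rightarrow> real^'d \<Rightarrow> real" and \<omega> M :: real
  assumes \<omega>: "0 \<le> \<omega>" and M: "0 \<le> M"
    and U_le: "\<And>i. i \<in> nds \<Longrightarrow> norm (U i) \<le> M"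
    and DU_le: "\<And>i. i \<in> nds \<Longrightarrow> norm (DU i) \<le> M"
    and P_le: "\<And>i. i \<in> nds \<Longrightarrow> \<bar>P i\<bar> \<le> M"
    and \<alpha>: "\<And>i j. i \<in> nds \<Longrightarrow> j \<in> nds \<Longrightarrow> \<alpha> i j = \<alpha> j i \<and> 0 \<le> \<alpha> i j \<and> \<alpha> i j \<le> 1"
    and momentum: "\<And>i. i \<in> nds \<Longrightarrow> mass_lumped L Tr i *\<^sub>R DU i =
        (\<Sum>j\<in>nbrs L Tr i. (dU L Tr \<alpha> U i j - atil L Tr U i j) *\<^sub>R U j - P j *\<^sub>R cvec L Tr i j)"
    and continuity: "\<And>k. k \<in> nds \<Longrightarrow>
        0 = (\<Sum>j\<in>nbrs L Tr k. dP L Tr \<omega> k j * P j - cvec L Tr k j \<bullet> U j)"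
begin

abbreviation "u \<equiv> fe L Tr U"
abbreviation "E \<equiv> I (eps U)"

text \<open>Off the skeleton this is the divergence of the discrete velocity
  (\<open>divu_eq\<close>). The form as a nodal sum matches the products with \<open>cvec\<close> in
  the continuity equation.\<close>

definition divu :: "real^'d \<Rightarrow> real" where
  "divu x = (\<Sum>j\<in>nds. U j \<bullet> G j x)"

lemma norm_u_le: "norm (u x) \<le> M"
  by (rule norm_fe_le) (rule U_le)

lemma ebm_divu: "ebm \<Omega> divu"
  unfolding divu_def by (intro ebm_rules)

lemma divu_eq: "x \<in> \<Omega> - skeleton \<Longrightarrow> divu x = (\<Sum>l\<in>UNIV. pd (\<lambda>y. u y $ l) l x)"
  unfolding divu_def by (simp add: pd_fe inner_vec_def grad_def sum.swap[of _ UNIV])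

lemma sum_inner_grad_0: "x \<in> \<Omega> - skeleton \<Longrightarrow> (\<Sum>j\<in>nds. a \<bullet> G j x) = 0"
  by (simp add: inner_sum_right[symmetric] sum_grad_phi)

text \<open>Since the gradients sum to 0, \<open>U j\<close> may be replaced by
  \<open>U j - u x\<close>, whose size h D cancels the 1/h of the gradients.\<close>

lemma divu_le:
  assumes x: "x \<in> \<Omega> - skeleton"
  shows "\<bar>divu x\<bar> \<le> Cg * fro U x"
proof -
  have "divu x = (\<Sum>j\<in>nds. (U j - u x) \<bullet> G j x)"
    unfolding divu_def using sum_inner_grad_0[OF x, of "u x"] by (simp add: inner_diff_left sum_subtractf)
  also have "\<bar>\<dots>\<bar> \<le> Cg * fro U x"
  proof (rule grad_sum_bound[OF x fro_nonneg, of _ "\<lambda>j. norm (U j - u x)"])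
    show "\<bar>(U j - u x) \<bullet> G j x\<bar> \<le> norm (G j x) * norm (U j - u x)" for j
      using Cauchy_Schwarz_ineq2[of "U j - u x" "G j x"] by (simp add: mult.commute)
  qed (rule nodal_difference[OF x])
  finally show ?thesis .
qed

text \<open>The rows of \<open>dP\<close> sum to zero, so the diagonal entry turns the pressures
  into pressure differences.\<close>

lemma continuity_nodes:
  assumes k: "k \<in> nds"
  shows "(\<Sum>j\<in>nds. cvec L Tr k j \<bullet> U j) = (\<Sum>j\<in>nds. \<omega> * mass L Tr k j * (P j - P k))"
proof -
  have "(\<Sum>j\<in>nds. cvec L Tr k j \<bullet> U j) = (\<Sum>j\<in>nbrs L Tr k. cvec L Tr k j \<bullet> U j)"
    by (rule sum.mono_neutral_right[OF finite_nodes nbrs_subset]) (simp add: cvec_eq_0)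
  also have "\<dots> = (\<Sum>j\<in>nbrs L Tr k. dP L Tr \<omega> k j * P j)"
    using continuity[OF k] by (simp add: sum_subtractf)
  also have "\<dots> = (\<Sum>j\<in>nds. dP L Tr \<omega> k j * P j)"
    by (rule sum.mono_neutral_left[OF finite_nodes nbrs_subset])
       (use nbrs_self[OF k] in \<open>auto simp: dP_def mass_eq_0\<close>)
  also have "\<dots> = dP L Tr \<omega> k k * P k + (\<Sum>j\<in>nds - {k}. dP L Tr \<omega> k j * P j)"
    by (rule sum.remove[OF finite_nodes k])
  also have "\<dots> = (\<Sum>j\<in>nds - {k}. \<omega> * mass L Tr k j * (P j - P k))"
    by (simp add: dP_def sum_distrib_right sum_distrib_left sum_subtractf algebra_simps)
  also have "\<dots> = (\<Sum>j\<in>nds. \<omega> * mass L Tr k j * (P j - P k))"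
    by (simp add: sum.remove[OF finite_nodes k])
  finally show ?thesis .
qed

text \<open>Swapping the summation indices moves the difference from the pressure, which is only
  bounded, to the test values, which vary slowly.\<close>

lemma div_tested_le:
  assumes B: "0 \<le> B"
    and near: "\<And>x k. x \<in> \<Omega> - skeleton \<Longrightarrow> k \<in> nds \<Longrightarrow> active k x \<Longrightarrow> \<bar>c k - f x\<bar> \<le> B * eps U x"
  shows "\<bar>\<Sum>k\<in>nds. c k * I (\<lambda>x. \<phi> k x * divu x)\<bar> \<le> 2 * \<omega> * M * B * E"
proof -
  have 1: "I (\<lambda>x. \<phi> k x * divu x) = (\<Sum>j\<in>nds. cvec L Tr k j \<bullet> U j)" for k
  proof -
    have "I (\<lambda>x. \<phi> k x * divu x) = I (\<lambda>x. \<Sum>j\<in>nds. \<phi> k x * (G j x \<bullet> U j))"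
      unfolding divu_def by (simp add: sum_distrib_left inner_commute)
    also have "\<dots> = (\<Sum>j\<in>nds. I (\<lambda>x. \<phi> k x * (G j x \<bullet> U j)))"
      by (rule I_sum[OF finite_nodes]) (intro ebm_rules)
    finally show ?thesis by (simp add: inner_cvec)
  qed
  let ?m = "mass L Tr"
  have sym: "?m k j = ?m j k" for k j unfolding mass_def by (simp add: mult.commute)
  have m0: "0 \<le> ?m k j" for k j
    unfolding mass_def
    by (rule integral_nonneg[OF ebm_integrable]) (auto intro!: ebm_rules simp: phi_nonneg)
  have "(\<Sum>k\<in>nds. c k * I (\<lambda>x. \<phi> k x * divu x))
      = (\<Sum>k\<in>nds. \<Sum>j\<in>nds. \<omega> * ?m k j * P j * c k) - (\<Sum>k\<in>nds. \<Sum>j\<in>nds. \<omega> * ?m k j * P k * c k)"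
    unfolding 1 by (simp add: continuity_nodes sum_distrib_left sum_subtractf[symmetric] algebra_simps)
  also have "(\<Sum>k\<in>nds. \<Sum>j\<in>nds. \<omega> * ?m k j * P j * c k) = (\<Sum>k\<in>nds. \<Sum>j\<in>nds. \<omega> * ?m k j * P k * c j)"
    by (subst sum.swap) (simp add: sym)
  also have "(\<Sum>k\<in>nds. \<Sum>j\<in>nds. \<omega> * ?m k j * P k * c j) - (\<Sum>k\<in>nds. \<Sum>j\<in>nds. \<omega> * ?m k j * P k * c k)
      = (\<Sum>k\<in>nds. \<Sum>j\<in>nds. \<omega> * ?m k j * (P k * (c j - c k)))"
    by (simp add: sum_subtractf[symmetric] algebra_simps)
  also have "\<bar>\<dots>\<bar> \<le> (\<Sum>k\<in>nds. \<Sum>j\<in>nds. \<omega> * M * (?m k j * \<bar>c j - c k\<bar>))"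
  proof (intro order_trans[OF sum_abs] sum_mono order_trans[OF sum_abs])
    fix k j assume kj: "k \<in> nds" "j \<in> nds"
    have "\<bar>\<omega> * ?m k j * (P k * (c j - c k))\<bar> = (\<omega> * ?m k j) * (\<bar>P k\<bar> * \<bar>c j - c k\<bar>)"
      using \<omega> m0[of k j] by (simp add: abs_mult)
    also have "\<dots> \<le> (\<omega> * ?m k j) * (M * \<bar>c j - c k\<bar>)"
      using \<omega> m0[of k j] P_le[OF kj(1)] by (intro mult_left_mono mult_right_mono) auto
    finally show "\<bar>\<omega> * ?m k j * (P k * (c j - c k))\<bar> \<le> \<omega> * M * (?m k j * \<bar>c j - c k\<bar>)"
      by (simp add: mult_ac)
  qed
  \<comment> \<open>The mass entries are turned back into integrals. At each \<open>x\<close> only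
    nodes active at that same point are then compared, both through \<open>f x\<close>, which is the
    origin of the factor 2.\<close>
  also have "\<dots> = \<omega> * M * I (\<lambda>x. \<Sum>k\<in>nds. \<Sum>j\<in>nds. \<phi> k x * \<phi> j x * \<bar>c j - c k\<bar>)"
  proof -
    have "I (\<lambda>x. \<Sum>k\<in>nds. \<Sum>j\<in>nds. \<phi> k x * \<phi> j x * \<bar>c j - c k\<bar>)
        = (\<Sum>k\<in>nds. I (\<lambda>x. \<Sum>j\<in>nds. \<phi> k x * \<phi> j x * \<bar>c j - c k\<bar>))"
      by (rule I_sum[OF finite_nodes]) (intro ebm_rules)
    also have "\<dots> = (\<Sum>k\<in>nds. \<Sum>j\<in>nds. I (\<lambda>x. \<phi> k x * \<phi> j x * \<bar>c j - c k\<bar>))"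
      by (intro sum.cong refl I_sum[OF finite_nodes]) (intro ebm_rules)
    finally show ?thesis by (simp add: mass_def sum_distrib_left)
  qed
  also have "\<dots> \<le> \<omega> * M * (2 * B * E)"
  proof (rule mult_left_mono)
    have "\<bar>I (\<lambda>x. \<Sum>k\<in>nds. \<Sum>j\<in>nds. \<phi> k x * \<phi> j x * \<bar>c j - c k\<bar>)\<bar> \<le> 2 * B * E"
    proof (rule I_bound[OF _ ebm_eps])
      show "ebm \<Omega> (\<lambda>x. \<Sum>k\<in>nds. \<Sum>j\<in>nds. \<phi> k x * \<phi> j x * \<bar>c j - c k\<bar>)" by (intro ebm_rules)
      fix x assume x: "x \<in> \<Omega> - skeleton"
      have "(\<Sum>k\<in>nds. \<Sum>j\<in>nds. \<phi> k x * \<phi> j x * \<bar>c j - c k\<bar>)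
          = (\<Sum>k\<in>nds. \<phi> k x * (\<Sum>j\<in>nds. \<phi> j x * \<bar>c j - c k\<bar>))"
        by (simp add: sum_distrib_left mult.assoc)
      also have "\<bar>\<dots>\<bar> \<le> 2 * B * eps U x"
      proof (rule phi_sum_bound, rule phi_sum_bound)
        fix k j assume "k \<in> nds" "active k x" "j \<in> nds" "active j x"
        then show "\<bar>\<bar>c j - c k\<bar>\<bar> \<le> 2 * B * eps U x"
          using near[OF x, of k] near[OF x, of j] by linarith
      qed
      finally show "\<bar>\<Sum>k\<in>nds. \<Sum>j\<in>nds. \<phi> k x * \<phi> j x * \<bar>c j - c k\<bar>\<bar> \<le> 2 * B * eps U x" .
    qed
    then show "I (\<lambda>x. \<Sum>k\<in>nds. \<Sum>j\<in>nds. \<phi> k x * \<phi> j x * \<bar>c j - c k\<bar>) \<le> 2 * B * E" by linarith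
  qed (use \<omega> M in simp)
  finally show ?thesis by (simp add: mult_ac)
qed

text \<open>The test function is split into a combination of basis functions, handled by the
  discrete continuity equation, and a remainder of size h that meets the pointwise bound
  \<open>divu_le\<close>. The nodal values \<open>c\<close> need only be close up to
  \<open>eps\<close>, so that they may contain the velocity.\<close>

lemma div_weak_le:
  assumes f: "ebm \<Omega> f" and A: "0 \<le> A" and B: "0 \<le> B"
    and interp: "\<And>x. x \<in> \<Omega> - skeleton \<Longrightarrow> \<bar>f x - (\<Sum>k\<in>nds. \<phi> k x * c k)\<bar> \<le> A * h"
    and near: "\<And>x k. x \<in> \<Omega> - skeleton \<Longrightarrow> k \<in> nds \<Longrightarrow> active k x \<Longrightarrow> \<bar>c k - f x\<bar> \<le> B * eps U x"
  shows "\<bar>I (\<lambda>x. f x * divu x)\<bar> \<le> (A * Cg + 2 * \<omega> * M * B) * E"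
proof -
  let ?r = "\<lambda>x. (f x - (\<Sum>k\<in>nds. \<phi> k x * c k)) * divu x"
  have r: "ebm \<Omega> ?r" by (intro ebm_rules f ebm_divu)
  have "I (\<lambda>x. f x * divu x) = I (\<lambda>x. ?r x + (\<Sum>k\<in>nds. c k * (\<phi> k x * divu x)))"
    by (rule I_cong) (simp add: algebra_simps sum_distrib_left)
  also have "\<dots> = I ?r + I (\<lambda>x. \<Sum>k\<in>nds. c k * (\<phi> k x * divu x))"
    by (rule I_add[OF r]) (intro ebm_rules ebm_divu)
  also have "I (\<lambda>x. \<Sum>k\<in>nds. c k * (\<phi> k x * divu x)) = (\<Sum>k\<in>nds. I (\<lambda>x. c k * (\<phi> k x * divu x)))"
    by (rule I_sum[OF finite_nodes]) (intro ebm_rules ebm_divu)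
  finally have eq: "I (\<lambda>x. f x * divu x) = I ?r + (\<Sum>k\<in>nds. c k * I (\<lambda>x. \<phi> k x * divu x))" by simp
  have "\<bar>I ?r\<bar> \<le> A * Cg * E"
  proof (rule I_bound[OF r ebm_eps])
    fix x assume x: "x \<in> \<Omega> - skeleton"
    have "\<bar>?r x\<bar> \<le> (A * h) * (Cg * fro U x)"
      unfolding abs_mult using interp[OF x] divu_le[OF x] A meshsize_pos by (intro mult_mono) auto
    also have "\<dots> = A * Cg * (h * fro U x)" by simp
    also have "\<dots> \<le> A * Cg * eps U x"
      using A Cg h_fro_le_eps by (intro mult_left_mono) auto
    finally show "\<bar>?r x\<bar> \<le> A * Cg * eps U x" .
  qed
  moreover have "\<bar>\<Sum>k\<in>nds. c k * I (\<lambda>x. \<phi> k x * divu x)\<bar> \<le> 2 * \<omega> * M * B * E"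
    by (rule div_tested_le[OF B near])
  ultimately show ?thesis unfolding eq distrib_right by linarith
qed

text \<open>The node itself may lie at the opposite end of the box. A lattice translate of it is
  close to \<open>x\<close>, and by periodicity \<open>f\<close> has the same value there.\<close>

lemma active_near_value:
  assumes x: "x \<in> \<Omega> - skeleton" "active k x" and per: "periodic_fun L f"
    and near: "\<And>w. dist w x \<le> h \<Longrightarrow> norm (f w - f x) \<le> \<Lambda> * h"
  shows "norm (f k - f x) \<le> \<Lambda> * h"
proof -
  obtain w where w: "w - k \<in> lattice L" "dist w x \<le> h" using active_near[OF x] .
  have "f w = f k" using periodic_funD[OF per w(1)] .
  then show ?thesis using near[OF w(2)] by simp
qed

text \<open>Integration by parts turns the error into minus the integral of \<open>q\<close> times
  \<open>divu\<close>, to which \<open>div_weak_le\<close> applies with the nodal values of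
  \<open>q\<close>.\<close>

lemma err_q_le:
  assumes q: "torus_lip L q" and dq: "\<And>x. x \<in> \<Omega> - skeleton \<Longrightarrow> q differentiable at x" and \<Lambda>: "0 \<le> \<Lambda>"
    and near: "\<And>x w. x \<in> \<Omega> \<Longrightarrow> dist w x \<le> h \<Longrightarrow> \<bar>q w - q x\<bar> \<le> \<Lambda> * h"
  shows "\<bar>err_q L Tr U q\<bar> \<le> (\<Lambda> * Cg + 2 * \<omega> * M * \<Lambda>) * E"
proof -
  have per: "periodic_fun L q" using q unfolding torus_lip_def by blast
  have near': "\<bar>q k - q x\<bar> \<le> \<Lambda> * h" if "x \<in> \<Omega> - skeleton" "active k x" for k x
    using active_near_value[OF that per, of \<Lambda>] near[of x] that by auto
  have e1: "ebm \<Omega> (\<lambda>x. u x \<bullet> grad q x)"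
    unfolding inner_vec_def grad_def using torus_lip_pd(1)[OF L_pos q] by (simp add: ebm_sum ebm_mult ebm_fe)
  have e2: "ebm \<Omega> (\<lambda>x. q x * divu x)" by (intro ebm_rules ebm_divu torus_lip_ebm[OF q])
  have "I (\<lambda>x. u x \<bullet> grad q x + q x * divu x) = 0"
  proof (rule I_divergence[of "\<lambda>l y. u y $ l * q y"])
    show "torus_lip L (\<lambda>y. u y $ l * q y)" for l by (intro torus_lip_mult fe_torus_lip q)
    fix x assume x: "x \<in> \<Omega> - skeleton"
    have "pd (\<lambda>y. u y $ l * q y) l x = pd (\<lambda>y. u y $ l) l x * q x + u x $ l * pd q l x" for l
      by (intro has_pd_eq has_pd_mult has_pdI fe_differentiable[OF x] dq[OF x])
    then show "u x \<bullet> grad q x + q x * divu x = (\<Sum>l\<in>UNIV. pd (\<lambda>y. u y $ l * q y) l x)"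
      unfolding divu_eq[OF x]
      by (simp add: inner_vec_def grad_def sum.distrib sum_distrib_left mult.commute)
  qed
  then have "err_q L Tr U q = - I (\<lambda>x. q x * divu x)"
    unfolding err_q_def using I_add[OF e1 e2] by simp
  moreover have "\<bar>I (\<lambda>x. q x * divu x)\<bar> \<le> (\<Lambda> * Cg + 2 * \<omega> * M * \<Lambda>) * E"
  proof (rule div_weak_le[OF torus_lip_ebm[OF q] \<Lambda> \<Lambda>])
    fix x assume x: "x \<in> \<Omega> - skeleton"
    have "q x - (\<Sum>k\<in>nds. \<phi> k x * q k) = (\<Sum>k\<in>nds. \<phi> k x * (q x - q k))"
      by (simp add: right_diff_distrib sum_subtractf sum_distrib_right[symmetric] sum_phi)
    also have "\<bar>\<dots>\<bar> \<le> \<Lambda> * h"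
      by (rule phi_sum_bound) (use near'[OF x] in \<open>simp add: abs_minus_commute\<close>)
    finally show "\<bar>q x - (\<Sum>k\<in>nds. \<phi> k x * q k)\<bar> \<le> \<Lambda> * h" .
    fix k assume "active k x"
    then have "\<bar>q k - q x\<bar> \<le> \<Lambda> * h" using near'[OF x] by blast
    also have "\<dots> \<le> \<Lambda> * eps U x" using \<Lambda> h_le_eps by (rule mult_left_mono[rotated])
    finally show "\<bar>q k - q x\<bar> \<le> \<Lambda> * eps U x" .
  qed
  ultimately show ?thesis by simp
qed

end

section \<open>The momentum equation tested with a smooth solenoidal field\<close>

locale tested_state = scheme_state L Tr Cg U DU P \<alpha> \<omega> M
  for L :: "real^'d" and Tr Cg U DU P \<alpha> \<omega> M +
  fixes v :: "real^'d \<Rightarrow> real^'d" and \<Lambda> :: real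
  assumes v_per: "periodic_fun L v" and v_lip: "\<And>k. torus_lip L (\<lambda>x. v x $ k)"
    and v_diff: "\<And>k x. (\<lambda>x. v x $ k) differentiable at x"
    and \<Lambda>: "0 \<le> \<Lambda>" and v_le: "\<And>x. x \<in> \<Omega> \<Longrightarrow> norm (v x) \<le> \<Lambda>"
    and v_near: "\<And>x w. x \<in> \<Omega> \<Longrightarrow> dist w x \<le> meshsize Tr \<Longrightarrow> norm (v w - v x) \<le> \<Lambda> * meshsize Tr"
    and pd_v_le: "\<And>x k l. x \<in> \<Omega> \<Longrightarrow> \<bar>pd (\<lambda>y. v y $ k) l x\<bar> \<le> \<Lambda>"
    and v_interp: "\<And>x. x \<in> \<Omega> \<Longrightarrow> norm (v x - fe L Tr v x) \<le> \<Lambda> * (meshsize Tr)\<^sup>2"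
    and v_div: "\<And>x. (\<Sum>k\<in>UNIV. pd (\<lambda>y. v y $ k) k x) = 0"
begin

abbreviation "dv k l x \<equiv> pd (\<lambda>y. v y $ k) l x"

lemma ebm_v: "ebm \<Omega> (\<lambda>x. v x $ k)"
  by (rule torus_lip_ebm[OF v_lip])

lemma ebm_dv: "ebm \<Omega> (dv k l)"
  by (rule torus_lip_pd(1)[OF L_pos v_lip])

lemmas ebm_all = ebm_rules ebm_v ebm_dv ebm_divu

lemma v_node: "x \<in> \<Omega> - skeleton \<Longrightarrow> active i x \<Longrightarrow> norm (v i - v x) \<le> \<Lambda> * h"
  by (rule active_near_value[OF _ _ v_per]) (auto intro: v_near)

lemma abs_inner_le: "norm a \<le> A \<Longrightarrow> norm b \<le> B \<Longrightarrow> \<bar>a \<bullet> b\<bar> \<le> A * B" for a b :: "real^'d"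
  using order_trans[OF Cauchy_Schwarz_ineq2[of a b] mult_mono[of "norm a" A "norm b" B]]
    order_trans[OF norm_ge_zero[of a]] by simp

text \<open>Lumping pairs \<open>DU i\<close> with \<open>v i\<close> where the exact integral pairs
  it with \<open>v x\<close>. What remains is a convex combination of terms with the factor
  \<open>v x - v i\<close>.\<close>

lemma mass_lumping_le:
  "\<bar>I (\<lambda>x. fe L Tr DU x \<bullet> v x) - (\<Sum>i\<in>nds. mass_lumped L Tr i * (DU i \<bullet> v i))\<bar> \<le> M * \<Lambda> * E"
proof -
  have "(\<Sum>i\<in>nds. mass_lumped L Tr i * (DU i \<bullet> v i)) = (\<Sum>i\<in>nds. I (\<lambda>x. \<phi> i x * (DU i \<bullet> v i)))"
    unfolding mass_lumped_def by simp
  also have "\<dots> = I (\<lambda>x. \<Sum>i\<in>nds. \<phi> i x * (DU i \<bullet> v i))"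
    by (rule I_sum[OF finite_nodes, symmetric]) (intro ebm_all)
  finally have "I (\<lambda>x. fe L Tr DU x \<bullet> v x) - (\<Sum>i\<in>nds. mass_lumped L Tr i * (DU i \<bullet> v i))
      = I (\<lambda>x. fe L Tr DU x \<bullet> v x) - I (\<lambda>x. \<Sum>i\<in>nds. \<phi> i x * (DU i \<bullet> v i))" by simp
  also have "\<dots> = I (\<lambda>x. fe L Tr DU x \<bullet> v x - (\<Sum>i\<in>nds. \<phi> i x * (DU i \<bullet> v i)))"
    by (rule I_diff[symmetric]) (intro ebm_all)+
  also have "\<bar>\<dots>\<bar> \<le> M * \<Lambda> * E"
  proof (rule I_bound[OF _ ebm_eps])
    show "ebm \<Omega> (\<lambda>x. fe L Tr DU x \<bullet> v x - (\<Sum>i\<in>nds. \<phi> i x * (DU i \<bullet> v i)))" by (intro ebm_all)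
    fix x assume x: "x \<in> \<Omega> - skeleton"
    have "fe L Tr DU x \<bullet> v x - (\<Sum>i\<in>nds. \<phi> i x * (DU i \<bullet> v i))
        = (\<Sum>i\<in>nds. \<phi> i x * (DU i \<bullet> (v x - v i)))"
      unfolding fe_def inner_sum_left by (simp add: inner_diff_right right_diff_distrib sum_subtractf)
    also have "\<bar>\<dots>\<bar> \<le> M * (\<Lambda> * h)"
      by (rule phi_sum_bound, rule abs_inner_le) (use DU_le v_node[OF x] in \<open>auto simp: norm_minus_commute\<close>)
    also have "\<dots> \<le> M * \<Lambda> * eps U x"
      unfolding mult.assoc using M \<Lambda> h_le_eps by (intro mult_left_mono) auto
    finally show "\<bar>fe L Tr DU x \<bullet> v x - (\<Sum>i\<in>nds. \<phi> i x * (DU i \<bullet> v i))\<bar> \<le> M * \<Lambda> * eps U x" .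
  qed
  finally show ?thesis .
qed

abbreviation "D i j \<equiv> dU L Tr \<alpha> U i j"

lemma dU_nonneg: "i \<in> nds \<Longrightarrow> j \<noteq> i \<Longrightarrow> 0 \<le> D i j"
  using \<alpha>[of i j] nbrs_subset[of i] unfolding dU_def by auto

lemma aij_antisym: "aij L Tr U j i = - aij L Tr U i j"
proof -
  have "(\<lambda>x. \<phi> j x * (u x \<bullet> G i x) - \<phi> i x * (u x \<bullet> G j x))
      = (\<lambda>x. - (\<phi> i x * (u x \<bullet> G j x) - \<phi> j x * (u x \<bullet> G i x)))" by auto
  then show ?thesis unfolding aij_def by (simp only: integral_neg mult_minus_right)
qed

lemma dU_sym: "i \<in> nds \<Longrightarrow> j \<in> nds \<Longrightarrow> D i j = D j i" if "i \<noteq> j"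
  using that \<alpha>[of i j] nbrs_sym[of i j] nbrs_sym[of j i] aij_antisym[of i j] unfolding dU_def by auto

text \<open>The bound is left as an integral of basis functions times gradients, so that the double
  sum in \<open>upwinding_le\<close> can be moved under one integral and estimated
  pointwise.\<close>

lemma dU_le:
  assumes "i \<in> nds" "j \<in> nds" "j \<noteq> i"
  shows "D i j \<le> M / 2 * I (\<lambda>x. \<phi> i x * norm (G j x) + \<phi> j x * norm (G i x))"
proof -
  have "D i j \<le> \<bar>aij L Tr U i j\<bar>"
    using assms \<alpha>[OF assms(1,2)] unfolding dU_def by (auto intro: mult_left_le_one_le)
  also have "\<dots> = 1/2 * \<bar>I (\<lambda>x. \<phi> i x * (u x \<bullet> G j x) - \<phi> j x * (u x \<bullet> G i x))\<bar>"
    unfolding aij_def by (simp add: abs_mult)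
  also have "\<dots> \<le> 1/2 * (M * I (\<lambda>x. \<phi> i x * norm (G j x) + \<phi> j x * norm (G i x)))"
  proof (rule mult_left_mono, rule I_bound)
    fix x assume x: "x \<in> \<Omega> - skeleton"
    have "\<bar>u x \<bullet> G k x\<bar> \<le> M * norm (G k x)" for k by (rule abs_inner_le[OF norm_u_le order_refl])
    then have "\<bar>\<phi> i x * (u x \<bullet> G j x)\<bar> \<le> \<phi> i x * (M * norm (G j x))"
      "\<bar>\<phi> j x * (u x \<bullet> G i x)\<bar> \<le> \<phi> j x * (M * norm (G i x))"
      unfolding abs_mult using phi_nonneg by (auto intro: mult_left_mono)
    then show "\<bar>\<phi> i x * (u x \<bullet> G j x) - \<phi> j x * (u x \<bullet> G i x)\<bar>
        \<le> M * (\<phi> i x * norm (G j x) + \<phi> j x * norm (G i x))"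
      by (simp add: algebra_simps)
  qed (intro ebm_all | simp)+
  finally show ?thesis by simp
qed

text \<open>Symmetrising produces a product of a velocity and a test-function difference.\<close>

lemma upwinding_le:
  "\<bar>\<Sum>i\<in>nds. \<Sum>j\<in>nds. D i j * (U j \<bullet> v i)\<bar> \<le> 2 * M * Cg * \<Lambda> * E"
proof -
  \<comment> \<open>Row sums of \<open>D\<close> vanish, so its negative diagonal is absorbed into
    the differences \<open>U j - U i\<close>. The remaining coefficients are symmetric and
    nonnegative.\<close>
  define \<delta> where "\<delta> i j = (if j = i then 0 else D i j)" for i j
  define w where "w i j = norm (U j - U i) * norm (v i - v j)" for i j
  let ?B = "\<Sum>i\<in>nds. \<Sum>j\<in>nds. D i j * (U j \<bullet> v i)"
  have row: "(\<Sum>j\<in>nds. D i j * (U j \<bullet> v i)) = (\<Sum>j\<in>nds. \<delta> i j * ((U j - U i) \<bullet> v i))" if i: "i \<in> nds" for i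
  proof -
    have "D i i = - (\<Sum>k\<in>nbrs L Tr i - {i}. D i k)"
      by (simp add: dU_def)
    also have "(\<Sum>k\<in>nbrs L Tr i - {i}. D i k) = (\<Sum>k\<in>nds - {i}. D i k)"
      by (rule sum.mono_neutral_left) (use finite_nodes nbrs_subset in \<open>auto simp: dU_def\<close>)
    finally have Dii: "D i i = - (\<Sum>k\<in>nds - {i}. D i k)" .
    have "(\<Sum>j\<in>nds. D i j * (U j \<bullet> v i)) = D i i * (U i \<bullet> v i) + (\<Sum>j\<in>nds - {i}. D i j * (U j \<bullet> v i))"
      by (rule sum.remove[OF finite_nodes i])
    also have "\<dots> = (\<Sum>j\<in>nds - {i}. D i j * ((U j - U i) \<bullet> v i))"
      unfolding Dii by (simp add: inner_diff_left sum_distrib_right sum_subtractf right_diff_distrib)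
    also have "\<dots> = (\<Sum>j\<in>nds. \<delta> i j * ((U j - U i) \<bullet> v i))"
      by (rule sum.mono_neutral_cong_left[OF finite_nodes]) (auto simp: \<delta>_def)
    finally show ?thesis .
  qed
  have sym: "\<delta> i j = \<delta> j i" if "i \<in> nds" "j \<in> nds" for i j
    using dU_sym[OF _ that] unfolding \<delta>_def by auto
  have "?B = (\<Sum>i\<in>nds. \<Sum>j\<in>nds. \<delta> i j * ((U j - U i) \<bullet> v i))" using row by simp
  moreover have "\<dots> = (\<Sum>i\<in>nds. \<Sum>j\<in>nds. \<delta> i j * ((U i - U j) \<bullet> v j))"
    by (subst sum.swap) (intro sum.cong refl, simp only: sym)
  ultimately have "2 * ?B = (\<Sum>i\<in>nds. \<Sum>j\<in>nds. \<delta> i j * ((U j - U i) \<bullet> v i))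
      + (\<Sum>i\<in>nds. \<Sum>j\<in>nds. \<delta> i j * ((U i - U j) \<bullet> v j))" by simp
  also have "\<dots> = (\<Sum>i\<in>nds. \<Sum>j\<in>nds. \<delta> i j * ((U j - U i) \<bullet> (v i - v j)))"
    unfolding sum.distrib[symmetric]
    by (intro sum.cong refl) (simp add: inner_diff_left inner_diff_right algebra_simps)
  finally have B2: "2 * ?B = (\<Sum>i\<in>nds. \<Sum>j\<in>nds. \<delta> i j * ((U j - U i) \<bullet> (v i - v j)))" .
  have "\<bar>2 * ?B\<bar> \<le> (\<Sum>i\<in>nds. \<Sum>j\<in>nds. M / 2 * I (\<lambda>x. (\<phi> i x * norm (G j x) + \<phi> j x * norm (G i x)) * w i j))"
    unfolding B2
  proof (intro order_trans[OF sum_abs] sum_mono order_trans[OF sum_abs])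
    fix i j assume ij: "i \<in> nds" "j \<in> nds"
    let ?J = "I (\<lambda>x. \<phi> i x * norm (G j x) + \<phi> j x * norm (G i x))"
    have J0: "0 \<le> ?J"
    proof (rule integral_nonneg[OF ebm_integrable])
      show "ebm \<Omega> (\<lambda>x. \<phi> i x * norm (G j x) + \<phi> j x * norm (G i x))" by (intro ebm_all)
      show "0 \<le> \<phi> i x * norm (G j x) + \<phi> j x * norm (G i x)" for x
        by (intro add_nonneg_nonneg mult_nonneg_nonneg phi_nonneg norm_ge_zero)
    qed
    have "0 \<le> \<delta> i j" "\<delta> i j \<le> M / 2 * ?J"
      using dU_nonneg[OF ij(1)] dU_le[OF ij] M J0 unfolding \<delta>_def by auto
    then have "\<bar>\<delta> i j\<bar> * \<bar>(U j - U i) \<bullet> (v i - v j)\<bar> \<le> (M / 2 * ?J) * w i j"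
      unfolding w_def by (intro mult_mono[OF _ Cauchy_Schwarz_ineq2]) auto
    then show "\<bar>\<delta> i j * ((U j - U i) \<bullet> (v i - v j))\<bar>
        \<le> M / 2 * I (\<lambda>x. (\<phi> i x * norm (G j x) + \<phi> j x * norm (G i x)) * w i j)"
      unfolding abs_mult integral_mult_left by (simp only: mult.assoc)
  qed
  also have "\<dots> = M / 2 * I (\<lambda>x. \<Sum>i\<in>nds. \<Sum>j\<in>nds. (\<phi> i x * norm (G j x) + \<phi> j x * norm (G i x)) * w i j)"
  proof -
    have "I (\<lambda>x. \<Sum>i\<in>nds. \<Sum>j\<in>nds. (\<phi> i x * norm (G j x) + \<phi> j x * norm (G i x)) * w i j)
        = (\<Sum>i\<in>nds. I (\<lambda>x. \<Sum>j\<in>nds. (\<phi> i x * norm (G j x) + \<phi> j x * norm (G i x)) * w i j))"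
      by (rule I_sum[OF finite_nodes]) (intro ebm_all)
    also have "\<dots> = (\<Sum>i\<in>nds. \<Sum>j\<in>nds. I (\<lambda>x. (\<phi> i x * norm (G j x) + \<phi> j x * norm (G i x)) * w i j))"
      by (intro sum.cong refl I_sum[OF finite_nodes]) (intro ebm_all)
    finally show ?thesis by (simp only: sum_distrib_left)
  qed
  \<comment> \<open>Passing both differences through their values at \<open>x\<close> gives 2 times
    2, and the two symmetric halves of the integrand double this to 8. With \<open>M / 2\<close> and
    the halving of \<open>2 * ?B\<close>, the constant 2 in the claim results.\<close>
  also have "\<dots> \<le> M / 2 * (8 * Cg * \<Lambda> * E)"
  proof (rule mult_left_mono)
    have "\<bar>I (\<lambda>x. \<Sum>i\<in>nds. \<Sum>j\<in>nds. (\<phi> i x * norm (G j x) + \<phi> j x * norm (G i x)) * w i j)\<bar> \<le> 8 * Cg * \<Lambda> * E"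
    proof (rule I_bound[OF _ ebm_eps])
      show "ebm \<Omega> (\<lambda>x. \<Sum>i\<in>nds. \<Sum>j\<in>nds. (\<phi> i x * norm (G j x) + \<phi> j x * norm (G i x)) * w i j)"
        by (intro ebm_all)
      fix x assume x: "x \<in> \<Omega> - skeleton"
      have wle: "w i j \<le> h * (4 * \<Lambda> * (h * fro U x))"
        if ij: "i \<in> nds" "j \<in> nds" "active i x" "active j x" for i j
      proof -
        have "norm (U j - U i) \<le> 2 * (h * fro U x)"
          using nodal_difference[OF x ij(1,3), of U] nodal_difference[OF x ij(2,4), of U]
            norm_triangle_ineq4[of "U j - u x" "U i - u x"] by simp
        moreover have "norm (v i - v j) \<le> 2 * (\<Lambda> * h)"
          using v_node[OF x ij(3)] v_node[OF x ij(4)]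
            norm_triangle_ineq4[of "v i - v x" "v j - v x"] by simp
        ultimately have "w i j \<le> (2 * (h * fro U x)) * (2 * (\<Lambda> * h))"
          unfolding w_def using fro_nonneg meshsize_pos by (intro mult_mono) auto
        then show ?thesis by (simp add: mult_ac)
      qed
      have B0: "0 \<le> 4 * \<Lambda> * (h * fro U x)" using \<Lambda> fro_nonneg meshsize_pos by simp
      have w0: "0 \<le> w i j" for i j unfolding w_def by simp
      have wsym: "w i j = w j i" for i j unfolding w_def by (simp add: norm_minus_commute)
      let ?T = "\<Sum>i\<in>nds. \<phi> i x * (\<Sum>j\<in>nds. norm (G j x) * w i j)"
      have T: "\<bar>?T\<bar> \<le> Cg * (4 * \<Lambda> * (h * fro U x))"
      proof (rule phi_sum_bound)
        fix i assume i: "i \<in> nds" "active i x"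
        show "\<bar>\<Sum>j\<in>nds. norm (G j x) * w i j\<bar> \<le> Cg * (4 * \<Lambda> * (h * fro U x))"
          by (rule grad_sum_bound[OF x B0, of _ "w i"]) (use wle[OF i(1) _ i(2)] w0 in auto)
      qed
      have "(\<Sum>i\<in>nds. \<Sum>j\<in>nds. (\<phi> i x * norm (G j x) + \<phi> j x * norm (G i x)) * w i j)
          = ?T + (\<Sum>i\<in>nds. \<Sum>j\<in>nds. \<phi> j x * norm (G i x) * w i j)"
        by (simp add: distrib_right sum.distrib sum_distrib_left mult.assoc)
      also have "(\<Sum>i\<in>nds. \<Sum>j\<in>nds. \<phi> j x * norm (G i x) * w i j) = ?T"
        by (subst sum.swap) (simp add: sum_distrib_left mult.assoc wsym)
      finally have "\<bar>\<Sum>i\<in>nds. \<Sum>j\<in>nds. (\<phi> i x * norm (G j x) + \<phi> j x * norm (G i x)) * w i j\<bar>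
          \<le> 8 * Cg * \<Lambda> * (h * fro U x)" using T by (simp add: mult_ac)
      also have "\<dots> \<le> 8 * Cg * \<Lambda> * eps U x"
        using h_fro_le_eps Cg \<Lambda> by (intro mult_left_mono) auto
      finally show "\<bar>\<Sum>i\<in>nds. \<Sum>j\<in>nds. (\<phi> i x * norm (G j x) + \<phi> j x * norm (G i x)) * w i j\<bar>
          \<le> 8 * Cg * \<Lambda> * eps U x" .
    qed
    then show "I (\<lambda>x. \<Sum>i\<in>nds. \<Sum>j\<in>nds. (\<phi> i x * norm (G j x) + \<phi> j x * norm (G i x)) * w i j)
        \<le> 8 * Cg * \<Lambda> * E" by linarith
  qed (use M in simp)
  finally show ?thesis by (simp add: abs_mult mult_ac)
qed

lemma sum_cvec:
  assumes "\<And>i j. ebm \<Omega> (\<lambda>x. \<phi> i x * (G j x \<bullet> a i j) * c i j)"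
  shows "(\<Sum>i\<in>nds. \<Sum>j\<in>nds. (cvec L Tr i j \<bullet> a i j) * c i j)
     = I (\<lambda>x. \<Sum>i\<in>nds. \<Sum>j\<in>nds. \<phi> i x * (G j x \<bullet> a i j) * c i j)"
proof -
  have "I (\<lambda>x. \<Sum>i\<in>nds. \<Sum>j\<in>nds. \<phi> i x * (G j x \<bullet> a i j) * c i j)
      = (\<Sum>i\<in>nds. I (\<lambda>x. \<Sum>j\<in>nds. \<phi> i x * (G j x \<bullet> a i j) * c i j))"
    by (rule I_sum[OF finite_nodes]) (intro ebm_sum assms)
  also have "\<dots> = (\<Sum>i\<in>nds. \<Sum>j\<in>nds. I (\<lambda>x. \<phi> i x * (G j x \<bullet> a i j) * c i j))"
    by (intro sum.cong refl I_sum[OF finite_nodes] assms)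
  finally show ?thesis by (simp add: inner_cvec)
qed

text \<open>Tested with \<open>v\<close> itself, the pressure gradient integrates to zero because
  \<open>v\<close> is solenoidal (\<open>R\<close>). What is left is tested with the nodal
  interpolant minus \<open>v\<close> (\<open>Q\<close>), where the second-order bound leaves one h
  after the gradient sum.\<close>

lemma pressure_le:
  "\<bar>\<Sum>i\<in>nds. \<Sum>j\<in>nds. P j * (cvec L Tr i j \<bullet> v i)\<bar> \<le> M * Cg * \<Lambda> * E"
proof -
  define R where "R x = (\<Sum>j\<in>nds. P j * (G j x \<bullet> v x))" for x
  define Q where "Q x = (\<Sum>j\<in>nds. P j * (G j x \<bullet> (fe L Tr v x - v x)))" for x
  have ebm: "ebm \<Omega> R" "ebm \<Omega> Q"
    unfolding R_def Q_def inner_diff_right by (intro ebm_all)+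
  have "(\<Sum>i\<in>nds. \<Sum>j\<in>nds. P j * (cvec L Tr i j \<bullet> v i))
      = I (\<lambda>x. \<Sum>i\<in>nds. \<Sum>j\<in>nds. \<phi> i x * (G j x \<bullet> v i) * P j)"
  proof -
    have "ebm \<Omega> (\<lambda>x. \<phi> i x * (G j x \<bullet> v i) * P j)" for i j by (intro ebm_all)
    from sum_cvec[of "\<lambda>i j. v i" "\<lambda>i j. P j", OF this] show ?thesis by (simp add: mult.commute)
  qed
  also have "\<dots> = I (\<lambda>x. Q x + R x)"
  proof (rule I_cong)
    fix x
    have "(\<Sum>i\<in>nds. \<Sum>j\<in>nds. \<phi> i x * (G j x \<bullet> v i) * P j) = (\<Sum>j\<in>nds. P j * (G j x \<bullet> fe L Tr v x))"
      by (subst sum.swap) (simp add: fe_def inner_sum_right sum_distrib_left mult_ac)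
    also have "\<dots> = Q x + R x"
      unfolding Q_def R_def by (simp add: inner_diff_right right_diff_distrib sum_subtractf)
    finally show "(\<Sum>i\<in>nds. \<Sum>j\<in>nds. \<phi> i x * (G j x \<bullet> v i) * P j) = Q x + R x" .
  qed
  also have "\<dots> = I Q + I R" by (rule I_add[OF ebm(2,1)])
  also have "I R = 0"
  proof (rule I_divergence[of "\<lambda>l y. (\<Sum>j\<in>nds. P j * \<phi> j y) * v y $ l"])
    show "torus_lip L (\<lambda>y. (\<Sum>j\<in>nds. P j * \<phi> j y) * v y $ l)" for l
      by (intro torus_lip_mult torus_lip_sum torus_lip_const phi_torus_lip v_lip)
    fix x assume x: "x \<in> \<Omega> - skeleton"
    have "pd (\<lambda>y. (\<Sum>j\<in>nds. P j * \<phi> j y) * v y $ l) l x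
        = (\<Sum>j\<in>nds. P j * pd (\<phi> j) l x) * v x $ l + (\<Sum>j\<in>nds. P j * \<phi> j x) * dv l l x" for l
      by (intro has_pd_eq has_pd_mult has_pd_sum has_pd_cmult has_pdI finite_nodes phi_differentiable[OF x] v_diff)
    then have "(\<Sum>l\<in>UNIV. pd (\<lambda>y. (\<Sum>j\<in>nds. P j * \<phi> j y) * v y $ l) l x)
        = (\<Sum>l\<in>UNIV. (\<Sum>j\<in>nds. P j * pd (\<phi> j) l x) * v x $ l) + (\<Sum>j\<in>nds. P j * \<phi> j x) * (\<Sum>l\<in>UNIV. dv l l x)"
      by (simp add: sum.distrib sum_distrib_left)
    also have "\<dots> = (\<Sum>l\<in>UNIV. \<Sum>j\<in>nds. P j * pd (\<phi> j) l x * v x $ l)"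
      by (simp add: v_div sum_distrib_right)
    also have "\<dots> = R x"
      unfolding R_def inner_vec_def by (subst sum.swap) (simp add: sum_distrib_left grad_def mult.assoc)
    finally show "R x = (\<Sum>l\<in>UNIV. pd (\<lambda>y. (\<Sum>j\<in>nds. P j * \<phi> j y) * v y $ l) l x)" by simp
  qed
  finally have eq: "(\<Sum>i\<in>nds. \<Sum>j\<in>nds. P j * (cvec L Tr i j \<bullet> v i)) = I Q" by simp
  have "\<bar>I Q\<bar> \<le> M * Cg * \<Lambda> * E"
  proof (rule I_bound[OF ebm(2) ebm_eps])
    fix x assume x: "x \<in> \<Omega> - skeleton"
    have "\<bar>Q x\<bar> \<le> Cg * (M * \<Lambda> * h)"
      unfolding Q_def
    proof (rule grad_sum_bound[OF x, of _ _ "\<lambda>j. M * (\<Lambda> * h\<^sup>2)"])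
      show "0 \<le> M * \<Lambda> * h" using M \<Lambda> meshsize_pos by simp
      show "M * (\<Lambda> * h\<^sup>2) \<le> h * (M * \<Lambda> * h)" by (simp add: power2_eq_square mult_ac)
      fix j assume j: "j \<in> nds"
      have "\<bar>G j x \<bullet> (fe L Tr v x - v x)\<bar> \<le> norm (G j x) * (\<Lambda> * h\<^sup>2)"
        by (rule abs_inner_le) (use v_interp x in \<open>auto simp: norm_minus_commute\<close>)
      then have "\<bar>P j\<bar> * \<bar>G j x \<bullet> (fe L Tr v x - v x)\<bar> \<le> M * (norm (G j x) * (\<Lambda> * h\<^sup>2))"
        using P_le[OF j] by (intro mult_mono) (auto simp: M)
      then show "\<bar>P j * (G j x \<bullet> (fe L Tr v x - v x))\<bar> \<le> norm (G j x) * (M * (\<Lambda> * h\<^sup>2))"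
        by (simp add: abs_mult mult_ac)
    qed
    also have "\<dots> = M * Cg * \<Lambda> * h" by (simp add: mult_ac)
    also have "\<dots> \<le> M * Cg * \<Lambda> * eps U x" using h_le_eps M Cg \<Lambda> by (intro mult_left_mono) auto
    finally show "\<bar>Q x\<bar> \<le> M * Cg * \<Lambda> * eps U x" .
  qed
  then show ?thesis unfolding eq .
qed

abbreviation "S x \<equiv> \<Sum>k\<in>UNIV. \<Sum>l\<in>UNIV. (u x $ k * u x $ l) * dv k l x"

text \<open>\<open>SI\<close> is \<open>S\<close> with \<open>u\<^sub>h \<otimes> u\<^sub>h\<close> replaced by its nodal interpolant, \<open>R\<close> is the density of the
  discrete convection with the nodal test values replaced by \<open>v x\<close>, and \<open>Q\<close> is what this replacement costs.\<close>

definition SI :: "real^'d \<Rightarrow> real" where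
  "SI x = (\<Sum>j\<in>nds. \<phi> j x * (\<Sum>k\<in>UNIV. \<Sum>l\<in>UNIV. (U j $ k * U j $ l) * dv k l x))"

definition R :: "real^'d \<Rightarrow> real" where
  "R x = (\<Sum>j\<in>nds. (G j x \<bullet> ((1/2) *\<^sub>R (u x + U j))) * (U j \<bullet> v x))"

definition Q :: "real^'d \<Rightarrow> real" where
  "Q x = (\<Sum>i\<in>nds. \<phi> i x * (\<Sum>j\<in>nds. (G j x \<bullet> ((1/2) *\<^sub>R (U i + U j))) * (U j \<bullet> (v i - v x))))"

lemma ebm_S: "ebm \<Omega> (\<lambda>x. S x)"
  by (intro ebm_all)

lemma ebm_SI: "ebm \<Omega> SI"
  unfolding SI_def by (intro ebm_all)

lemma ebm_R: "ebm \<Omega> R"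
  unfolding R_def inner_scaleR_right inner_add_right by (intro ebm_all)

lemma ebm_Q: "ebm \<Omega> Q"
  unfolding Q_def inner_diff_right by (intro ebm_all)

lemma ebm_uv_divu: "ebm \<Omega> (\<lambda>x. (u x \<bullet> v x) * divu x)"
  by (intro ebm_all)

text \<open>Once \<open>v i\<close> is replaced by \<open>v x\<close>, the index \<open>i\<close>
  occurs only in the average of \<open>U i\<close> and \<open>U j\<close>. Summing it against the
  basis functions turns \<open>U i\<close> into \<open>u x\<close>.\<close>

lemma convection_split:
  "(\<Sum>i\<in>nds. \<Sum>j\<in>nds. atil L Tr U i j * (U j \<bullet> v i)) = I Q + I R"
proof -
  let ?a = "\<lambda>i j. (1/2) *\<^sub>R (U i + U j)"
  have "(\<Sum>i\<in>nds. \<Sum>j\<in>nds. atil L Tr U i j * (U j \<bullet> v i))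
      = (\<Sum>i\<in>nds. \<Sum>j\<in>nds. (cvec L Tr i j \<bullet> ?a i j) * (U j \<bullet> v i))"
    unfolding atil_def by (simp only: inner_commute)
  also have "\<dots> = I (\<lambda>x. \<Sum>i\<in>nds. \<Sum>j\<in>nds. \<phi> i x * (G j x \<bullet> ?a i j) * (U j \<bullet> v i))"
    by (rule sum_cvec) (intro ebm_all)
  also have "\<dots> = I (\<lambda>x. Q x + R x)"
  proof (rule I_cong)
    fix x
    have "R x = (\<Sum>j\<in>nds. (\<Sum>i\<in>nds. \<phi> i x * (G j x \<bullet> ?a i j)) * (U j \<bullet> v x))"
      unfolding R_def
    proof (intro sum.cong refl arg_cong2[of _ _ _ _ "(*)"])
      fix j
      have "(\<Sum>i\<in>nds. \<phi> i x * (G j x \<bullet> ?a i j))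
          = (G j x \<bullet> u x) / 2 + (\<Sum>i\<in>nds. \<phi> i x) * ((G j x \<bullet> U j) / 2)"
        unfolding fe_def inner_sum_right sum_divide_distrib sum_distrib_right sum.distrib[symmetric]
        by (intro sum.cong refl) (simp add: inner_add_right field_simps)
      then show "G j x \<bullet> ((1/2) *\<^sub>R (u x + U j)) = (\<Sum>i\<in>nds. \<phi> i x * (G j x \<bullet> ?a i j))"
        by (simp add: sum_phi inner_add_right field_simps)
    qed
    also have "\<dots> = (\<Sum>j\<in>nds. \<Sum>i\<in>nds. \<phi> i x * (G j x \<bullet> ?a i j) * (U j \<bullet> v x))"
      by (simp only: sum_distrib_right)
    also have "\<dots> = (\<Sum>i\<in>nds. \<Sum>j\<in>nds. \<phi> i x * (G j x \<bullet> ?a i j) * (U j \<bullet> v x))"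
      by (rule sum.swap)
    finally have Rx: "R x = (\<Sum>i\<in>nds. \<Sum>j\<in>nds. \<phi> i x * (G j x \<bullet> ?a i j) * (U j \<bullet> v x))" .
    show "(\<Sum>i\<in>nds. \<Sum>j\<in>nds. \<phi> i x * (G j x \<bullet> ?a i j) * (U j \<bullet> v i)) = Q x + R x"
      unfolding Q_def Rx sum_distrib_left sum.distrib[symmetric]
      by (intro sum.cong refl) (simp only: inner_diff_right right_diff_distrib mult.assoc diff_add_cancel)
  qed
  also have "\<dots> = I Q + I R" by (rule I_add[OF ebm_Q ebm_R])
  finally show ?thesis .
qed

text \<open>The part of \<open>2 * R\<close> containing \<open>U j\<close> is the divergence of the
  nodal interpolant of the tensor product of the velocity with itself, paired with \<open>v\<close>.
  The part containing \<open>u x\<close> is the advective derivative of the velocity paired with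
  \<open>v\<close>. The product rule for these two fluxes produces \<open>SI\<close>,
  \<open>S\<close> and the divergence term.\<close>

lemma convection_by_parts:
  "2 * I R = - I SI - I (\<lambda>x. S x) - I (\<lambda>x. (u x \<bullet> v x) * divu x)"
proof -
  \<comment> \<open>\<open>?A\<close> is the flux with nodally interpolated products,
    \<open>?B\<close> the flux with products of the finite element function; each is contracted with
    \<open>v\<close>.\<close>
  let ?A = "\<lambda>l y. \<Sum>j\<in>nds. \<Sum>k\<in>UNIV. (U j $ l * U j $ k) * (\<phi> j y * v y $ k)"
  let ?B = "\<lambda>l y. \<Sum>k\<in>UNIV. u y $ l * (u y $ k * v y $ k)"
  let ?du = "\<lambda>k l x. pd (\<lambda>y. u y $ k) l x"
  have "I (\<lambda>x. 2 * R x + SI x + S x + (u x \<bullet> v x) * divu x) = 0"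
  proof (rule I_divergence[of "\<lambda>l y. ?A l y + ?B l y"])
    show "torus_lip L (\<lambda>y. ?A l y + ?B l y)" for l
      by (intro torus_lip_add torus_lip_sum torus_lip_mult torus_lip_const phi_torus_lip v_lip fe_torus_lip)
    fix x assume x: "x \<in> \<Omega> - skeleton"
    have pdA: "has_pd (?A l) l x (\<Sum>j\<in>nds. \<Sum>k\<in>UNIV. (U j $ l * U j $ k) *
        (pd (\<phi> j) l x * v x $ k + \<phi> j x * dv k l x))" for l
      by (intro has_pd_sum has_pd_cmult has_pd_mult has_pdI finite_nodes finite phi_differentiable[OF x] v_diff)
    have pdB: "has_pd (?B l) l x (\<Sum>k\<in>UNIV. ?du l l x * (u x $ k * v x $ k)
        + u x $ l * (?du k l x * v x $ k + u x $ k * dv k l x))" for l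
      by (intro has_pd_sum has_pd_mult has_pdI finite fe_differentiable[OF x] v_diff)
    have a: "(\<Sum>l\<in>UNIV. \<Sum>j\<in>nds. \<Sum>k\<in>UNIV. (U j $ l * U j $ k) * (pd (\<phi> j) l x * v x $ k))
        = (\<Sum>j\<in>nds. (G j x \<bullet> U j) * (U j \<bullet> v x))"
      unfolding inner_vec_def inner_real_def sum_product
      by (rule trans[OF sum.swap], intro sum.cong refl) (simp add: grad_def)
    have b: "(\<Sum>l\<in>UNIV. \<Sum>j\<in>nds. \<Sum>k\<in>UNIV. (U j $ l * U j $ k) * (\<phi> j x * dv k l x)) = SI x"
      unfolding SI_def
      by (rule trans[OF sum.swap], intro sum.cong refl, rule trans[OF sum.swap])
         (simp add: sum_distrib_left mult_ac)
    have c: "(\<Sum>l\<in>UNIV. \<Sum>k\<in>UNIV. ?du l l x * (u x $ k * v x $ k)) = (u x \<bullet> v x) * divu x"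
      unfolding divu_eq[OF x] inner_vec_def by (simp add: sum_product mult.commute)
    have d: "(\<Sum>l\<in>UNIV. \<Sum>k\<in>UNIV. u x $ l * (?du k l x * v x $ k)) = (\<Sum>j\<in>nds. (G j x \<bullet> u x) * (U j \<bullet> v x))"
    proof -
      have "(\<Sum>l\<in>UNIV. \<Sum>k\<in>UNIV. u x $ l * (?du k l x * v x $ k))
          = (\<Sum>l\<in>UNIV. \<Sum>k\<in>UNIV. \<Sum>j\<in>nds. (pd (\<phi> j) l x * u x $ l) * (U j $ k * v x $ k))"
        unfolding pd_fe[OF x] sum_distrib_right sum_distrib_left by (simp only: mult_ac)
      also have "\<dots> = (\<Sum>l\<in>UNIV. \<Sum>j\<in>nds. \<Sum>k\<in>UNIV. (pd (\<phi> j) l x * u x $ l) * (U j $ k * v x $ k))"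
        by (intro sum.cong refl sum.swap)
      also have "\<dots> = (\<Sum>j\<in>nds. \<Sum>l\<in>UNIV. \<Sum>k\<in>UNIV. (pd (\<phi> j) l x * u x $ l) * (U j $ k * v x $ k))"
        by (rule sum.swap)
      finally show ?thesis by (simp add: inner_vec_def grad_def sum_product)
    qed
    have e: "(\<Sum>l\<in>UNIV. \<Sum>k\<in>UNIV. u x $ l * (u x $ k * dv k l x)) = S x"
      by (rule trans[OF sum.swap]) (simp add: mult_ac)
    have r: "2 * R x = (\<Sum>j\<in>nds. (G j x \<bullet> u x) * (U j \<bullet> v x)) + (\<Sum>j\<in>nds. (G j x \<bullet> U j) * (U j \<bullet> v x))"
      unfolding R_def sum_distrib_left sum.distrib[symmetric]
      by (intro sum.cong refl) (simp add: inner_add_right distrib_right)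
    have "(\<Sum>l\<in>UNIV. pd (\<lambda>y. ?A l y + ?B l y) l x)
        = (\<Sum>l\<in>UNIV. (\<Sum>j\<in>nds. \<Sum>k\<in>UNIV. (U j $ l * U j $ k) * (pd (\<phi> j) l x * v x $ k + \<phi> j x * dv k l x))
          + (\<Sum>k\<in>UNIV. ?du l l x * (u x $ k * v x $ k) + u x $ l * (?du k l x * v x $ k + u x $ k * dv k l x)))"
      by (intro sum.cong refl has_pd_eq has_pd_add pdA pdB)
    also have "\<dots> = (\<Sum>j\<in>nds. (G j x \<bullet> U j) * (U j \<bullet> v x)) + SI x + ((u x \<bullet> v x) * divu x
        + ((\<Sum>j\<in>nds. (G j x \<bullet> u x) * (U j \<bullet> v x)) + S x))"
      unfolding a[symmetric] b[symmetric] c[symmetric] d[symmetric] e[symmetric]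
      by (simp only: distrib_left sum.distrib)
    finally show "2 * R x + SI x + S x + (u x \<bullet> v x) * divu x = (\<Sum>l\<in>UNIV. pd (\<lambda>y. ?A l y + ?B l y) l x)"
      using r by linarith
  qed
  moreover have "I (\<lambda>x. 2 * R x + SI x + S x + (u x \<bullet> v x) * divu x)
      = I (\<lambda>x. 2 * R x) + I SI + I (\<lambda>x. S x) + I (\<lambda>x. (u x \<bullet> v x) * divu x)"
    by (simp only: I_add ebm_R ebm_SI ebm_S ebm_uv_divu ebm_add ebm_mult ebm_const)
  ultimately have "2 * I R + I SI + I (\<lambda>x. S x) + I (\<lambda>x. (u x \<bullet> v x) * divu x) = 0" by simp
  then show ?thesis by linarith
qed

text \<open>The difference \<open>v i - v x\<close> only compensates the 1/h of the gradients. The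
  missing factor h D comes from subtracting \<open>u x\<close> from \<open>U j\<close>, again
  because the gradients sum to zero.\<close>

lemma Q_le:
  assumes x: "x \<in> \<Omega> - skeleton"
  shows "\<bar>Q x\<bar> \<le> 2 * M * \<Lambda> * Cg * eps U x"
proof -
  have "\<bar>Q x\<bar> \<le> Cg * (2 * M * \<Lambda> * (h * fro U x))"
    unfolding Q_def
  proof (rule phi_sum_bound)
    fix i assume i: "i \<in> nds" "active i x"
    define b where "b = v i - v x"
    have b: "norm b \<le> \<Lambda> * h" unfolding b_def by (rule v_node[OF x i(2)])
    let ?d = "\<lambda>j. norm (U j - u x)"
    \<comment> \<open>\<open>U j\<close> is replaced by \<open>u x\<close> in one factor at a time.
      The term left over depends on \<open>j\<close> through the gradient alone and drops out of the
      sum.\<close>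
    let ?c = "\<lambda>j. (G j x \<bullet> (U j - u x)) * (U j \<bullet> b) / 2 + (G j x \<bullet> (U i + u x)) * ((U j - u x) \<bullet> b) / 2"
    have "(\<Sum>j\<in>nds. (G j x \<bullet> ((1/2) *\<^sub>R (U i + U j))) * (U j \<bullet> b))
        = (\<Sum>j\<in>nds. ?c j + ((U i + u x) \<bullet> G j x) * ((u x \<bullet> b) / 2))"
      by (intro sum.cong refl)
         (simp add: inner_add_right inner_diff_right inner_diff_left inner_add_left inner_commute[of "G _ x"] algebra_simps
           diff_divide_distrib add_divide_distrib)
    also have "\<dots> = (\<Sum>j\<in>nds. ?c j)"
      by (simp only: sum.distrib sum_distrib_right[symmetric] sum_inner_grad_0[OF x] mult_zero_left add_0_right)
    finally have eq: "(\<Sum>j\<in>nds. (G j x \<bullet> ((1/2) *\<^sub>R (U i + U j))) * (U j \<bullet> b)) = (\<Sum>j\<in>nds. ?c j)" .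
    show "\<bar>\<Sum>j\<in>nds. (G j x \<bullet> ((1/2) *\<^sub>R (U i + U j))) * (U j \<bullet> (v i - v x))\<bar>
        \<le> Cg * (2 * M * \<Lambda> * (h * fro U x))"
      unfolding b_def[symmetric] eq
    proof (rule grad_sum_bound[OF x, of _ _ "\<lambda>j. 2 * M * \<Lambda> * h * ?d j"])
      show "0 \<le> 2 * M * \<Lambda> * (h * fro U x)" using M \<Lambda> fro_nonneg meshsize_pos by simp
      fix j assume j: "j \<in> nds"
      define \<kappa> where "\<kappa> = norm (G j x) * ?d j * (M * (\<Lambda> * h))"
      have "\<bar>(G j x \<bullet> (U j - u x)) * (U j \<bullet> b)\<bar> \<le> (norm (G j x) * ?d j) * (M * (\<Lambda> * h))"
        unfolding abs_mult using M
        by (intro mult_mono[OF abs_inner_le[OF order_refl order_refl] abs_inner_le[OF U_le[OF j] b]]) auto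
      then have 1: "\<bar>(G j x \<bullet> (U j - u x)) * (U j \<bullet> b)\<bar> \<le> \<kappa>" unfolding \<kappa>_def .
      have Ui: "norm (U i + u x) \<le> 2 * M"
        using norm_triangle_ineq[of "U i" "u x"] U_le[OF i(1)] norm_u_le[of x] by linarith
      have "\<bar>(G j x \<bullet> (U i + u x)) * ((U j - u x) \<bullet> b)\<bar> \<le> (norm (G j x) * (2 * M)) * (?d j * (\<Lambda> * h))"
        unfolding abs_mult using M
        by (intro mult_mono[OF abs_inner_le[OF order_refl Ui] abs_inner_le[OF order_refl b]]) auto
      also have "\<dots> = 2 * \<kappa>" unfolding \<kappa>_def by (simp only: mult_ac)
      finally have 2: "\<bar>(G j x \<bullet> (U i + u x)) * ((U j - u x) \<bullet> b)\<bar> \<le> 2 * \<kappa>" .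
      have "0 \<le> \<kappa>" unfolding \<kappa>_def using M \<Lambda> meshsize_pos by simp
      then have "\<bar>?c j\<bar> \<le> 2 * \<kappa>" using 1 2 by linarith
      also have "\<dots> = norm (G j x) * (2 * M * \<Lambda> * h * ?d j)" unfolding \<kappa>_def by (simp only: mult_ac)
      finally show "\<bar>?c j\<bar> \<le> norm (G j x) * (2 * M * \<Lambda> * h * ?d j)" .
      assume "active j x"
      then have "?d j \<le> h * fro U x" by (rule nodal_difference[OF x j])
      then have "(2 * M * \<Lambda> * h) * ?d j \<le> (2 * M * \<Lambda> * h) * (h * fro U x)"
        using M \<Lambda> meshsize_pos by (intro mult_left_mono) auto
      also have "\<dots> = h * (2 * M * \<Lambda> * (h * fro U x))" by (simp only: mult_ac)
      finally show "2 * M * \<Lambda> * h * ?d j \<le> h * (2 * M * \<Lambda> * (h * fro U x))" .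
    qed
  qed
  also have "\<dots> = 2 * M * \<Lambda> * Cg * (h * fro U x)" by (simp add: mult_ac)
  also have "\<dots> \<le> 2 * M * \<Lambda> * Cg * eps U x"
    using h_fro_le_eps M Cg \<Lambda> by (intro mult_left_mono) auto
  finally show ?thesis .
qed

text \<open>Both sides are averaged with the same weights. A difference of products consists of two
  one-factor differences of size h D, each times \<open>M\<close>, and the square of the dimension
  counts the tensor entries.\<close>

lemma SI_le:
  assumes x: "x \<in> \<Omega> - skeleton"
  shows "\<bar>S x - SI x\<bar> \<le> 2 * (real CARD('d))\<^sup>2 * M * \<Lambda> * eps U x"
proof -
  have "S x - SI x = (\<Sum>j\<in>nds. \<phi> j x * S x) - SI x"
    by (simp only: sum_distrib_right[symmetric] sum_phi mult_1)
  also have "\<dots> = (\<Sum>j\<in>nds. \<phi> j x * (\<Sum>k\<in>UNIV. \<Sum>l\<in>UNIV. (u x $ k * u x $ l - U j $ k * U j $ l) * dv k l x))"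
    unfolding SI_def by (simp only: left_diff_distrib right_diff_distrib sum_subtractf)
  finally have eq: "S x - SI x = \<dots>" .
  have "\<bar>S x - SI x\<bar> \<le> real CARD('d) * (real CARD('d) * (2 * M * (h * fro U x) * \<Lambda>))"
    unfolding eq
  proof (rule phi_sum_bound)
    fix j assume j: "j \<in> nds" "active j x"
    have "\<bar>(u x $ k * u x $ l - U j $ k * U j $ l) * dv k l x\<bar> \<le> 2 * M * (h * fro U x) * \<Lambda>" for k l
    proof -
      have c: "\<bar>u x $ k - U j $ k\<bar> \<le> h * fro U x" for k
        using component_le_norm_cart[of "u x - U j" k] nodal_difference[OF x j, of U]
        by (simp add: norm_minus_commute)
      have "u x $ k * u x $ l - U j $ k * U j $ l = (u x $ k - U j $ k) * u x $ l + U j $ k * (u x $ l - U j $ l)"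
        by (simp add: algebra_simps)
      also have "\<bar>\<dots>\<bar> \<le> \<bar>u x $ k - U j $ k\<bar> * \<bar>u x $ l\<bar> + \<bar>U j $ k\<bar> * \<bar>u x $ l - U j $ l\<bar>"
        by (metis abs_mult abs_triangle_ineq)
      also have "\<dots> \<le> (h * fro U x) * M + M * (h * fro U x)"
      proof -
        have 1: "\<bar>u x $ l\<bar> \<le> M" using component_le_norm_cart[of "u x" l] norm_u_le[of x] by linarith
        have 2: "\<bar>U j $ k\<bar> \<le> M" using component_le_norm_cart[of "U j" k] U_le[OF j(1)] by linarith
        have 3: "0 \<le> h * fro U x" using fro_nonneg meshsize_pos by simp
        show ?thesis
          by (rule add_mono[OF mult_mono[OF c 1 3] mult_mono[OF 2 c M]]) simp_all
      qed
      finally have "\<bar>u x $ k * u x $ l - U j $ k * U j $ l\<bar> \<le> 2 * M * (h * fro U x)" by simp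
      then show ?thesis
        unfolding abs_mult using pd_v_le[of x k l] x by (intro mult_mono) (auto simp: M fro_nonneg less_imp_le[OF meshsize_pos])
    qed
    then have "\<bar>\<Sum>l\<in>UNIV. (u x $ k * u x $ l - U j $ k * U j $ l) * dv k l x\<bar>
        \<le> real CARD('d) * (2 * M * (h * fro U x) * \<Lambda>)" for k
      by (intro order_trans[OF sum_abs] sum_bounded_above) 
    then show "\<bar>\<Sum>k\<in>UNIV. \<Sum>l\<in>UNIV. (u x $ k * u x $ l - U j $ k * U j $ l) * dv k l x\<bar>
        \<le> real CARD('d) * (real CARD('d) * (2 * M * (h * fro U x) * \<Lambda>))"
      by (rule order_trans[OF sum_abs sum_bounded_above])
  qed
  also have "\<dots> = 2 * (real CARD('d))\<^sup>2 * M * \<Lambda> * (h * fro U x)" by (simp add: power2_eq_square mult_ac)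
  also have "\<dots> \<le> 2 * (real CARD('d))\<^sup>2 * M * \<Lambda> * eps U x"
    using h_fro_le_eps M \<Lambda> by (intro mult_left_mono) auto
  finally show ?thesis .
qed

text \<open>The test function contains the velocity and has no Lipschitz bound uniform in h. Against
  the nodal values \<open>U k \<bullet> v k\<close> the interpolation error still involves
  differences of \<open>v\<close> only and is O(h), whereas closeness at the nodes holds merely up
  to \<open>eps\<close>.\<close>

lemma uv_divu_le:
  "\<bar>I (\<lambda>x. (u x \<bullet> v x) * divu x)\<bar> \<le> (M * \<Lambda> * Cg + 2 * \<omega> * M * ((M + 1) * \<Lambda>)) * E"
proof (rule div_weak_le[where c = "\<lambda>k. U k \<bullet> v k"])
  show "ebm \<Omega> (\<lambda>x. u x \<bullet> v x)" by (intro ebm_all)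
  show "0 \<le> M * \<Lambda>" "0 \<le> (M + 1) * \<Lambda>" using M \<Lambda> by auto
  fix x assume x: "x \<in> \<Omega> - skeleton"
  have "u x \<bullet> v x - (\<Sum>k\<in>nds. \<phi> k x * (U k \<bullet> v k)) = (\<Sum>k\<in>nds. \<phi> k x * (U k \<bullet> (v x - v k)))"
    unfolding fe_def inner_sum_left by (simp add: inner_diff_right right_diff_distrib sum_subtractf)
  also have "\<bar>\<dots>\<bar> \<le> M * (\<Lambda> * h)"
    by (rule phi_sum_bound, rule abs_inner_le) (use U_le v_node[OF x] in \<open>auto simp: norm_minus_commute\<close>)
  finally show "\<bar>u x \<bullet> v x - (\<Sum>k\<in>nds. \<phi> k x * (U k \<bullet> v k))\<bar> \<le> M * \<Lambda> * h" by simp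
  fix k assume k: "k \<in> nds" "active k x"
  have "U k \<bullet> v k - u x \<bullet> v x = U k \<bullet> (v k - v x) + (U k - u x) \<bullet> v x"
    by (simp add: inner_diff_left inner_diff_right)
  moreover have "\<bar>U k \<bullet> (v k - v x)\<bar> \<le> M * (\<Lambda> * h)"
    by (rule abs_inner_le[OF U_le[OF k(1)] v_node[OF x k(2)]])
  moreover have "\<bar>(U k - u x) \<bullet> v x\<bar> \<le> (h * fro U x) * \<Lambda>"
    by (rule abs_inner_le[OF nodal_difference[OF x k] v_le]) (use x in blast)
  moreover have "M * (\<Lambda> * h) \<le> M * (\<Lambda> * eps U x)"
    using h_le_eps M \<Lambda> by (intro mult_left_mono) auto
  moreover have "(h * fro U x) * \<Lambda> \<le> eps U x * \<Lambda>"
    using h_fro_le_eps \<Lambda> by (intro mult_right_mono) auto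
  ultimately show "\<bar>U k \<bullet> v k - u x \<bullet> v x\<bar> \<le> (M + 1) * \<Lambda> * eps U x"
    by (simp add: algebra_simps)
qed

text \<open>Inserting \<open>convection_by_parts\<close> for the integral of \<open>R\<close> and
  adding that of \<open>S\<close> leaves half the integral of \<open>S - SI\<close> and half the
  divergence term, besides \<open>Q\<close>.\<close>

lemma convection_le:
  "\<bar>(\<Sum>i\<in>nds. \<Sum>j\<in>nds. atil L Tr U i j * (U j \<bullet> v i)) + I (\<lambda>x. S x)\<bar>
    \<le> (2 * M * \<Lambda> * Cg + (real CARD('d))\<^sup>2 * M * \<Lambda> + (M * \<Lambda> * Cg + 2 * \<omega> * M * ((M + 1) * \<Lambda>)) / 2) * E"
proof -
  have Q: "\<bar>I Q\<bar> \<le> 2 * M * \<Lambda> * Cg * E" by (rule I_bound[OF ebm_Q ebm_eps Q_le])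
  have "\<bar>I (\<lambda>x. S x - SI x)\<bar> \<le> 2 * (real CARD('d))\<^sup>2 * M * \<Lambda> * E"
    by (rule I_bound[OF ebm_diff[OF ebm_S ebm_SI] ebm_eps SI_le])
  then have S: "\<bar>I (\<lambda>x. S x) - I SI\<bar> \<le> 2 * ((real CARD('d))\<^sup>2 * M * \<Lambda> * E)"
    unfolding I_diff[OF ebm_S ebm_SI] by (simp only: mult.assoc)
  have "\<bar>q + r + s\<bar> \<le> (x + y + z / 2) * e"
    if "\<bar>q\<bar> \<le> x * e" "\<bar>s - i\<bar> \<le> 2 * (y * e)" "\<bar>d\<bar> \<le> z * e" "2 * r = - i - s - d"
    for q i s d r x y z e :: real
  proof -
    have "(x + y + z / 2) * e = x * e + y * e + (z * e) / 2" by (simp add: algebra_simps)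
    then show ?thesis using that by linarith
  qed
  from this[OF Q S uv_divu_le convection_by_parts] show ?thesis unfolding convection_split .
qed

lemma momentum_tested:
  "(\<Sum>i\<in>nds. mass_lumped L Tr i * (DU i \<bullet> v i))
    = (\<Sum>i\<in>nds. \<Sum>j\<in>nds. D i j * (U j \<bullet> v i)) - (\<Sum>i\<in>nds. \<Sum>j\<in>nds. atil L Tr U i j * (U j \<bullet> v i))
      - (\<Sum>i\<in>nds. \<Sum>j\<in>nds. P j * (cvec L Tr i j \<bullet> v i))"
proof -
  have "mass_lumped L Tr i * (DU i \<bullet> v i)
      = (\<Sum>j\<in>nds. D i j * (U j \<bullet> v i) - atil L Tr U i j * (U j \<bullet> v i) - P j * (cvec L Tr i j \<bullet> v i))"
    if i: "i \<in> nds" for i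
  proof -
    have "mass_lumped L Tr i * (DU i \<bullet> v i) = (mass_lumped L Tr i *\<^sub>R DU i) \<bullet> v i" by simp
    also have "\<dots> = (\<Sum>j\<in>nbrs L Tr i. D i j * (U j \<bullet> v i) - atil L Tr U i j * (U j \<bullet> v i) - P j * (cvec L Tr i j \<bullet> v i))"
      unfolding momentum[OF i] inner_sum_left by (simp add: inner_diff_left left_diff_distrib)
    also have "\<dots> = (\<Sum>j\<in>nds. D i j * (U j \<bullet> v i) - atil L Tr U i j * (U j \<bullet> v i) - P j * (cvec L Tr i j \<bullet> v i))"
      by (rule sum.mono_neutral_left[OF finite_nodes nbrs_subset])
         (use nbrs_self[OF i] in \<open>auto simp: dU_def atil_def cvec_eq_0\<close>)
    finally show ?thesis .
  qed
  then show ?thesis by (simp add: sum_subtractf)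
qed

lemma err_u_le:
  "\<bar>err_u L Tr U DU v\<bar> \<le> (M * \<Lambda> + 2 * M * Cg * \<Lambda> + M * Cg * \<Lambda> + (2 * M * \<Lambda> * Cg
     + (real CARD('d))\<^sup>2 * M * \<Lambda> + (M * \<Lambda> * Cg + 2 * \<omega> * M * ((M + 1) * \<Lambda>)) / 2)) * E"
proof -
  have "\<bar>b - s\<bar> \<le> (x + y + z + w) * e"
    if "\<bar>b - m\<bar> \<le> x * e" "\<bar>t\<bar> \<le> y * e" "\<bar>p\<bar> \<le> z * e" "\<bar>c + s\<bar> \<le> w * e" "m = t - c - p"
    for b c m p s t x y z w e :: real
  proof -
    have "(x + y + z + w) * e = x * e + y * e + z * e + w * e" by (simp add: algebra_simps)
    then show ?thesis using that by (intro abs_leI) linarith+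
  qed
  from this[OF mass_lumping_le upwinding_le pressure_le convection_le momentum_tested]
  show ?thesis unfolding err_u_def .
qed

end

section \<open>Uniform bounds for the smooth test functions\<close>

lemma near_box_enlarged:
  fixes x w L :: "real^'d"
  assumes "x \<in> cbox 0 L" "dist w x \<le> 1"
  shows "w \<in> cbox (-1) (L + 1)"
proof -
  have "- 1 \<le> w $ i \<and> w $ i \<le> L $ i + 1" for i
    using assms(1)[unfolded mem_box_cart, rule_format, of i] component_le_norm_cart[of "w - x" i] assms(2)
    by (auto simp: dist_norm)
  then show ?thesis by (auto simp: mem_box_cart)
qed

lemma compact_norm_bound:
  assumes "compact S" "continuous_on S f"
  obtains C :: real where "0 \<le> C" "\<And>x. x \<in> S \<Longrightarrow> norm (f x) \<le> C"
proof -
  obtain C where C: "\<forall>x\<in>S. norm (f x) \<le> C"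
    using compact_imp_bounded[OF compact_continuous_image[OF assms(2,1)]] unfolding bounded_iff by auto
  show ?thesis by (rule that[of "\<bar>C\<bar>"]) (use C in force)+
qed

lemma C1_on_lipschitz:
  fixes f :: "'a::euclidean_space \<Rightarrow> 'b::real_normed_vector"
  assumes f: "C1_on S f" and Z: "Z \<subseteq> S" "compact Z" "convex Z"
  shows "\<exists>C. C-lipschitz_on Z f"
proof -
  obtain f' where f': "\<And>z. z \<in> S \<Longrightarrow> (f has_derivative blinfun_apply (f' z)) (at z within S)"
    "continuous_on S f'" using f unfolding C1_on_def by blast
  obtain C where C: "0 \<le> C" "\<And>z. z \<in> Z \<Longrightarrow> norm (f' z) \<le> C"
    using compact_norm_bound[OF Z(2) continuous_on_subset[OF f'(2) Z(1)]] by blast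
  have "C-lipschitz_on Z f"
  proof (rule lipschitz_onI[OF _ C(1)])
    fix x y assume xy: "x \<in> Z" "y \<in> Z"
    have "norm (f x - f y) \<le> C * norm (x - y)"
    proof (rule differentiable_bound[OF Z(3) _ _ xy])
      fix z assume z: "z \<in> Z"
      show "(f has_derivative blinfun_apply (f' z)) (at z within Z)"
        using has_derivative_subset[OF f'(1) Z(1)] z Z(1) by blast
      show "onorm (blinfun_apply (f' z)) \<le> C"
        using C(2)[OF z] by (simp add: norm_blinfun.rep_eq)
    qed
    then show "dist (f x) (f y) \<le> C * dist x y" by (simp add: dist_norm)
  qed
  then show ?thesis by blast
qed

lemma C1_torus_lip:
  fixes q :: "real^'d \<Rightarrow> real"
  assumes "C1_on UNIV q" "periodic_fun L q"
  shows "torus_lip L q" "q differentiable at x"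
proof -
  show d: "q differentiable at x" for x
    using assms(1) unfolding C1_on_def by (meson UNIV_I differentiableI)
  show "torus_lip L q"
    unfolding torus_lip_def
    using assms(2) C1_on_lipschitz[OF assms(1) subset_UNIV compact_cbox convex_box(1)] d
    by (intro conjI exI[of _ "{}"]) auto
qed

lemma C2_on_C1_on:
  fixes f :: "'a::euclidean_space \<Rightarrow> 'b::real_normed_vector"
  assumes "C2_on S f"
  shows "C1_on S f"
proof -
  obtain g' where g: "\<forall>z\<in>S. (f has_derivative blinfun_apply (g' z)) (at z within S)" "C1_on S g'"
    using assms unfolding C2_on_def by blast
  then have "continuous_on S g'"
    unfolding C1_on_def by (meson has_derivative_continuous continuous_on_eq_continuous_within)
  then show ?thesis unfolding C1_on_def using g(1) by blast
qed

text \<open>All constants are taken on the compact product of the enlarged box with the time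
  interval, so one \<Lambda> serves all times. The Taylor remainder is quadratic because the
  derivative is itself C1 and hence Lipschitz there.\<close>

lemma C2_test_field_bounds:
  fixes v :: "real^'d \<Rightarrow> real \<Rightarrow> real^'d"
  assumes v: "C2_on (UNIV \<times> {0..T}) (\<lambda>(x, t). v x t)"
    and per: "\<And>t. t \<in> {0..T} \<Longrightarrow> periodic_fun L (\<lambda>x. v x t)"
  obtains \<Lambda> g where "0 \<le> \<Lambda>"
    "\<And>t k. t \<in> {0..T} \<Longrightarrow> torus_lip L (\<lambda>x. v x t $ k)"
    "\<And>t k x. t \<in> {0..T} \<Longrightarrow> (\<lambda>x. v x t $ k) differentiable at x"
    "\<And>t x. t \<in> {0..T} \<Longrightarrow> x \<in> cbox 0 L \<Longrightarrow> norm (v x t) \<le> \<Lambda>"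
    "\<And>t x w. t \<in> {0..T} \<Longrightarrow> x \<in> cbox 0 L \<Longrightarrow> dist w x \<le> 1 \<Longrightarrow> norm (v w t - v x t) \<le> \<Lambda> * dist w x"
    "\<And>t x k l. t \<in> {0..T} \<Longrightarrow> x \<in> cbox 0 L \<Longrightarrow> \<bar>pd (\<lambda>y. v y t $ k) l x\<bar> \<le> \<Lambda>"
    "\<And>t x. t \<in> {0..T} \<Longrightarrow> linear (g t x)"
    "\<And>t x w. t \<in> {0..T} \<Longrightarrow> x \<in> cbox 0 L \<Longrightarrow> dist w x \<le> 1 \<Longrightarrow>
       norm (v w t - v x t - g t x (w - x)) \<le> \<Lambda> * (dist w x)\<^sup>2"
proof -
  let ?S = "UNIV \<times> {0..T} :: ((real^'d) \<times> real) set"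
  let ?B = "cbox (-1) (L + 1) :: (real^'d) set"
  let ?Z = "?B \<times> {0..T}"
  let ?f = "\<lambda>(x, t). v x t"
  have Z: "?Z \<subseteq> ?S" "compact ?Z" "convex ?Z"
    by (auto intro: compact_Times convex_Times convex_box(1))
  obtain f' where f': "\<And>z. z \<in> ?S \<Longrightarrow> (?f has_derivative blinfun_apply (f' z)) (at z within ?S)"
    and f'1: "C1_on ?S f'" using v unfolding C2_on_def by blast
  obtain C2 where C2: "C2-lipschitz_on ?Z f'" using C1_on_lipschitz[OF f'1 Z] by blast
  obtain C1 where C1: "C1-lipschitz_on ?Z ?f" using C1_on_lipschitz[OF C2_on_C1_on[OF v] Z] by blast
  obtain C0 where C0: "0 \<le> C0" "\<And>z. z \<in> ?Z \<Longrightarrow> norm (?f z) \<le> C0"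
    using compact_norm_bound[OF Z(2) lipschitz_on_continuous_on[OF C1]] by blast
  obtain C3 where C3: "0 \<le> C3" "\<And>z. z \<in> ?Z \<Longrightarrow> norm (f' z) \<le> C3"
    using compact_norm_bound[OF Z(2) lipschitz_on_continuous_on[OF C2]] by blast
  note nonneg = lipschitz_on_nonneg[OF C1] lipschitz_on_nonneg[OF C2] C0(1) C3(1)
  define \<Lambda> where "\<Lambda> = C0 + C1 + C2 + C3"
  have \<Lambda>: "0 \<le> \<Lambda>" "C0 \<le> \<Lambda>" "C1 \<le> \<Lambda>" "C2 \<le> \<Lambda>" "C3 \<le> \<Lambda>" using nonneg unfolding \<Lambda>_def by linarith+
  \<comment> \<open>The spatial part of the space-time derivative: it is evaluated on increments
    with zero time component.\<close>
  define g where "g t x y = blinfun_apply (f' (x, t)) (y, 0)" for t x y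
  have der: "((\<lambda>x. v x t) has_derivative g t x) (at x within X)" if t: "t \<in> {0..T}" for t x X
  proof -
    have "((\<lambda>x. (x, t)) has_derivative (\<lambda>y. (y, 0))) (at x)"
      by (auto intro!: derivative_eq_intros)
    \<comment> \<open>In time the derivative exists only within \<open>{0..T}\<close>, one-sided at
      the end points. A time slice lies inside the domain, so the derivative in space is
      nevertheless unrestricted.\<close>
    moreover have "(?f has_derivative blinfun_apply (f' (x, t))) (at (x, t) within range (\<lambda>x. (x, t)))"
      by (rule has_derivative_subset[OF f']) (use t in auto)
    ultimately have "((\<lambda>x. ?f (x, t)) has_derivative (\<lambda>y. blinfun_apply (f' (x, t)) (y, 0))) (at x)"
      using has_derivative_in_compose[of "\<lambda>x. (x, t)" "\<lambda>y. (y, 0)" x UNIV ?f "blinfun_apply (f' (x, t))"] by simp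
    then show ?thesis unfolding g_def using has_derivative_at_withinI by auto
  qed
  have derk: "((\<lambda>x. v x t $ k) has_derivative (\<lambda>y. g t x y $ k)) (at x)" if "t \<in> {0..T}" for t x k
    using bounded_linear.has_derivative[OF bounded_linear_vec_nth der[OF that]] .
  have lipv: "norm (v y t - v x t) \<le> \<Lambda> * dist y x" if "t \<in> {0..T}" "x \<in> ?B" "y \<in> ?B" for t x y
  proof -
    have "dist (?f (y, t)) (?f (x, t)) \<le> C1 * dist (y, t) (x, t)"
      by (rule lipschitz_onD[OF C1]) (use that in auto)
    also have "dist (y, t) (x, t) = dist y x" by (simp add: dist_Pair_Pair)
    also have "C1 * dist y x \<le> \<Lambda> * dist y x" using \<Lambda>(3) by (intro mult_right_mono) auto
    finally show ?thesis by (simp add: dist_norm)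
  qed
  show ?thesis
  proof (rule that[of \<Lambda> g])
    show "0 \<le> \<Lambda>" by (rule \<Lambda>(1))
    fix t assume t: "t \<in> {0..T}"
    show "(\<lambda>x. v x t $ k) differentiable at x" for k x
      using derk[OF t] by (rule differentiableI)
    then show "torus_lip L (\<lambda>x. v x t $ k)" for k
      unfolding torus_lip_def
    proof (intro conjI exI[of _ "{}"] exI[of _ \<Lambda>] lipschitz_onI \<Lambda>(1))
      show "periodic_fun L (\<lambda>x. v x t $ k)"
        using per[OF t] unfolding periodic_fun_def by simp
      fix x y assume "x \<in> ?B" "y \<in> ?B"
      then have "norm (v x t - v y t) \<le> \<Lambda> * dist x y" using lipv[OF t, of y x] by blast
      then show "dist (v x t $ k) (v y t $ k) \<le> \<Lambda> * dist x y"
        using component_le_norm_cart[of "v x t - v y t" k] by (simp add: dist_real_def)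
    qed auto
    fix x :: "real^'d"
    show lin: "linear (g t x)" using has_derivative_linear[OF der[OF t]] by blast
    assume x: "x \<in> cbox 0 L"
    then have xB: "x \<in> ?B" using box_subset_enlarged by blast
    show "norm (v x t) \<le> \<Lambda>" using C0(2)[of "(x, t)"] xB t \<Lambda>(2) by auto
    show "\<bar>pd (\<lambda>y. v y t $ k) l x\<bar> \<le> \<Lambda>" for k l
    proof -
      have "\<bar>pd (\<lambda>y. v y t $ k) l x\<bar> \<le> norm (g t x (axis l 1))"
        unfolding has_derivative_pd[OF derk[OF t]] by (rule component_le_norm_cart)
      also have "\<dots> \<le> norm (f' (x, t)) * norm (axis l 1 :: real^'d, 0::real)"
        unfolding g_def by (rule norm_blinfun)
      also have "\<dots> \<le> \<Lambda>" using C3(2)[of "(x, t)"] xB t \<Lambda>(5) by (simp add: norm_Pair norm_axis_1)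
      finally show ?thesis .
    qed
    fix w assume w: "dist w x \<le> 1"
    then have wB: "w \<in> ?B" using near_box_enlarged[OF x] by blast
    show "norm (v w t - v x t) \<le> \<Lambda> * dist w x" by (rule lipv[OF t xB wB])
    let ?seg = "closed_segment x w"
    have seg: "?seg \<subseteq> ?B" using closed_segment_subset[OF xB wB convex_box(1)] .
    \<comment> \<open>Along the segment the derivative differs from its value at \<open>x\<close> by
      at most \<open>C2 * norm (w - x)\<close>; the mean value estimate contributes the second
      factor \<open>norm (w - x)\<close>.\<close>
    have "norm (v w t - v x t - g t x (w - x)) \<le> norm (w - x) * (C2 * norm (w - x))"
    proof (rule differentiable_bound_linearization[where S = ?seg and f = "\<lambda>x. v x t" and f' = "g t"])
      show "x + s *\<^sub>R (w - x) \<in> ?seg" if "s \<in> {0..1}" for s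
        using that unfolding closed_segment_def by (auto simp: algebra_simps intro!: exI[of _ s])
      show "((\<lambda>x. v x t) has_derivative g t y) (at y within ?seg)" for y by (rule der[OF t])
      show "x \<in> ?seg" by simp
      fix y assume y: "y \<in> ?seg"
      have "norm (f' (y, t) - f' (x, t)) \<le> C2 * dist (y, t) (x, t)"
        using lipschitz_onD[OF C2, of "(y, t)" "(x, t)"] y seg xB t by (auto simp: dist_norm)
      also have "dist (y, t) (x, t) = norm (y - x)" by (simp add: dist_Pair_Pair dist_norm)
      also have "C2 * norm (y - x) \<le> C2 * norm (w - x)"
        using segment_bound1[OF y] nonneg(2) by (intro mult_left_mono) auto
      finally have le: "norm (f' (y, t) - f' (x, t)) \<le> C2 * norm (w - x)" .
      show "onorm (g t y - g t x) \<le> C2 * norm (w - x)"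
      proof (rule onorm_bound)
        show "0 \<le> C2 * norm (w - x)" using nonneg(2) by simp
        fix z
        have "norm ((g t y - g t x) z) = norm (blinfun_apply (f' (y, t) - f' (x, t)) (z, 0))"
          by (simp add: g_def blinfun.diff_left)
        also have "\<dots> \<le> norm (f' (y, t) - f' (x, t)) * norm (z, 0::real)" by (rule norm_blinfun)
        also have "\<dots> \<le> C2 * norm (w - x) * norm z"
          using le by (auto simp: norm_Pair intro: mult_right_mono)
        finally show "norm ((g t y - g t x) z) \<le> C2 * norm (w - x) * norm z" .
      qed
    qed
    also have "\<dots> = C2 * (dist w x)\<^sup>2" by (simp add: dist_norm power2_eq_square)
    also have "\<dots> \<le> \<Lambda> * (dist w x)\<^sup>2" using \<Lambda>(4) by (intro mult_right_mono) auto
    finally show "norm (v w t - v x t - g t x (w - x)) \<le> \<Lambda> * (dist w x)\<^sup>2" .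
  qed
qed

section \<open>Integration in time and the limit of vanishing mesh size\<close>

context torus_mesh
begin

lemma nodes_nonempty: "nds \<noteq> {}"
  using sum_phi[of 0] by auto

text \<open>A quadratic form in the nodal values whose coefficients depend on the mesh alone.
  Continuity in time of the nodal velocities therefore carries over to the seminorm.\<close>

lemma H1semi_sq_quadratic:
  "H1semi_sq L Tr U = (\<Sum>k\<in>UNIV. \<Sum>l\<in>UNIV. \<Sum>i\<in>nds. \<Sum>j\<in>nds.
     U i $ k * U j $ k * I (\<lambda>x. pd (\<phi> i) l x * pd (\<phi> j) l x))"
proof -
  have "H1semi_sq L Tr U = I (\<lambda>x. \<Sum>k\<in>UNIV. \<Sum>l\<in>UNIV. \<Sum>i\<in>nds. \<Sum>j\<in>nds.
      U i $ k * U j $ k * (pd (\<phi> i) l x * pd (\<phi> j) l x))"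
    unfolding H1semi_sq_def
  proof (rule I_cong, intro sum.cong refl)
    fix x k l assume "x \<in> \<Omega> - skeleton"
    then show "(pd (\<lambda>y. fe L Tr U y $ k) l x)\<^sup>2
        = (\<Sum>i\<in>nds. \<Sum>j\<in>nds. U i $ k * U j $ k * (pd (\<phi> i) l x * pd (\<phi> j) l x))"
      by (simp add: pd_fe power2_eq_square sum_product mult_ac)
  qed
  also have "\<dots> = (\<Sum>k\<in>UNIV. \<Sum>l\<in>UNIV. \<Sum>i\<in>nds. \<Sum>j\<in>nds.
      I (\<lambda>x. U i $ k * U j $ k * (pd (\<phi> i) l x * pd (\<phi> j) l x)))"
    by (subst I_sum, simp, intro ebm_sum ebm_mult ebm_const ebm_pd_phi, intro sum.cong refl,
        subst I_sum, simp, intro ebm_sum ebm_mult ebm_const ebm_pd_phi, intro sum.cong refl,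
        subst I_sum, rule finite_nodes, intro ebm_sum ebm_mult ebm_const ebm_pd_phi, intro sum.cong refl,
        rule I_sum, rule finite_nodes, intro ebm_mult ebm_const ebm_pd_phi)
  finally show ?thesis by simp
qed

end

text \<open>No measurability of \<open>e\<close> is needed: a non-integrable integrand has integral 0.\<close>

lemma integral_abs_le_affine:
  fixes e g :: "real \<Rightarrow> real"
  assumes le: "\<And>t. t \<in> {0..T} \<Longrightarrow> \<bar>e t\<bar> \<le> C * (a + b * g t)"
    and g: "g integrable_on {0..T}" and "0 \<le> T" "0 \<le> C" "0 \<le> b" "integral {0..T} g \<le> M"
  shows "integral {0..T} (\<lambda>t. \<bar>e t\<bar>) \<le> C * (a * T + b * M)"
proof -
  have i: "(\<lambda>t. C * (a + b * g t)) integrable_on {0..T}"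
    using integrable_on_cmult_left[OF integrable_add[OF integrable_const_ivl integrable_on_cmult_left[OF g]], of C a b]
    by simp
  have "integral {0..T} (\<lambda>t. \<bar>e t\<bar>) \<le> integral {0..T} (\<lambda>t. C * (a + b * g t))"
  proof (cases "(\<lambda>t. \<bar>e t\<bar>) integrable_on {0..T}")
    case True
    then show ?thesis by (rule integral_le[OF _ i le])
  next
    case False
    then have "integral {0..T} (\<lambda>t. \<bar>e t\<bar>) = 0" by (rule not_integrable_integral)
    also have "0 \<le> integral {0..T} (\<lambda>t. C * (a + b * g t))"
      by (rule integral_nonneg[OF i]) (use le abs_ge_zero order_trans in blast)
    finally show ?thesis .
  qed
  also have "\<dots> = C * integral {0..T} (\<lambda>t. a + b * g t)" by simp
  also have "integral {0..T} (\<lambda>t. a + b * g t) = integral {0..T} (\<lambda>t. a) + integral {0..T} (\<lambda>t. b * g t)"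
    by (rule integral_add[OF integrable_const_ivl integrable_on_cmult_left[OF g, of b, simplified]])
  also have "\<dots> = a * T + b * integral {0..T} g" using \<open>0 \<le> T\<close> by simp
  also have "C * (a * T + b * integral {0..T} g) \<le> C * (a * T + b * M)"
    using assms by (intro mult_left_mono add_left_mono) auto
  finally show ?thesis .
qed

lemma integral_abs_nonneg: "0 \<le> integral S (\<lambda>t. \<bar>e t :: real\<bar>)"
  by (cases "(\<lambda>t. \<bar>e t\<bar>) integrable_on S") (simp_all add: integral_nonneg not_integrable_integral)

lemma sqrt_rate_tendsto_0:
  fixes f h :: "nat \<Rightarrow> real"
  assumes h: "h \<longlonglongrightarrow> 0" and f: "\<forall>\<^sub>F n in sequentially. 0 \<le> f n \<and> f n \<le> C * sqrt (h n)"
  shows "f \<longlonglongrightarrow> 0"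
proof (rule tendsto_sandwich[of "\<lambda>_. 0"])
  show "(\<lambda>n. C * sqrt (h n)) \<longlonglongrightarrow> 0"
    using tendsto_mult_right_zero[OF tendsto_real_sqrt[OF h, simplified]] by simp
  show "\<forall>\<^sub>F n in sequentially. 0 \<le> f n" "\<forall>\<^sub>F n in sequentially. f n \<le> C * sqrt (h n)"
    using f by (auto elim: eventually_mono)
qed simp

theorem theorem3:
  fixes L :: "real^'d"
    and Tr :: "nat \<Rightarrow> (real^'d) set set"
    and Tf \<omega> M :: real
    and u du :: "nat \<Rightarrow> real^'d \<Rightarrow> real \<Rightarrow> real^'d"
    and p :: "nat \<Rightarrow> real^'d \<Rightarrow> real \<Rightarrow> real"
    and \<alpha> :: "nat \<Rightarrow> real^'d \<Rightarrow> real^'d \<Rightarrow> real \<Rightarrow> real"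
    and q :: "real^'d \<Rightarrow> real"
    and v :: "real^'d \<Rightarrow> real \<Rightarrow> real^'d"
  assumes dim: "CARD('d) = 2 \<or> CARD('d) = 3"
    and L_pos: "\<forall>k. 0 < L $ k"
    and Tf_pos: "0 < Tf"
    and omega_pos: "0 < \<omega>"
    and meshes: "\<forall>n. periodic_mesh L (Tr n)"
    and h_to_0: "(\<lambda>n. meshsize (Tr n)) \<longlonglongrightarrow> 0"
    and shape_regular: "\<exists>\<sigma>>0. \<forall>n. \<forall>K\<in>Tr n. diameter (convex hull K) \<le> \<sigma> * inradius K"
    and quasi_uniform: "\<exists>c>0. \<forall>n. \<forall>K\<in>Tr n. c * meshsize (Tr n) \<le> diameter (convex hull K)"
    and alpha: "\<forall>n. \<forall>i\<in>nodes L (Tr n). \<forall>j\<in>nodes L (Tr n). \<forall>t\<in>{0..Tf}.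
                  \<alpha> n i j t = \<alpha> n j i t \<and> 0 \<le> \<alpha> n i j t \<and> \<alpha> n i j t \<le> 1"
    and u_C1: "\<forall>n. \<forall>i\<in>nodes L (Tr n).
                 (\<forall>t\<in>{0..Tf}. (u n i has_vector_derivative du n i t) (at t within {0..Tf}))
                 \<and> continuous_on {0..Tf} (du n i)"
    and S1: "\<forall>n. \<forall>t\<in>{0..Tf}. \<forall>i\<in>nodes L (Tr n).
               mass_lumped L (Tr n) i *\<^sub>R du n i t =
               (\<Sum>j\<in>nbrs L (Tr n) i.
                  (dU L (Tr n) (\<lambda>a b. \<alpha> n a b t) (\<lambda>k. u n k t) i j
                   - atil L (Tr n) (\<lambda>k. u n k t) i j) *\<^sub>R u n j t
                  - p n j t *\<^sub>R cvec L (Tr n) i j)"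
    and S2: "\<forall>n. \<forall>t\<in>{0..Tf}. \<forall>k\<in>nodes L (Tr n).
               0 = (\<Sum>j\<in>nbrs L (Tr n) k.
                      dP L (Tr n) \<omega> k j * p n j t - inner (cvec L (Tr n) k j) (u n j t))"
    and bounds: "\<forall>n. \<forall>i\<in>nodes L (Tr n). \<forall>t\<in>{0..Tf}.
                   norm (u n i t) \<le> M \<and> \<bar>p n i t\<bar> \<le> M \<and> norm (du n i t) \<le> M"
    and H1_bound: "\<forall>n. integral {0..Tf}
                     (\<lambda>t. meshsize (Tr n) * H1semi_sq L (Tr n) (\<lambda>k. u n k t)) \<le> M"
    and q_C1: "C1_on UNIV q" and q_per: "periodic_fun L q"
    and v_C2: "C2_on (UNIV \<times> {0..Tf}) (\<lambda>(x, t). v x t)"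
    and v_per: "\<forall>t\<in>{0..Tf}. periodic_fun L (\<lambda>x. v x t)"
    and v_vanish: "\<exists>\<delta>>0. \<forall>x. \<forall>t\<in>{0..Tf}. Tf - \<delta> < t \<longrightarrow> v x t = 0"
    and v_div: "\<forall>x. \<forall>t\<in>{0..Tf}. (\<Sum>k\<in>UNIV. pd (\<lambda>y. v y t $ k) k x) = 0"
  shows "(\<lambda>n. integral {0..Tf} (\<lambda>t. \<bar>err_q L (Tr n) (\<lambda>k. u n k t) q\<bar>)) \<longlonglongrightarrow> 0
       \<and> (\<lambda>n. integral {0..Tf}
              (\<lambda>t. \<bar>err_u L (Tr n) (\<lambda>k. u n k t) (\<lambda>k. du n k t) (\<lambda>x. v x t)\<bar>)) \<longlonglongrightarrow> 0"
proof -
  obtain \<sigma> where \<sigma>: "0 < \<sigma>" "\<And>n. \<forall>K\<in>Tr n. diameter (convex hull K) \<le> \<sigma> * inradius K"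
    using shape_regular by auto
  obtain c where c: "0 < c" "\<And>n. \<forall>K\<in>Tr n. c * meshsize (Tr n) \<le> diameter (convex hull K)"
    using quasi_uniform by auto
  \<comment> \<open>d+1 vertices per element, each with the gradient bound of
    \<open>gradient_bound_of_shape\<close>; the mesh size is kept separate, so \<open>Cg\<close> is
    the same for all n.\<close>
  define Cg where "Cg = real (CARD('d) + 1) * (4 * \<sigma> / c)"
  have mesh: "torus_mesh L (Tr n)" for n
    using L_pos meshes by (simp add: torus_mesh_def)
  define vol where "vol = measure lborel (cbox 0 L)"
  \<comment> \<open>A node exists because the basis functions sum to 1, and the velocity bound at it
    forces \<open>M\<close> to be nonnegative.\<close>
  have M0: "0 \<le> M"
  proof -
    interpret torus_mesh L "Tr 0" by (rule mesh)
    obtain i where i: "i \<in> nodes L (Tr 0)" using nodes_nonempty by auto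
    have "norm (u 0 i 0) \<le> M" using bounds i Tf_pos by auto
    then show ?thesis using norm_ge_zero order_trans by blast
  qed
  have graded: "inverse_estimate_mesh L (Tr n) Cg" if h1: "meshsize (Tr n) \<le> 1" for n
  proof -
    interpret torus_mesh L "Tr n" by (rule mesh)
    show ?thesis
    proof
      show "meshsize (Tr n) \<le> 1" by (rule h1)
      show "0 \<le> Cg" unfolding Cg_def using \<sigma>(1) c(1) by simp
      fix x assume "x \<in> cbox 0 L - skeleton"
      from sum_norm_grad_phi[OF this gradient_bound_of_shape[OF \<sigma>(2,1) c(2,1)]]
      show "(\<Sum>v\<in>nodes L (Tr n). norm (grad (phi L (Tr n) v) x)) \<le> Cg / meshsize (Tr n)"
        unfolding Cg_def by simp
    qed
  qed
  have state: "scheme_state L (Tr n) Cg (\<lambda>k. u n k t) (\<lambda>k. du n k t) (\<lambda>k. p n k t) (\<lambda>a b. \<alpha> n a b t) \<omega> M"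
    if h1: "meshsize (Tr n) \<le> 1" and t: "t \<in> {0..Tf}" for n t
  proof (intro scheme_state.intro scheme_state_axioms.intro graded[OF h1])
  qed (use omega_pos M0 bounds alpha S1 S2 t in \<open>simp_all\<close>)
  \<comment> \<open>A pointwise-in-time bound becomes a rate: with \<open>sqrt h\<close> factored
    out, the first summand is constant in time and the second is controlled by
    \<open>H1_bound\<close>.\<close>
  have rate: "integral {0..Tf} (\<lambda>t. \<bar>e t\<bar>) \<le> C * (vol * Tf + M) * sqrt (meshsize (Tr n))"
    if h1: "meshsize (Tr n) \<le> 1" and C: "0 \<le> C"
      and e: "\<And>t. t \<in> {0..Tf} \<Longrightarrow> \<bar>e t\<bar> \<le> C * (sqrt (meshsize (Tr n)) * vol
          + meshsize (Tr n) * sqrt (meshsize (Tr n)) * H1semi_sq L (Tr n) (\<lambda>k. u n k t))" for e C n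
  proof -
    interpret torus_mesh L "Tr n" by (rule mesh)
    let ?H = "\<lambda>t. H1semi_sq L (Tr n) (\<lambda>k. u n k t)"
    have "continuous_on {0..Tf} (u n i)" if "i \<in> nds" for i
      using u_C1 that has_vector_derivative_continuous
      unfolding continuous_on_eq_continuous_within by blast
    \<comment> \<open>Integrability has to be established before \<open>H1_bound\<close> is used: a
      bound on an integral that does not exist would only bound the default value 0.\<close>
    then have "continuous_on {0..Tf} ?H"
      unfolding H1semi_sq_quadratic by (intro continuous_intros) auto
    then have int: "(\<lambda>t. h * ?H t) integrable_on {0..Tf}"
      by (intro integrable_continuous_interval continuous_intros)
    have "integral {0..Tf} (\<lambda>t. \<bar>e t\<bar>) \<le> C * ((sqrt h * vol) * Tf + sqrt h * M)"
    proof (rule integral_abs_le_affine[OF _ int])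
      show "\<bar>e t\<bar> \<le> C * (sqrt h * vol + sqrt h * (h * ?H t))" if "t \<in> {0..Tf}" for t
        using e[OF that] by (simp add: mult_ac)
    qed (use Tf_pos C H1_bound meshsize_pos in auto)
    then show ?thesis by (simp add: algebra_simps)
  qed
  \<comment> \<open>The pointwise estimates need \<open>h \<le> 1\<close>, which holds for all large
    n; the limit sees only those.\<close>
  have small: "\<forall>\<^sub>F n in sequentially. meshsize (Tr n) \<le> 1"
    using order_tendstoD(2)[OF h_to_0, of 1] by (auto elim: eventually_mono)
  obtain \<Lambda>q where \<Lambda>q: "\<Lambda>q-lipschitz_on (cbox (-1) (L + 1)) q"
    using C1_torus_lip(1)[OF q_C1 q_per] unfolding torus_lip_def by blast
  have "(\<lambda>n. integral {0..Tf} (\<lambda>t. \<bar>err_q L (Tr n) (\<lambda>k. u n k t) q\<bar>)) \<longlonglongrightarrow> 0"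
  proof (rule sqrt_rate_tendsto_0[OF h_to_0], rule eventually_mono[OF small])
    fix n assume h1: "meshsize (Tr n) \<le> 1"
    let ?C = "\<Lambda>q * Cg + 2 * \<omega> * M * \<Lambda>q"
    interpret g: inverse_estimate_mesh L "Tr n" Cg by (rule graded[OF h1])
    have C0: "0 \<le> ?C"
      using lipschitz_on_nonneg[OF \<Lambda>q] g.Cg omega_pos M0 by (intro add_nonneg_nonneg mult_nonneg_nonneg) auto
    have "integral {0..Tf} (\<lambda>t. \<bar>err_q L (Tr n) (\<lambda>k. u n k t) q\<bar>) \<le> ?C * (vol * Tf + M) * sqrt (meshsize (Tr n))"
    proof (rule rate[OF h1 C0])
      fix t assume t: "t \<in> {0..Tf}"
      interpret scheme_state L "Tr n" Cg "\<lambda>k. u n k t" "\<lambda>k. du n k t" "\<lambda>k. p n k t" "\<lambda>a b. \<alpha> n a b t" \<omega> M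
        by (rule state[OF h1 t])
      show "\<bar>err_q L (Tr n) (\<lambda>k. u n k t) q\<bar> \<le> ?C * (sqrt (meshsize (Tr n)) * vol
          + meshsize (Tr n) * sqrt (meshsize (Tr n)) * H1semi_sq L (Tr n) (\<lambda>k. u n k t))"
        unfolding vol_def g.I_eps[symmetric]
      proof (rule err_q_le[OF C1_torus_lip[OF q_C1 q_per] lipschitz_on_nonneg[OF \<Lambda>q]])
        fix x w assume x: "x \<in> cbox 0 L" and w: "dist w x \<le> meshsize (Tr n)"
        have "dist (q w) (q x) \<le> \<Lambda>q * dist w x"
          using near_box_enlarged[OF x, of w] x w h1 box_subset_enlarged by (intro lipschitz_onD[OF \<Lambda>q]) auto
        also have "\<dots> \<le> \<Lambda>q * meshsize (Tr n)" using w lipschitz_on_nonneg[OF \<Lambda>q] by (rule mult_left_mono)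
        finally show "\<bar>q w - q x\<bar> \<le> \<Lambda>q * meshsize (Tr n)" by (simp add: dist_real_def)
      qed
    qed
    moreover have "0 \<le> integral {0..Tf} (\<lambda>t. \<bar>err_q L (Tr n) (\<lambda>k. u n k t) q\<bar>)"
      by (rule integral_abs_nonneg)
    ultimately show "0 \<le> integral {0..Tf} (\<lambda>t. \<bar>err_q L (Tr n) (\<lambda>k. u n k t) q\<bar>)
        \<and> integral {0..Tf} (\<lambda>t. \<bar>err_q L (Tr n) (\<lambda>k. u n k t) q\<bar>) \<le> ?C * (vol * Tf + M) * sqrt (meshsize (Tr n))"
      by blast
  qed
  moreover
  obtain \<Lambda> g where \<Lambda>: "0 \<le> \<Lambda>"
    and v_lip: "\<And>t k. t \<in> {0..Tf} \<Longrightarrow> torus_lip L (\<lambda>x. v x t $ k)"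
    and v_diff: "\<And>t k x. t \<in> {0..Tf} \<Longrightarrow> (\<lambda>x. v x t $ k) differentiable at x"
    and v_le: "\<And>t x. t \<in> {0..Tf} \<Longrightarrow> x \<in> cbox 0 L \<Longrightarrow> norm (v x t) \<le> \<Lambda>"
    and v_near: "\<And>t x w. t \<in> {0..Tf} \<Longrightarrow> x \<in> cbox 0 L \<Longrightarrow> dist w x \<le> 1 \<Longrightarrow> norm (v w t - v x t) \<le> \<Lambda> * dist w x"
    and pd_v: "\<And>t x k l. t \<in> {0..Tf} \<Longrightarrow> x \<in> cbox 0 L \<Longrightarrow> \<bar>pd (\<lambda>y. v y t $ k) l x\<bar> \<le> \<Lambda>"
    and g: "\<And>t x. t \<in> {0..Tf} \<Longrightarrow> linear (g t x)"
    and taylor: "\<And>t x w. t \<in> {0..Tf} \<Longrightarrow> x \<in> cbox 0 L \<Longrightarrow> dist w x \<le> 1 \<Longrightarrow>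
       norm (v w t - v x t - g t x (w - x)) \<le> \<Lambda> * (dist w x)\<^sup>2"
    using C2_test_field_bounds[OF v_C2, of L] v_per by blast
  \<comment> \<open>The constant of \<open>err_u_le\<close>. It depends neither on n nor on t, since
    \<Lambda> is uniform in time and \<open>Cg\<close> uniform in the mesh.\<close>
  define Cu where "Cu = M * \<Lambda> + 2 * M * Cg * \<Lambda> + M * Cg * \<Lambda> + (2 * M * \<Lambda> * Cg
     + (real CARD('d))\<^sup>2 * M * \<Lambda> + (M * \<Lambda> * Cg + 2 * \<omega> * M * ((M + 1) * \<Lambda>)) / 2)"
  have "(\<lambda>n. integral {0..Tf}
      (\<lambda>t. \<bar>err_u L (Tr n) (\<lambda>k. u n k t) (\<lambda>k. du n k t) (\<lambda>x. v x t)\<bar>)) \<longlonglongrightarrow> 0"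
  proof (rule sqrt_rate_tendsto_0[OF h_to_0], rule eventually_mono[OF small])
    fix n assume h1: "meshsize (Tr n) \<le> 1"
    let ?e = "\<lambda>t. err_u L (Tr n) (\<lambda>k. u n k t) (\<lambda>k. du n k t) (\<lambda>x. v x t)"
    interpret g: inverse_estimate_mesh L "Tr n" Cg by (rule graded[OF h1])
    have C0: "0 \<le> Cu"
      unfolding Cu_def using \<Lambda> g.Cg omega_pos M0
      by (intro add_nonneg_nonneg mult_nonneg_nonneg divide_nonneg_nonneg) auto
    have "integral {0..Tf} (\<lambda>t. \<bar>?e t\<bar>) \<le> Cu * (vol * Tf + M) * sqrt (meshsize (Tr n))"
    proof (rule rate[OF h1 C0])
      fix t assume t: "t \<in> {0..Tf}"
      interpret scheme_state L "Tr n" Cg "\<lambda>k. u n k t" "\<lambda>k. du n k t" "\<lambda>k. p n k t" "\<lambda>a b. \<alpha> n a b t" \<omega> M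
        by (rule state[OF h1 t])
      interpret tested_state L "Tr n" Cg "\<lambda>k. u n k t" "\<lambda>k. du n k t" "\<lambda>k. p n k t" "\<lambda>a b. \<alpha> n a b t" \<omega> M
        "\<lambda>x. v x t" \<Lambda>
      proof
        fix x :: "real^'d" assume x: "x \<in> cbox 0 L"
        show "norm (v w t - v x t) \<le> \<Lambda> * meshsize (Tr n)" if w: "dist w x \<le> meshsize (Tr n)" for w
          using v_near[OF t x, of w] w h1 mult_left_mono[OF w \<Lambda>] by linarith
        show "norm (v x t - fe L (Tr n) (\<lambda>x. v x t) x) \<le> \<Lambda> * (meshsize (Tr n))\<^sup>2"
        proof (rule g.interpolation_second_order[OF _ g[OF t, of x]])
          show "periodic_fun L (\<lambda>x. v x t)" using v_per t by blast
          fix w assume w: "dist w x \<le> meshsize (Tr n)"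
          have "(dist w x)\<^sup>2 \<le> (meshsize (Tr n))\<^sup>2" using w by (intro power_mono) auto
          then show "norm (v w t - v x t - g t x (w - x)) \<le> \<Lambda> * (meshsize (Tr n))\<^sup>2"
            using taylor[OF t x, of w] w h1 mult_left_mono[OF _ \<Lambda>] by fastforce
        qed
      qed (use v_per v_div v_lip[OF t] v_diff[OF t] v_le[OF t] pd_v[OF t] \<Lambda> t in auto)
      show "\<bar>?e t\<bar> \<le> Cu * (sqrt (meshsize (Tr n)) * vol
          + meshsize (Tr n) * sqrt (meshsize (Tr n)) * H1semi_sq L (Tr n) (\<lambda>k. u n k t))"
        unfolding vol_def g.I_eps[symmetric] Cu_def by (rule err_u_le)
    qed
    moreover have "0 \<le> integral {0..Tf} (\<lambda>t. \<bar>?e t\<bar>)"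
      by (rule integral_abs_nonneg)
    ultimately show "0 \<le> integral {0..Tf} (\<lambda>t. \<bar>?e t\<bar>)
        \<and> integral {0..Tf} (\<lambda>t. \<bar>?e t\<bar>) \<le> Cu * (vol * Tf + M) * sqrt (meshsize (Tr n))"
      by blast
  qed
  ultimately show ?thesis by blast
qed

end
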